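(* Let $g\ge 2$ be an integer. The minimal spectral radius $>1$ among all skew-reciprocal primitive matrices $A\in\mathrm{GL}_{2g}(\mathbb{Z})$ exists and equals $\mu_{2g}$, where $\mu_{2g}$ is the largest real root of the polynomial \[ t^{2g}-t^{g+2}-t^{g-2}-1 \] if $g$ is odd, and the largest real root of the polynomial \[ t^{2g}-t^{g+1}-t^{g-1}-1 \] if $g$ is even.
   Context: A matrix is nonnegative if all its coefficients are nonnegative. A nonnegative square matrix is primitive if some power of it has strictly positive coefficients. A matrix is skew-reciprocal if the set of its eigenvalues, counted with multiplicity, is invariant under the transformation $t\mapsto -t^{-1}$. The spectral radius of a matrix is the maximal modulus of its eigenvalues. *)

theory Defs
  imports
    "Jordan_Normal_Form.Spectral_Radius"
begin

definition nonneg_matrix :: "'a :: linordered_idom mat \<Rightarrow> bool" where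
  "nonneg_matrix A \<longleftrightarrow> (\<forall>i < dim_row A. \<forall>j < dim_col A. 0 \<le> A $$ (i, j))"

definition pos_matrix :: "'a :: linordered_idom mat \<Rightarrow> bool" where
  "pos_matrix A \<longleftrightarrow> (\<forall>i < dim_row A. \<forall>j < dim_col A. 0 < A $$ (i, j))"

(* The exponent k > 0 is required so that the zeroth power, the identity matrix,
   does not make every 1 x 1 nonnegative matrix primitive. *)
definition primitive_matrix :: "'a :: linordered_idom mat \<Rightarrow> bool" where
  "primitive_matrix A \<longleftrightarrow>
     square_mat A \<and> nonneg_matrix A \<and> (\<exists>k > 0. pos_matrix (A ^\<^sub>m k))"

definition GL_int :: "nat \<Rightarrow> int mat set" where
  "GL_int n = {A \<in> carrier_mat n n. invertible_mat A}"

abbreviation complex_of_int_mat :: "int mat \<Rightarrow> complex mat" where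
  "complex_of_int_mat A \<equiv> map_mat of_int A"

definition eigenvalue_mset :: "complex mat \<Rightarrow> complex multiset" where
  "eigenvalue_mset A = proots (char_poly A)"

(* The map t \<mapsto> -1/t is undefined at 0, whereas 1 / 0 = 0 in HOL; hence the
   explicit exclusion of the eigenvalue 0. *)
definition skew_reciprocal :: "complex mat \<Rightarrow> bool" where
  "skew_reciprocal A \<longleftrightarrow>
     square_mat A \<and> 0 \<notin># eigenvalue_mset A \<and>
     image_mset (\<lambda>t. - (1 / t)) (eigenvalue_mset A) = eigenvalue_mset A"

definition mu_poly :: "nat \<Rightarrow> real poly" where
  "mu_poly g =
     (if odd g then monom 1 (2 * g) - monom 1 (g + 2) - monom 1 (g - 2) - 1
      else monom 1 (2 * g) - monom 1 (g + 1) - monom 1 (g - 1) - 1)"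

(* The index is g, so this is the number usually written with subscript 2g. *)
definition mu :: "nat \<Rightarrow> real" where
  "mu g = Max {t. poly (mu_poly g) t = 0}"

lemma mu_greatest_root:
  assumes "g \<ge> 2"
  shows "poly (mu_poly g) (mu g) = 0" and "poly (mu_poly g) t = 0 \<Longrightarrow> t \<le> mu g"
proof -
  have "coeff (mu_poly g) (2 * g) = 1"
  proof (cases "odd g")
    case True
    then have "g \<noteq> 2" by auto
    with assms True show ?thesis by (simp add: mu_poly_def)
  next
    case False
    with assms show ?thesis by (simp add: mu_poly_def)
  qed
  then have lead: "lead_coeff (mu_poly g) = 1"
  proof -
    assume *: "coeff (mu_poly g) (2 * g) = 1"
    have "degree (mu_poly g) \<le> 2 * g"
    proof (cases "odd g")
      case True
      with assms have "g + 2 \<le> 2 * g" "g - 2 \<le> 2 * g" by auto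
      with True show ?thesis unfolding mu_poly_def
        by (auto intro!: degree_diff_le intro: order.trans[OF degree_monom_le])
    next
      case False
      with assms have "g + 1 \<le> 2 * g" "g - 1 \<le> 2 * g" by auto
      with False show ?thesis unfolding mu_poly_def
        by (auto intro!: degree_diff_le intro: order.trans[OF degree_monom_le])
    qed
    moreover have "2 * g \<le> degree (mu_poly g)" using * by (intro le_degree) simp
    ultimately show ?thesis using * by simp
  qed
  then have "mu_poly g \<noteq> 0" by auto
  then have fin: "finite {t. poly (mu_poly g) t = 0}" by (rule poly_roots_finite)
  obtain n where n: "poly (mu_poly g) x \<ge> lead_coeff (mu_poly g)" if "x \<ge> n" for x
    using poly_pinfty_gt_lc[of "mu_poly g"] lead by auto
  have neg: "poly (mu_poly g) 1 < 0" by (simp add: mu_poly_def poly_monom)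
  define b where "b = max 2 n"
  have "poly (mu_poly g) b > 0" using n[of b] lead by (simp add: b_def)
  moreover have "1 < b" by (simp add: b_def)
  ultimately obtain x where "poly (mu_poly g) x = 0"
    using poly_IVT_pos[of 1 b "mu_poly g"] neg by auto
  then have "{t. poly (mu_poly g) t = 0} \<noteq> {}" by auto
  from Max_in[OF fin this] show "poly (mu_poly g) (mu g) = 0" by (simp add: mu_def)
  show "poly (mu_poly g) t = 0 \<Longrightarrow> t \<le> mu g"
    using Max_ge[OF fin] by (simp add: mu_def)
qed

end

theory Submission
  imports Defs "HOL-Combinatorics.Orbits" "HOL-Combinatorics.Cycles"
begin

text \<open>Up to sign, the coefficients of the characteristic polynomial of \<open>A\<close> count collections of
  pairwise disjoint cycles in the weighted digraph of \<open>A\<close>, by total length. Let \<open>t\<close> be the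
  reciprocal of the spectral radius. A Perron vector forces \<open>t ^ p + t ^ q \<le> 1\<close> for any two
  different cycles of lengths \<open>p\<close> and \<open>q\<close> that meet, and
  \<open>t ^ (2 * g) \<le> (1 - t ^ p) * (1 - t ^ q)\<close> for disjoint ones if \<open>1 / 8 < t ^ (2 * g)\<close>.
  Skew-reciprocity pairs the coefficients at \<open>m\<close> and \<open>2 * g - m\<close>, so that the characteristic
  equation becomes an identity between the coefficients up to the middle one.
  If the spectral radius were less than \<open>mu g\<close>, then for \<open>g \<noteq> 3\<close> the power \<open>t ^ g\<close> would exceed
  \<open>(3 - sqrt 5) / 2\<close>; then disjoint cycles have total length greater than \<open>g\<close>, the coefficients
  up to the middle one are at most \<open>0\<close>, and the identity contradicts the inequalities for the few
  cycle lengths that remain. Primitivity enters through the uniqueness of the dominant root, which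
  excludes coefficients supported on multiples of a common divisor. The case \<open>g = 3\<close> needs a
  separate argument. The companion matrix of the polynomial defining \<open>mu g\<close> attains the bound.\<close>

subsection \<open>Coefficients of the characteristic polynomial\<close>

text \<open>Put \<open>p i j = t * B i j * v j / v i\<close>. The Perron inequality makes
  \<open>p\<close> substochastic. Along a cycle the entries of \<open>v\<close> cancel, so a cycle
  of length \<open>k\<close> has probability at least \<open>t ^ k\<close>, and so has each of its
  edges. All cycle inequalities describe how such probabilities share the total 1 at a vertex. The
  exponents of the polynomial come from parity: the lower one is the largest odd number below
  \<open>g\<close>. For determinant -1, an odd cycle length \<open>j < g\<close> would need
  \<open>t ^ j + t ^ (2 * g - j) + t ^ (2 * g) \<le> 1\<close>, which fails once
  \<open>1 / t < mu g\<close>. The constant \<open>(3 - sqrt 5) / 2\<close> is the root of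
  \<open>(1 - x)^2 = x\<close> in the unit interval: for \<open>x = t ^ g\<close> above it,
  \<open>t ^ p * t ^ q \<ge> x\<close> contradicts
  \<open>(1 - t ^ p) * (1 - t ^ q) \<ge> x^2\<close>. The main device against the remaining lengths:
  a negative coefficient below the middle forces, depending on parity and determinant, a positive
  one above it. Only a disjoint pair of cycles can produce that, and the pair supplies further
  lengths to put into the identity.\<close>

lemma sign_cycle_of_list:
  assumes "distinct cs" "cs \<noteq> []"
  shows "sign (cycle_of_list cs) = - ((- 1) ^ length cs)"
  using assms
proof (induction cs rule: cycle_of_list.induct)
  case (1 i j cs)
  have "sign (cycle_of_list (i # j # cs)) = sign (transpose i j) * sign (cycle_of_list (j # cs))"
    using sign_compose[OF permutation_swap_id permutation_of_cycle] by simp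
  with 1 show ?case by (simp add: sign_swap_id del: cycle_of_list.simps)
qed auto

text \<open>\<open>support \<pi> s\<close> lists the orbit of \<open>s\<close>; the cycle of this
  list agrees with \<open>\<pi>\<close> on \<open>S\<close> and, like \<open>\<pi>\<close>, fixes
  all other points.\<close>

lemma sign_cyclic_on:
  assumes "\<pi> permutes S" "finite S" "cyclic_on \<pi> S"
  shows "sign \<pi> = - ((- 1) ^ card S)"
proof -
  have perm: "permutation \<pi>" using assms by (auto simp: permutation_permutes)
  obtain s where s: "s \<in> S" "S = orbit \<pi> s" using assms(3) by (auto simp: cyclic_on_def)
  let ?cs = "support \<pi> s"
  have set_cs: "set ?cs = S"
    unfolding support_set[OF perm] s(2) orbit_altdef_permutation[OF perm] by auto
  have dist: "distinct ?cs" by (rule cycle_of_permutation[OF perm])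
  have "cycle_of_list ?cs x = \<pi> x" for x
  proof (cases "x \<in> S")
    case True
    then show ?thesis using cycle_restrict[OF perm, of x s] set_cs by simp
  next
    case False
    then show ?thesis
      using id_outside_supp[of x ?cs] set_cs assms(1) by (simp add: permutes_not_in)
  qed
  then have "\<pi> = cycle_of_list ?cs" by auto
  moreover have "length ?cs = card S" using set_cs dist distinct_card by fastforce
  moreover have "?cs \<noteq> []" using set_cs s(1) by (metis empty_iff empty_set)
  ultimately show ?thesis using sign_cycle_of_list[OF dist] by metis
qed

lemma permutes_fixing_iff:
  assumes "X \<subseteq> U"
  shows "\<pi> permutes U \<and> (\<forall>i\<in>X. \<pi> i = i) \<longleftrightarrow> \<pi> permutes (U - X)"
  using assms by (auto simp: permutes_def)

lemma coeff_signof_mult: "coeff (signof \<pi> * p) m = signof \<pi> * coeff p m"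
  by (cases \<pi> rule: sign_cases) simp_all

text \<open>In the Leibniz expansion every factor is split into its variable part, present only if
  \<open>\<pi> i = i\<close>, and its constant part. \<open>X\<close> is the set of rows where the
  variable is chosen: these are fixed points, they give the degree \<open>card X\<close>, and
  \<open>\<pi>\<close> permutes the complement \<open>S\<close>.\<close>

lemma coeff_char_poly:
  fixes A :: "'a :: comm_ring_1 mat"
  assumes A: "A \<in> carrier_mat n n" and m: "m \<le> n"
  shows "coeff (char_poly A) (n - m) =
    (\<Sum>S | S \<subseteq> {0..<n} \<and> card S = m. \<Sum>\<pi> | \<pi> permutes S.
       (- 1) ^ m * signof \<pi> * (\<Prod>i\<in>S. A $$ (i, \<pi> i)))"
proof -
  let ?U = "{0..<n}"
  define G where "G X \<pi> = signof \<pi> * (\<Prod>i\<in>?U - X. - A $$ (i, \<pi> i))" for X \<pi>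
  have CA: "char_poly_matrix A \<in> carrier_mat n n" using A by simp
  have "char_poly A = (\<Sum>\<pi> | \<pi> permutes ?U. signof \<pi> * (\<Prod>i\<in>?U. char_poly_matrix A $$ (i, \<pi> i)))"
    unfolding char_poly_def det_def'[OF CA] ..
  also have "\<dots> = (\<Sum>\<pi> | \<pi> permutes ?U. signof \<pi> * (\<Sum>X\<in>Pow ?U.
      (\<Prod>i\<in>X. [:0, of_bool (\<pi> i = i):]) * (\<Prod>i\<in>?U - X. [:- A $$ (i, \<pi> i):])))"
  proof (rule sum.cong[OF refl], goal_cases)
    case (1 \<pi>)
    then have "\<pi> permutes ?U" by simp
    then have "i < n \<Longrightarrow> \<pi> i < n" for i using permutes_in_image[of \<pi> ?U i] by simp
    then have "(\<Prod>i\<in>?U. char_poly_matrix A $$ (i, \<pi> i)) =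
       (\<Prod>i\<in>?U. [:0, of_bool (\<pi> i = i):] + [:- A $$ (i, \<pi> i):])"
      using A by (intro prod.cong) (auto simp: char_poly_matrix_def)
    then show ?case unfolding prod_add[OF finite_atLeastLessThan] by simp
  qed
  finally have "coeff (char_poly A) (n - m) = (\<Sum>\<pi> | \<pi> permutes ?U. \<Sum>X\<in>Pow ?U. signof \<pi> *
      coeff ((\<Prod>i\<in>X. [:0, of_bool (\<pi> i = i):]) * (\<Prod>i\<in>?U - X. [:- A $$ (i, \<pi> i):])) (n - m))"
    by (simp only: coeff_sum coeff_signof_mult sum_distrib_left)
  also have "\<dots> = (\<Sum>\<pi> | \<pi> permutes ?U. \<Sum>X\<in>Pow ?U.
      if (\<forall>i\<in>X. \<pi> i = i) \<and> card X = n - m then G X \<pi> else 0)"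
  proof (intro sum.cong refl, goal_cases)
    case (1 \<pi> X)
    have fin: "finite X" using 1 finite_subset by auto
    have c: "(\<Prod>i\<in>Y. [:f i:]) = [:\<Prod>i\<in>Y. f i:]" if "finite Y" for Y and f :: "nat \<Rightarrow> 'a"
      using that by induction (auto simp: one_pCons)
    show ?case
    proof (cases "\<forall>i\<in>X. \<pi> i = i")
      case True
      then have "(\<Prod>i\<in>X. [:0, of_bool (\<pi> i = i):]) = (\<Prod>i\<in>X. [:0, 1:] :: 'a poly)"
        by (intro prod.cong) auto
      also have "\<dots> = monom 1 (card X)" by (simp add: monom_altdef)
      finally show ?thesis using True
        by (simp add: c G_def)
    next
      case False
      then have "(\<Prod>i\<in>X. [:0, of_bool (\<pi> i = i):]) = (0 :: 'a poly)"
        using fin by (intro prod_zero) auto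
      then show ?thesis using False by auto
    qed
  qed
  also have "\<dots> = (\<Sum>X\<in>Pow ?U. \<Sum>\<pi> | \<pi> permutes ?U.
      if (\<forall>i\<in>X. \<pi> i = i) \<and> card X = n - m then G X \<pi> else 0)"
    by (rule sum.swap)
  also have "\<dots> = (\<Sum>X\<in>{X\<in>Pow ?U. card X = n - m}. \<Sum>\<pi> | \<pi> permutes (?U - X). G X \<pi>)"
  proof (rule sum.mono_neutral_cong_right, goal_cases)
    case (4 X)
    then have "{\<pi>. \<pi> permutes (?U - X)} = {\<pi>. \<pi> permutes ?U \<and> (\<forall>i\<in>X. \<pi> i = i)}"
      by (subst permutes_fixing_iff[symmetric]) auto
    then show ?case using 4
      by (simp add: sum.inter_filter[symmetric] finite_permutations)
  qed auto
  also have "\<dots> = (\<Sum>S | S \<subseteq> ?U \<and> card S = m. \<Sum>\<pi> | \<pi> permutes S. G (?U - S) \<pi>)"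
    by (rule sum.reindex_bij_witness[of _ "\<lambda>S. ?U - S" "\<lambda>S. ?U - S"])
       (use m in \<open>auto simp: card_Diff_subset finite_subset double_diff Diff_Diff_Int
          Int_absorb1 subset_eq_atLeast0_lessThan_finite\<close>)
  also have "\<dots> = (\<Sum>S | S \<subseteq> ?U \<and> card S = m. \<Sum>\<pi> | \<pi> permutes S.
       (- 1) ^ m * signof \<pi> * (\<Prod>i\<in>S. A $$ (i, \<pi> i)))"
    by (intro sum.cong refl) (auto simp: G_def Int_absorb1 double_diff prod_uminus)
  finally show ?thesis .
qed

subsection \<open>Cycles and Perron vectors\<close>

locale perron_graph =
  fixes n :: nat and B :: "nat \<Rightarrow> nat \<Rightarrow> int" and v :: "nat \<Rightarrow> real" and t :: real
  assumes B_nonneg: "i < n \<Longrightarrow> j < n \<Longrightarrow> 0 \<le> B i j"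
    and v_pos: "i < n \<Longrightarrow> 0 < v i"
    and t_pos: "0 < t" and t_less_1: "t < 1"
    and v_super: "i < n \<Longrightarrow> t * (\<Sum>j<n. B i j * v j) \<le> v i"
    and irreducible: "i < n \<Longrightarrow> j < n \<Longrightarrow>
      \<exists>f m. f 0 = i \<and> f m = j \<and> (\<forall>l<m. f l < n \<and> f (Suc l) < n \<and> 0 < B (f l) (f (Suc l)))"
begin

definition edge :: "nat \<Rightarrow> nat \<Rightarrow> bool" where
  "edge i j \<longleftrightarrow> i < n \<and> j < n \<and> 0 < B i j"

definition wt :: "nat set \<Rightarrow> (nat \<Rightarrow> nat) \<Rightarrow> int" where
  "wt S \<pi> = (\<Prod>i\<in>S. B i (\<pi> i))"

definition cyc :: "nat set \<Rightarrow> (nat \<Rightarrow> nat) \<Rightarrow> bool" where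
  "cyc S \<pi> \<longleftrightarrow> S \<subseteq> {0..<n} \<and> \<pi> permutes S \<and> cyclic_on \<pi> S \<and> 0 < wt S \<pi>"

lemma term_nonneg: "i < n \<Longrightarrow> j < n \<Longrightarrow> 0 \<le> B i j * v j"
  using B_nonneg v_pos by (simp add: less_imp_le)

lemma edge_le: assumes "edge i j" shows "t * (B i j * v j) \<le> v i"
proof -
  have "B i j * v j \<le> (\<Sum>j<n. B i j * v j)"
    using assms term_nonneg by (intro member_le_sum) (auto simp: edge_def)
  then have "t * (B i j * v j) \<le> t * (\<Sum>j<n. B i j * v j)"
    using t_pos by (intro mult_left_mono) auto
  also have "\<dots> \<le> v i" using assms v_super by (auto simp: edge_def)
  finally show ?thesis .
qed

lemma edge_le_mult:
  assumes "edge i j" "c \<le> B i j" shows "of_int c * (t * v j) \<le> v i"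
proof -
  have "of_int c * (t * v j) \<le> of_int (B i j) * (t * v j)"
    using assms v_pos[of j] t_pos by (intro mult_right_mono) (auto simp: edge_def)
  also have "\<dots> = t * (B i j * v j)" by simp
  finally show ?thesis using edge_le[OF assms(1)] by linarith
qed

lemma edge_le_one: "edge i j \<Longrightarrow> t * v j \<le> v i"
  using edge_le_mult[of i j 1] by (simp add: edge_def)

lemma two_edges_le:
  assumes "edge i j" "edge i k" "j \<noteq> k" shows "t * v j + t * v k \<le> v i"
proof -
  have *: "1 * v l \<le> B i l * v l" if "edge i l" for l
    using that v_pos[of l] by (intro mult_right_mono) (auto simp: edge_def)
  have "v j + v k \<le> B i j * v j + B i k * v k"
    using *[OF assms(1)] *[OF assms(2)] by linarith
  also have "\<dots> = (\<Sum>j\<in>{j, k}. B i j * v j)" using assms by simp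
  also have "\<dots> \<le> (\<Sum>j<n. B i j * v j)"
    using assms term_nonneg by (intro sum_mono2) (auto simp: edge_def)
  finally have "t * (v j + v k) \<le> t * (\<Sum>j<n. B i j * v j)"
    using t_pos by (intro mult_left_mono) auto
  also have "\<dots> \<le> v i" using assms v_super by (auto simp: edge_def)
  finally show ?thesis by (simp add: algebra_simps)
qed

lemma walk_le:
  assumes "\<And>l. i \<le> l \<Longrightarrow> l < j \<Longrightarrow> edge (f l) (f (Suc l))" "i \<le> j"
  shows "t ^ (j - i) * v (f j) \<le> v (f i)"
  using assms(2,1)
proof (induction j rule: dec_induct)
  case (step j)
  have "t ^ (Suc j - i) * v (f (Suc j)) = t ^ (j - i) * (t * v (f (Suc j)))"
    using step by (simp add: Suc_diff_le)
  also have "\<dots> \<le> t ^ (j - i) * v (f j)"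
    using step t_pos edge_le_one by (intro mult_left_mono) auto
  finally show ?case using step by auto
qed simp

lemma finite_cyc: "cyc S \<pi> \<Longrightarrow> finite S"
  using finite_subset by (auto simp: cyc_def)

lemma cyc_ne: "cyc S \<pi> \<Longrightarrow> S \<noteq> {}"
  by (auto simp: cyc_def cyclic_on_def)

lemma card_cyc: "cyc S \<pi> \<Longrightarrow> 0 < card S \<and> card S \<le> n"
  using finite_cyc cyc_ne card_mono[of "{0..<n}" S] by (auto simp: cyc_def card_gt_0_iff)

lemma cyc_in: "cyc S \<pi> \<Longrightarrow> \<pi> i \<in> S \<longleftrightarrow> i \<in> S"
  by (simp add: cyc_def permutes_in_image)

lemma cyc_edge: assumes "cyc S \<pi>" "i \<in> S" shows "edge i (\<pi> i)"
proof -
  have "\<pi> i \<in> S" using assms cyc_in by blast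
  then have "i < n" "\<pi> i < n" using assms by (auto simp: cyc_def)
  moreover have "B i (\<pi> i) \<noteq> 0"
  proof
    assume "B i (\<pi> i) = 0"
    then have "wt S \<pi> = 0" using assms finite_cyc by (auto simp: wt_def)
    then show False using assms by (simp add: cyc_def)
  qed
  ultimately show ?thesis using B_nonneg[of i "\<pi> i"] by (simp add: edge_def)
qed

text \<open>Following the cycle, \<open>b\<close> is reached from \<open>a\<close> in at most
  \<open>card S - 1\<close> steps; since \<open>t < 1\<close>, the largest exponent is a bound for
  all positions.\<close>

lemma cyc_walk:
  assumes c: "cyc S \<pi>" and a: "a \<in> S" and b: "b \<in> S"
  shows "t ^ (card S - 1) * v b \<le> v a"
proof -
  have S: "S = orbit \<pi> a" using c a by (auto simp: cyc_def dest: orbit_cyclic_eq3)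
  let ?N = "funpow_dist1 \<pi> a a"
  have aa: "a \<in> orbit \<pi> a" using S a by simp
  have im: "S = (\<lambda>m. (\<pi> ^^ m) a) ` {0..<?N}" using orbit_conv_funpow_dist1[OF aa] S by simp
  have "card S = ?N" unfolding im using card_image[OF inj_on_funpow_dist1[OF aa]] by simp
  then obtain m where m: "m < card S" "(\<pi> ^^ m) a = b" using b im by auto
  have inS: "(\<pi> ^^ l) a \<in> S" for l using a cyc_in[OF c] by (induction l) auto
  have "t ^ (m - 0) * v ((\<pi> ^^ m) a) \<le> v ((\<pi> ^^ 0) a)"
    by (rule walk_le) (use inS cyc_edge[OF c] in auto)
  then have "t ^ m * v b \<le> v a" using m by simp
  moreover have "t ^ (card S - 1) * v b \<le> t ^ m * v b"
  proof (rule mult_right_mono)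
    show "t ^ (card S - 1) \<le> t ^ m" using m t_pos t_less_1 by (intro power_decreasing) auto
    show "0 \<le> v b" using v_pos[of b] b c by (auto simp: cyc_def)
  qed
  ultimately show ?thesis by linarith
qed

text \<open>Every edge of a cycle has probability at least that of the whole cycle: the walk from
  \<open>\<pi> a\<close> back to \<open>a\<close> has \<open>card S - 1\<close> edges, and the extra
  factor \<open>t\<close> stands for the edge leaving \<open>a\<close>.\<close>

lemma cyc_return:
  assumes c: "cyc S \<pi>" and a: "a \<in> S"
  shows "t ^ card S * v a \<le> t * v (\<pi> a)"
proof -
  have "t ^ (card S - 1) * v a \<le> v (\<pi> a)" using cyc_walk[OF c] cyc_in[OF c] a by blast
  then have "t * (t ^ (card S - 1) * v a) \<le> t * v (\<pi> a)" using t_pos by simp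
  moreover have "t * t ^ (card S - 1) = t ^ card S"
    using card_cyc[OF c] by (simp flip: power_Suc)
  ultimately show ?thesis by (metis mult.assoc)
qed

lemma cyc_exit:
  assumes "cyc S \<pi>" "a \<in> S" "edge a c" "c \<noteq> \<pi> a"
  shows "t * v c \<le> (1 - t ^ card S) * v a"
  using two_edges_le[OF assms(3) cyc_edge[OF assms(1,2)]] assms cyc_return[OF assms(1,2)]
  by (simp add: algebra_simps)

text \<open>If both cycles had the same successor at every common vertex, the orbit of a common
  vertex would be the same under both, and the cycles would be equal. At a common vertex with two
  successors, these claim the shares \<open>t ^ card S\<close> and \<open>t ^ card S'\<close> of the
  total 1.\<close>

lemma cyc_meet:
  assumes c: "cyc S \<pi>" and c': "cyc S' \<pi>'" and "S \<inter> S' \<noteq> {}" and ne: "\<not> (S = S' \<and> \<pi> = \<pi>')"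
  shows "t ^ card S + t ^ card S' \<le> 1"
proof -
  have "\<exists>i\<in>S \<inter> S'. \<pi> i \<noteq> \<pi>' i"
  proof (rule ccontr)
    assume "\<not> ?thesis"
    then have eq: "\<pi> i = \<pi>' i" if "i \<in> S" "i \<in> S'" for i using that by auto
    obtain a where a: "a \<in> S" "a \<in> S'" using assms by auto
    have *: "X \<subseteq> Y" if XY: "cyc X p" "cyc Y q" "a \<in> X" "a \<in> Y"
      "\<And>i. i \<in> X \<Longrightarrow> i \<in> Y \<Longrightarrow> p i = q i" for X Y p q
    proof -
      have X: "X = orbit p a" using XY by (auto simp: cyc_def dest: orbit_cyclic_eq3)
      have "x \<in> X \<and> x \<in> Y" if "x \<in> orbit p a" for x
        using that
      proof induction
        case base
        then show ?case using cyc_in[OF XY(1), of a] cyc_in[OF XY(2), of a] XY(3-5) by simp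
      next
        case (step y)
        then show ?case using cyc_in[OF XY(1), of y] cyc_in[OF XY(2), of y] XY(5) by simp
      qed
      then show ?thesis using X by auto
    qed
    have "S = S'"
      using *[OF c c' a eq] *[OF c' c a(2,1)] eq by (metis subset_antisym)
    moreover have "\<pi> = \<pi>'"
    proof
      fix i
      show "\<pi> i = \<pi>' i"
      proof (cases "i \<in> S")
        case True
        then show ?thesis using eq \<open>S = S'\<close> by simp
      next
        case False
        then have "\<pi> i = i" "\<pi>' i = i"
          using c c' \<open>S = S'\<close> by (auto simp: cyc_def intro: permutes_not_in)
        then show ?thesis by simp
      qed
    qed
    ultimately show False using ne by simp
  qed
  then obtain i where i: "i \<in> S" "i \<in> S'" "\<pi> i \<noteq> \<pi>' i" by auto
  have "t * v (\<pi> i) + t * v (\<pi>' i) \<le> v i"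
    by (rule two_edges_le) (use i cyc_edge c c' in auto)
  then have "(t ^ card S + t ^ card S') * v i \<le> 1 * v i"
    using cyc_return[OF c i(1)] cyc_return[OF c' i(2)] by (simp add: algebra_simps)
  moreover have "v i > 0" using v_pos[of i] i c by (auto simp: cyc_def)
  ultimately show ?thesis by simp
qed

text \<open>Some entry on the cycle is at least 2 and acts like two parallel edges, so the cycle
  meets a copy of itself as in \<open>cyc_meet\<close>.\<close>

lemma cyc_heavy:
  assumes c: "cyc S \<pi>" and w: "2 \<le> wt S \<pi>"
  shows "2 * t ^ card S \<le> 1"
proof -
  have "\<exists>i\<in>S. B i (\<pi> i) \<noteq> 1"
  proof (rule ccontr)
    assume "\<not> ?thesis"
    then have "wt S \<pi> = 1" by (simp add: wt_def)
    then show False using w by simp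
  qed
  then obtain i where i: "i \<in> S" "B i (\<pi> i) \<noteq> 1" by auto
  have "edge i (\<pi> i)" by (rule cyc_edge[OF c i(1)])
  then have "2 * (t * v (\<pi> i)) \<le> v i"
    using edge_le_mult[of i "\<pi> i" 2] i by (simp add: edge_def)
  then have "(2 * t ^ card S) * v i \<le> 1 * v i"
    using cyc_return[OF c i(1)] by (simp add: algebra_simps)
  moreover have "v i > 0" using v_pos[of i] i c by (auto simp: cyc_def)
  ultimately show ?thesis by simp
qed

text \<open>In a walk of minimal length no vertex recurs, as the loop could be cut out, and no inner
  vertex lies in \<open>X\<close> or \<open>Y\<close>, as an end could be cut off.\<close>

lemma shortest_path:
  assumes X: "X \<subseteq> {0..<n}" "X \<noteq> {}" and Y: "Y \<subseteq> {0..<n}" "Y \<noteq> {}" and XY: "X \<inter> Y = {}"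
  obtains f p where "0 < p" "f 0 \<in> X" "f p \<in> Y" "\<And>l. l < p \<Longrightarrow> edge (f l) (f (Suc l))"
    "inj_on f {1..<p}" "f ` {1..<p} \<subseteq> {0..<n} - (X \<union> Y)"
proof -
  define P where "P f p \<longleftrightarrow> f 0 \<in> X \<and> f p \<in> Y \<and> (\<forall>l<p. edge (f l) (f (Suc l)))"
    for f :: "nat \<Rightarrow> nat" and p
  obtain x y where xy: "x \<in> X" "y \<in> Y" using X Y by auto
  then have "x < n" "y < n" using X Y by auto
  from irreducible[OF this] obtain f0 m where
    "f0 0 = x" "f0 m = y" "\<forall>l<m. f0 l < n \<and> f0 (Suc l) < n \<and> 0 < B (f0 l) (f0 (Suc l))"
    by blast
  then have "P f0 m" using xy by (simp add: P_def edge_def)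
  then have ex: "\<exists>p f. P f p" by blast
  define p where "p = (LEAST p. \<exists>f. P f p)"
  obtain f where f: "P f p" using LeastI_ex[OF ex] unfolding p_def by blast
  have least: "p \<le> q" if "P h q" for h q unfolding p_def by (rule Least_le) (use that in blast)
  have "p \<noteq> 0"
  proof
    assume "p = 0"
    then have "f 0 \<in> X" "f 0 \<in> Y" using f by (simp_all add: P_def)
    then show False using XY by blast
  qed
  moreover have "inj_on f {1..<p}"
  proof (rule linorder_inj_onI)
    fix i j assume ij: "i < j" "i \<in> {1..<p}" "j \<in> {1..<p}"
    show "f i \<noteq> f j"
    proof
      assume eq: "f i = f j"
      define h where "h l = (if l \<le> i then f l else f (l + (j - i)))" for l
      have "P h (p - (j - i))"
        unfolding P_def
      proof (intro conjI allI impI)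
        show "h 0 \<in> X" using f by (simp add: h_def P_def)
        show "h (p - (j - i)) \<in> Y" using f ij by (auto simp: h_def P_def)
        fix l assume l: "l < p - (j - i)"
        consider "l < i" | "l = i" | "i < l" by linarith
        then show "edge (h l) (h (Suc l))"
        proof cases
          case 2
          then have "edge (f j) (f (Suc j))" using f ij by (auto simp: P_def)
          moreover have "Suc i + (j - i) = Suc j" using ij by simp
          ultimately show ?thesis using 2 eq by (simp add: h_def)
        qed (use f l ij in \<open>auto simp: h_def P_def\<close>)
      qed
      from least[OF this] show False using ij by auto
    qed
  qed auto
  moreover have "f i \<in> {0..<n} - (X \<union> Y)" if i: "i \<in> {1..<p}" for i
  proof -
    have "f i < n" using f i by (auto simp: P_def edge_def)
    moreover have "f i \<notin> Y"
    proof
      assume "f i \<in> Y"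
      then have "P f i" using f i by (auto simp: P_def)
      from least[OF this] show False using i by auto
    qed
    moreover have "f i \<notin> X"
    proof
      assume "f i \<in> X"
      then have "P (\<lambda>l. f (l + i)) (p - i)" using f i by (auto simp: P_def)
      from least[OF this] show False using i by auto
    qed
    ultimately show ?thesis by auto
  qed
  ultimately show ?thesis using f by (intro that[of p f]) (auto simp: P_def)
qed

text \<open>Follow a shortest path \<open>f\<close> from the first cycle to the second, the second cycle, a
  shortest path \<open>h\<close> back, and the first cycle. If the paths meet outside of the cycles, this closed
  walk may be longer than \<open>n\<close>, but then the two paths part at some vertex, which costs a factor
  \<open>1/4\<close>.\<close>
lemma cyc_disjoint:
  assumes c: "cyc S \<pi>" and c': "cyc S' \<pi>'" and disj: "S \<inter> S' = {}"
  shows "t ^ n \<le> (1 - t ^ card S) * (1 - t ^ card S') \<or>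
    4 * t ^ (2 * n - card S - card S') \<le> (1 - t ^ card S) * (1 - t ^ card S')"
proof -
  let ?k = "card S" and ?l = "card S'"
  let ?K = "1 - t ^ ?k" and ?L = "1 - t ^ ?l"
  have sub: "S \<subseteq> {0..<n}" "S' \<subseteq> {0..<n}" using c c' by (auto simp: cyc_def)
  note ne = cyc_ne[OF c] cyc_ne[OF c']
  note fin = finite_cyc[OF c] finite_cyc[OF c']
  obtain f p where f: "0 < p" "f 0 \<in> S" "f p \<in> S'" "\<And>l. l < p \<Longrightarrow> edge (f l) (f (Suc l))"
    "inj_on f {1..<p}" "f ` {1..<p} \<subseteq> {0..<n} - (S \<union> S')"
    using shortest_path[OF sub(1) ne(1) sub(2) ne(2) disj] by metis
  have disj': "S' \<inter> S = {}" using disj by auto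
  obtain h q where h: "0 < q" "h 0 \<in> S'" "h q \<in> S" "\<And>l. l < q \<Longrightarrow> edge (h l) (h (Suc l))"
    "inj_on h {1..<q}" "h ` {1..<q} \<subseteq> {0..<n} - (S' \<union> S)"
    using shortest_path[OF sub(2) ne(2) sub(1) ne(1) disj'] by metis
  let ?R = "{0..<n} - (S \<union> S')"
  have cardR: "card ?R = n - ?k - ?l"
    using sub fin disj by (subst card_Diff_subset) (auto simp: card_Un_disjoint)
  have kl: "?k + ?l \<le> n"
    using card_mono[of "{0..<n}" "S \<union> S'"] sub fin disj by (simp add: card_Un_disjoint)
  have cf: "card (f ` {1..<p}) = p - 1" using card_image[OF f(5)] by simp
  have ch: "card (h ` {1..<q}) = q - 1" using card_image[OF h(5)] by simp
  have k0: "0 < ?k" "0 < ?l" using card_cyc c c' by auto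
  have f1: "f 1 \<notin> S" using f(1,3,6) disj by (cases "p = 1") (auto simp: image_subset_iff)
  have h1: "h 1 \<notin> S'" using h(1,3,6) disj by (cases "q = 1") (auto simp: image_subset_iff)
  have exf: "t * v (f 1) \<le> ?K * v (f 0)"
  proof (rule cyc_exit[OF c f(2)])
    show "edge (f 0) (f 1)" using f(4)[of 0] f(1) by simp
    show "f 1 \<noteq> \<pi> (f 0)" using f1 cyc_in[OF c, of "f 0"] f(2) by metis
  qed
  have exh: "t * v (h 1) \<le> ?L * v (h 0)"
  proof (rule cyc_exit[OF c' h(2)])
    show "edge (h 0) (h 1)" using h(4)[of 0] h(1) by simp
    show "h 1 \<noteq> \<pi>' (h 0)" using h1 cyc_in[OF c', of "h 0"] h(2) by metis
  qed
  have bf: "t ^ (?l - 1) * v (h 0) \<le> v (f p)" by (rule cyc_walk[OF c' f(3) h(2)])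
  have bh: "t ^ (?k - 1) * v (f 0) \<le> v (h q)" by (rule cyc_walk[OF c h(3) f(2)])
  have vf0: "0 < v (f 0)" "0 < v (h 0)" using f(2) h(2) sub v_pos by auto
  \<comment> \<open>\<open>c\<close> and \<open>d\<close> bound the probability of following
    \<open>f\<close> beyond \<open>f 1\<close> and \<open>h\<close> beyond \<open>h 1\<close>: 1 in
    general, smaller if the paths part. Multiplying the two half tours cancels
    \<open>v (f 0)\<close> and \<open>v (h 0)\<close>. The exponent counts \<open>p + q\<close> path
    edges and at most \<open>?k - 1\<close> and \<open>?l - 1\<close> cycle edges.\<close>
  have main: "c * d * ?K * ?L \<ge> t ^ (p + q + ?k + ?l - 2)"
    if cd: "0 \<le> c" "0 \<le> d" "t ^ (p - 1) * v (f p) \<le> c * v (f 1)" "t ^ (q - 1) * v (h q) \<le> d * v (h 1)" for c d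
  proof -
    have "t ^ (p + ?l - 1) * v (h 0) = t * t ^ (p - 1) * (t ^ (?l - 1) * v (h 0))"
    proof -
      have "p + ?l - 1 = Suc ((p - 1) + (?l - 1))" using f(1) k0 by simp
      then show ?thesis by (simp only: power_Suc power_add mult.assoc)
    qed
    also have "\<dots> \<le> t * t ^ (p - 1) * v (f p)" using bf t_pos by (intro mult_left_mono) auto
    also have "\<dots> \<le> t * (c * v (f 1))" using cd t_pos by (simp add: mult.assoc)
    also have "\<dots> = c * (t * v (f 1))" by simp
    also have "\<dots> \<le> c * (?K * v (f 0))" using exf cd by (intro mult_left_mono) auto
    finally have 1: "t ^ (p + ?l - 1) * v (h 0) \<le> c * ?K * v (f 0)" by simp
    have "t ^ (q + ?k - 1) * v (f 0) = t * t ^ (q - 1) * (t ^ (?k - 1) * v (f 0))"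
    proof -
      have "q + ?k - 1 = Suc ((q - 1) + (?k - 1))" using h(1) k0 by simp
      then show ?thesis by (simp only: power_Suc power_add mult.assoc)
    qed
    also have "\<dots> \<le> t * t ^ (q - 1) * v (h q)" using bh t_pos by (intro mult_left_mono) auto
    also have "\<dots> \<le> t * (d * v (h 1))" using cd t_pos by (simp add: mult.assoc)
    also have "\<dots> = d * (t * v (h 1))" by simp
    also have "\<dots> \<le> d * (?L * v (h 0))" using exh cd by (intro mult_left_mono) auto
    finally have 2: "t ^ (q + ?k - 1) * v (f 0) \<le> d * ?L * v (h 0)" by simp
    have "(t ^ (p + ?l - 1) * v (h 0)) * (t ^ (q + ?k - 1) * v (f 0)) \<le>
      (c * ?K * v (f 0)) * (d * ?L * v (h 0))"
      using t_pos vf0 by (intro mult_mono'[OF 1 2] mult_nonneg_nonneg) auto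
    then have "(t ^ (p + ?l - 1) * t ^ (q + ?k - 1)) * (v (h 0) * v (f 0)) \<le>
      (c * d * ?K * ?L) * (v (h 0) * v (f 0))" by (simp add: algebra_simps)
    then have "t ^ (p + ?l - 1) * t ^ (q + ?k - 1) \<le> c * d * ?K * ?L"
      using vf0 by simp
    moreover have "t ^ (p + ?l - 1) * t ^ (q + ?k - 1) = t ^ (p + q + ?k + ?l - 2)"
    proof -
      have "p + q + ?k + ?l - 2 = (p + ?l - 1) + (q + ?k - 1)" using f(1) h(1) k0 by simp
      then show ?thesis by (simp only: power_add)
    qed
    ultimately show ?thesis by simp
  qed
  have wf: "t ^ (j - i) * v (f j) \<le> v (f i)" if "i \<le> j" "j \<le> p" for i j
    by (rule walk_le) (use f(4) that in auto)
  have wh: "t ^ (j - i) * v (h j) \<le> v (h i)" if "i \<le> j" "j \<le> q" for i j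
    by (rule walk_le) (use h(4) that in auto)
  show ?thesis
  proof (cases "f ` {1..<p} \<inter> h ` {1..<q} = {}")
    case True
    have "card (f ` {1..<p} \<union> h ` {1..<q}) \<le> card ?R"
      using f(6) h(6) by (intro card_mono) auto
    \<comment> \<open>The \<open>p - 1\<close> and \<open>q - 1\<close> inner vertices are now
      distinct and lie off both cycles, so everything fits into \<open>n\<close> vertices.\<close>
    then have "p + q + ?k + ?l - 2 \<le> n"
      using cf ch cardR kl f(1) h(1) True by (simp add: card_Un_disjoint)
    then have "t ^ n \<le> t ^ (p + q + ?k + ?l - 2)"
      using t_pos t_less_1 by (intro power_decreasing) auto
    also have "\<dots> \<le> 1 * 1 * ?K * ?L"
      by (rule main) (use wf[of 1 p] wh[of 1 q] f(1) h(1) in auto)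
    finally show ?thesis by simp
  next
    case False
    define I where "I = {i \<in> {1..<p}. f i \<in> h ` {1..<q}}"
    have I: "finite I" "I \<noteq> {}" using False by (auto simp: I_def)
    \<comment> \<open>At the last vertex of \<open>f\<close> that lies on \<open>h\<close> the
      successors must differ: a common successor would be a later meeting point, or would lie on one
      of the cycles, which \<open>f\<close> and \<open>h\<close> reach at different ends.\<close>
    define i where "i = Max I"
    have "i \<in> I" using Max_in[OF I] by (simp add: i_def)
    then obtain j where ij: "1 \<le> i" "i < p" "1 \<le> j" "j < q" "f i = h j"
      by (auto simp: I_def)
    have "Suc i \<notin> I" using Max_ge[OF I(1), of "Suc i"] by (auto simp: i_def)
    have part: "f (Suc i) \<noteq> h (Suc j)"
    proof
      assume eq: "f (Suc i) = h (Suc j)"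
      show False
      proof (cases "Suc i < p")
        case True
        then have fr: "f (Suc i) \<in> ?R" using f(6) ij by (simp add: image_subset_iff)
        show False
        proof (cases "Suc j < q")
          case True
          then have "Suc i \<in> I" using \<open>Suc i < p\<close> ij eq by (auto simp: I_def)
          then show False using \<open>Suc i \<notin> I\<close> by simp
        next
          case False
          then have "Suc j = q" using ij by simp
          then show False using h(3) fr eq by auto
        qed
      next
        case False
        then have "Suc i = p" using ij by simp
        then have "h (Suc j) \<in> S'" using f(3) eq by simp
        then have "Suc j \<noteq> q" using h(3) disj by auto
        then have "h (Suc j) \<in> {0..<n} - (S' \<union> S)" using h(6) ij by (simp add: image_subset_iff)
        then show False using \<open>h (Suc j) \<in> S'\<close> by auto
      qed
    qed
    define u where "u = f i"
    have u: "u = h j" using ij by (simp add: u_def)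
    have e1: "edge u (f (Suc i))" using f(4)[of i] ij by (simp add: u_def)
    have e2: "edge u (h (Suc j))" using h(4)[of j] ij by (simp add: u)
    have two: "t * v (f (Suc i)) + t * v (h (Suc j)) \<le> v u" by (rule two_edges_le[OF e1 e2 part])
    have vu: "0 < v u" using e1 v_pos by (auto simp: edge_def)
    have vpos: "0 < v (f (Suc i))" "0 < v (h (Suc j))" using e1 e2 v_pos by (auto simp: edge_def)
    define x y where "x = t * v (f (Suc i)) / v u" and "y = t * v (h (Suc j)) / v u"
    have xy: "0 \<le> x" "0 \<le> y" "x + y \<le> 1"
      using two vu vpos t_pos by (auto simp: x_def y_def divide_simps)
    have "4 * (x * y) \<le> (x + y)\<^sup>2" using sum_squares_ge_zero[of "x - y" 0]
      by (simp add: power2_eq_square algebra_simps)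
    also have "\<dots> \<le> 1" using xy by (simp add: power_le_one)
    finally have xy4: "4 * (x * y) \<le> 1" .
    have A: "t ^ (p - 1) * v (f p) \<le> x * v (f 1)"
    proof -
      have "t ^ (p - 1) * v (f p) = t ^ (i - 1) * (t * (t ^ (p - Suc i) * v (f p)))"
      proof -
        have "p - 1 = (i - 1) + Suc (p - Suc i)" using ij by simp
        then show ?thesis by (simp only: power_add power_Suc mult.assoc)
      qed
      also have "\<dots> \<le> t ^ (i - 1) * (t * v (f (Suc i)))"
        using wf[of "Suc i" p] ij t_pos by (intro mult_left_mono) auto
      also have "\<dots> = x * (t ^ (i - 1) * v u)" using vu by (simp add: x_def)
      also have "\<dots> \<le> x * v (f 1)"
        using wf[of 1 i] ij xy by (intro mult_left_mono) (auto simp: u_def)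
      finally show ?thesis .
    qed
    have C: "t ^ (q - 1) * v (h q) \<le> y * v (h 1)"
    proof -
      have "t ^ (q - 1) * v (h q) = t ^ (j - 1) * (t * (t ^ (q - Suc j) * v (h q)))"
      proof -
        have "q - 1 = (j - 1) + Suc (q - Suc j)" using ij by simp
        then show ?thesis by (simp only: power_add power_Suc mult.assoc)
      qed
      also have "\<dots> \<le> t ^ (j - 1) * (t * v (h (Suc j)))"
        using wh[of "Suc j" q] ij t_pos by (intro mult_left_mono) auto
      also have "\<dots> = y * (t ^ (j - 1) * v u)" using vu by (simp add: y_def)
      also have "\<dots> \<le> y * v (h 1)"
        using wh[of 1 j] ij xy by (intro mult_left_mono) (auto simp: u)
      finally show ?thesis .
    qed
    have KL: "0 \<le> ?K * ?L"
      using t_pos t_less_1 by (intro mult_nonneg_nonneg) (auto simp: power_le_one)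
    have "card (f ` {1..<p}) \<le> card ?R" "card (h ` {1..<q}) \<le> card ?R"
      using f(6) h(6) by (auto intro!: card_mono)
    \<comment> \<open>Each path separately has at most \<open>n - ?k - ?l\<close> inner
      vertices.\<close>
    then have "p + q + ?k + ?l - 2 \<le> 2 * n - ?k - ?l" using cf ch cardR kl by linarith
    then have "4 * t ^ (2 * n - ?k - ?l) \<le> 4 * t ^ (p + q + ?k + ?l - 2)"
      using t_pos t_less_1 by (intro mult_left_mono power_decreasing) auto
    also have "\<dots> \<le> 4 * (x * y * ?K * ?L)" using main[OF xy(1,2) A C] by simp
    also have "\<dots> = (4 * (x * y)) * (?K * ?L)" by simp
    also have "\<dots> \<le> 1 * (?K * ?L)" using xy4 KL by (intro mult_right_mono)
    finally show ?thesis by simp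
  qed
qed

end

subsection \<open>Coefficients as signed cycle counts\<close>

lemma card_split: "P \<subseteq> S \<Longrightarrow> finite S \<Longrightarrow> card P + card (S - P) = card S"
  by (simp add: card_Diff_subset finite_subset card_mono)

context perron_graph
begin

text \<open>The sign is \<open>(- 1)\<close> to the number of cycles of \<open>\<pi>\<close> on
  \<open>S\<close>, where fixed points in \<open>S\<close> count as loops: a cycle of length
  \<open>k\<close> has permutation sign \<open>- ((- 1) ^ k)\<close>, and
  \<open>(- 1) ^ card S\<close> removes the dependence on lengths.\<close>

definition signed_wt :: "nat set \<Rightarrow> (nat \<Rightarrow> nat) \<Rightarrow> int" where
  "signed_wt S \<pi> = (- 1) ^ card S * sign \<pi> * wt S \<pi>"

definition perms :: "nat \<Rightarrow> (nat set \<times> (nat \<Rightarrow> nat)) set" where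
  "perms m = (SIGMA S:{S. S \<subseteq> {0..<n} \<and> card S = m}. {\<pi>. \<pi> permutes S})"

text \<open>The coefficient of \<open>z ^ m\<close> in \<open>det (1 - z * B)\<close>, the reversed
  characteristic polynomial, whose roots are the reciprocals of the nonzero eigenvalues.\<close>

definition a :: "nat \<Rightarrow> int" where
  "a m = (\<Sum>(S, \<pi>)\<in>perms m. signed_wt S \<pi>)"

definition len :: "nat \<Rightarrow> bool" where
  "len m \<longleftrightarrow> (\<exists>S \<pi>. cyc S \<pi> \<and> card S = m)"

definition dj :: "nat \<Rightarrow> nat \<Rightarrow> bool" where
  "dj p q \<longleftrightarrow> (\<exists>S \<pi> S' \<pi>'. cyc S \<pi> \<and> cyc S' \<pi>' \<and> S \<inter> S' = {} \<and> card S = p \<and> card S' = q)"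

lemma finite_perms: "finite (perms m)"
  unfolding perms_def
proof (rule finite_SigmaI)
  show "finite {S. S \<subseteq> {0..<n} \<and> card S = m}"
    by (rule finite_subset[of _ "Pow {0..<n}"]) auto
  show "finite {\<pi>. \<pi> permutes S}" if "S \<in> {S. S \<subseteq> {0..<n} \<and> card S = m}" for S
    using that finite_subset[of S "{0..<n}"] by (intro finite_permutations) auto
qed

lemma permsD:
  assumes "(S, \<pi>) \<in> perms m"
  shows "S \<subseteq> {0..<n}" "card S = m" "\<pi> permutes S" "finite S"
  using assms finite_subset[of S "{0..<n}"] by (auto simp: perms_def)

lemma wt_nonneg:
  assumes "S \<subseteq> {0..<n}" "\<pi> permutes S" shows "0 \<le> wt S \<pi>"
  unfolding wt_def
proof (rule prod_nonneg)
  fix i assume "i \<in> S"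
  then have "\<pi> i \<in> S" using assms by (simp add: permutes_in_image)
  then show "0 \<le> B i (\<pi> i)" using \<open>i \<in> S\<close> assms(1) by (intro B_nonneg) auto
qed

lemma signed_wt_cyc: assumes "cyc S \<pi>" shows "signed_wt S \<pi> = - wt S \<pi>"
proof -
  have "sign \<pi> = - ((- 1) ^ card S)"
    using assms finite_cyc[OF assms] by (intro sign_cyclic_on) (auto simp: cyc_def)
  moreover have "(- 1 :: int) ^ card S * (- 1) ^ card S = 1" by (simp flip: power_mult_distrib)
  ultimately show ?thesis by (simp add: signed_wt_def)
qed

lemma cyc_perms: "cyc S \<pi> \<Longrightarrow> (S, \<pi>) \<in> perms (card S)"
  by (auto simp: cyc_def perms_def)

lemma signed_wt_nonzeroD:
  assumes "S \<subseteq> {0..<n}" "\<pi> permutes S" "signed_wt S \<pi> \<noteq> 0" shows "0 < wt S \<pi>"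
proof -
  have "wt S \<pi> \<noteq> 0" using assms(3) by (auto simp: signed_wt_def)
  then show ?thesis using wt_nonneg[OF assms(1,2)] by linarith
qed

text \<open>Peels the cycle through \<open>s\<close> off a permutation. Since weights and signs are
  multiplicative, iterating this yields the cycle decomposition as far as it is wanted.\<close>

lemma split_orbit:
  assumes S: "S \<subseteq> {0..<n}" and \<pi>: "\<pi> permutes S" and w: "0 < wt S \<pi>" and s: "s \<in> S"
  defines "P \<equiv> orbit \<pi> s"
  defines "\<sigma> \<equiv> perm_restrict \<pi> P" and "\<tau> \<equiv> perm_restrict \<pi> (S - P)"
  shows "P \<subseteq> S" "cyc P \<sigma>" "\<tau> permutes (S - P)" "0 < wt (S - P) \<tau>" "\<pi> = \<sigma> \<circ> \<tau>"
    "signed_wt S \<pi> = signed_wt P \<sigma> * signed_wt (S - P) \<tau>"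
    "wt S \<pi> = wt P \<sigma> * wt (S - P) \<tau>"
proof -
  have fin: "finite S" using S finite_subset by auto
  show PS: "P \<subseteq> S" unfolding P_def by (rule permutes_orbit_subset[OF \<pi> s])
  have cP: "cyclic_on \<pi> P" unfolding P_def by (rule cyclic_on_orbit[OF \<pi> fin])
  show \<tau>: "\<tau> permutes (S - P)" unfolding \<tau>_def by (rule perm_restrict_diff_cyclic[OF \<pi> cP])
  have cP': "cyclic_on \<tau>' P" if "\<And>x. x \<in> P \<Longrightarrow> \<tau>' x = \<pi> x" for \<tau>'
    using cP that by (simp cong: cyclic_cong)
  have im: "\<pi> x \<in> S - P \<longleftrightarrow> x \<in> S - P" for x
  proof (cases "x \<in> S - P")
    case True
    then show ?thesis using permutes_in_image[OF \<tau>, of x] by (simp add: \<tau>_def perm_restrict_def)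
  next
    case False
    then show ?thesis using cyclic_on_inI[OF cP, of x] \<pi> by (auto simp: permutes_def)
  qed
  have imP: "\<pi> x \<in> P \<longleftrightarrow> x \<in> P" for x
    using im[of x] permutes_in_image[OF \<pi>, of x] PS by auto
  have \<sigma>: "\<sigma> permutes P"
  proof (rule bij_imp_permutes)
    have "inj_on \<sigma> P" using permutes_inj[OF \<pi>]
      by (auto simp: \<sigma>_def perm_restrict_def inj_on_def)
    moreover have "\<sigma> ` P \<subseteq> P" using imP by (auto simp: \<sigma>_def perm_restrict_def)
    moreover have "finite P" using PS fin finite_subset by blast
    ultimately have "\<sigma> ` P = P" by (intro endo_inj_surj)
    then show "bij_betw \<sigma> P P" using \<open>inj_on \<sigma> P\<close> by (simp add: bij_betw_def)
  qed (auto simp: \<sigma>_def perm_restrict_def)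
  have eq: "\<pi> = \<sigma> \<circ> \<tau>"
  proof
    fix x
    show "\<pi> x = (\<sigma> \<circ> \<tau>) x"
      using im[of x] imP[of x] permutes_not_in[OF \<pi>, of x] PS
      by (auto simp: \<sigma>_def \<tau>_def perm_restrict_def)
  qed
  then show "\<pi> = \<sigma> \<circ> \<tau>" .
  have "wt S \<pi> = (\<Prod>i\<in>P. B i (\<pi> i)) * (\<Prod>i\<in>S - P. B i (\<pi> i))"
    unfolding wt_def using PS fin by (subst prod.subset_diff[of P]) auto
  also have "\<dots> = wt P \<sigma> * wt (S - P) \<tau>"
    unfolding wt_def by (intro arg_cong2[of _ _ _ _ "(*)"] prod.cong)
      (auto simp: \<sigma>_def \<tau>_def perm_restrict_def)
  finally show ww: "wt S \<pi> = wt P \<sigma> * wt (S - P) \<tau>" .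
  have "0 \<le> wt P \<sigma>" "0 \<le> wt (S - P) \<tau>"
    using S PS \<sigma> \<tau> by (auto intro!: wt_nonneg)
  then have pos: "0 < wt P \<sigma>" "0 < wt (S - P) \<tau>"
    using w ww by (auto simp: zero_less_mult_iff)
  then show "0 < wt (S - P) \<tau>" by simp
  have "cyclic_on \<sigma> P" by (rule cP') (auto simp: \<sigma>_def perm_restrict_def)
  then show "cyc P \<sigma>" using pos \<sigma> PS S by (auto simp: cyc_def)
  have "permutation \<sigma>" "permutation \<tau>"
    using \<sigma> \<tau> PS fin finite_subset by (auto simp: permutation_permutes)
  then have "sign \<pi> = sign \<sigma> * sign \<tau>" unfolding eq by (rule sign_compose)
  moreover have "card S = card P + card (S - P)"
    using card_split[OF PS fin] by simp
  ultimately show "signed_wt S \<pi> = signed_wt P \<sigma> * signed_wt (S - P) \<tau>"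
    by (simp add: signed_wt_def ww power_add algebra_simps)
qed

text \<open>A second orbit inside \<open>S\<close> would give two disjoint cycles of total length at
  most \<open>d\<close>.\<close>

lemma small_cyc:
  assumes D: "\<And>p q. dj p q \<Longrightarrow> d < p + q"
    and S: "S \<subseteq> {0..<n}" and \<pi>: "\<pi> permutes S" and w: "0 < wt S \<pi>"
    and ne: "S \<noteq> {}" and card: "card S \<le> d"
  shows "cyc S \<pi>"
proof -
  have fin: "finite S" using S finite_subset by auto
  obtain s where s: "s \<in> S" using ne by auto
  note sp = split_orbit[OF S \<pi> w s]
  let ?P = "orbit \<pi> s"
  show ?thesis
  proof (cases "S - ?P = {}")
    case True
    then have "?P = S" using sp(1) by auto
    then show ?thesis using sp(2) \<pi> by simp
  next
    case False
    then obtain s' where s': "s' \<in> S - ?P" by auto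
    have S': "S - ?P \<subseteq> {0..<n}" using S by auto
    note sp' = split_orbit[OF S' sp(3,4) s']
    let ?P' = "orbit (perm_restrict \<pi> (S - ?P)) s'"
    have "dj (card ?P) (card ?P')" using sp(2) sp'(1,2) unfolding dj_def by blast
    then have "d < card ?P + card ?P'" by (rule D)
    also have "\<dots> = card (?P \<union> ?P')"
      using sp(1) sp'(1) fin by (intro card_Un_disjoint[symmetric]) (auto intro: finite_subset)
    also have "\<dots> \<le> card S" using sp(1) sp'(1) fin by (intro card_mono) auto
    finally show ?thesis using card by simp
  qed
qed

text \<open>A positive sign means an even number of cycles, not zero as \<open>S\<close> is
  nonempty. Four cycles would form two disjoint pairs, each of total length at least
  \<open>d + 1\<close>, and \<open>2 * (d + 1)\<close> exceeds \<open>n\<close>. Hence there are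
  exactly two.\<close>

lemma pos_term:
  assumes D: "\<And>p q. dj p q \<Longrightarrow> d < p + q" and n: "n \<le> 2 * d + 1"
    and S: "S \<subseteq> {0..<n}" and \<pi>: "\<pi> permutes S" and pos: "0 < signed_wt S \<pi>" and ne: "S \<noteq> {}"
  obtains P \<sigma> \<tau> where "P \<subseteq> S" "cyc P \<sigma>" "cyc (S - P) \<tau>" "\<pi> = \<sigma> \<circ> \<tau>"
    "wt S \<pi> = wt P \<sigma> * wt (S - P) \<tau>" "signed_wt S \<pi> = wt S \<pi>"
proof -
  have fin: "finite S" using S finite_subset by auto
  have w: "0 < wt S \<pi>" using signed_wt_nonzeroD[OF S \<pi>] pos by simp
  obtain s where s: "s \<in> S" using ne by auto
  note 1 = split_orbit[OF S \<pi> w s]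
  define P \<sigma> \<tau> where "P = orbit \<pi> s" and "\<sigma> = perm_restrict \<pi> P" and "\<tau> = perm_restrict \<pi> (S - P)"
  note 1 = 1[folded P_def, folded \<sigma>_def \<tau>_def]
  have S1: "S - P \<subseteq> {0..<n}" using S by auto
  have neg1: "signed_wt P \<sigma> < 0" using signed_wt_cyc[OF 1(2)] 1(2) by (simp add: cyc_def)
  have "S - P \<noteq> {}"
  proof
    assume "S - P = {}"
    then have "P = S" using 1(1) by auto
    then have "\<sigma> = \<pi>" using \<pi> by (simp add: \<sigma>_def)
    then show False using neg1 pos \<open>P = S\<close> by simp
  qed
  then obtain s2 where s2: "s2 \<in> S - P" by auto
  note 2 = split_orbit[OF S1 1(3,4) s2]
  define P2 \<sigma>2 \<tau>2 where "P2 = orbit \<tau> s2" and "\<sigma>2 = perm_restrict \<tau> P2"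
    and "\<tau>2 = perm_restrict \<tau> (S - P - P2)"
  note 2 = 2[folded P2_def, folded \<sigma>2_def \<tau>2_def]
  have neg2: "signed_wt P2 \<sigma>2 < 0" using signed_wt_cyc[OF 2(2)] 2(2) by (simp add: cyc_def)
  have S2: "S - P - P2 \<subseteq> {0..<n}" using S by auto
  have "S - P - P2 = {}"
  proof (rule ccontr)
    assume "S - P - P2 \<noteq> {}"
    then obtain s3 where s3: "s3 \<in> S - P - P2" by auto
    note 3 = split_orbit[OF S2 2(3,4) s3]
    define P3 \<sigma>3 \<tau>3 where "P3 = orbit \<tau>2 s3" and "\<sigma>3 = perm_restrict \<tau>2 P3"
      and "\<tau>3 = perm_restrict \<tau>2 (S - P - P2 - P3)"
    note 3 = 3[folded P3_def, folded \<sigma>3_def \<tau>3_def]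
    have neg3: "signed_wt P3 \<sigma>3 < 0" using signed_wt_cyc[OF 3(2)] 3(2) by (simp add: cyc_def)
    have S3: "S - P - P2 - P3 \<subseteq> {0..<n}" using S by auto
    show False
    proof (cases "S - P - P2 - P3 = {}")
      case True
      then have P3: "P3 = S - P - P2" using 3(1) by auto
      then have "\<sigma>3 = \<tau>2" using 2(3) by (simp add: \<sigma>3_def)
      then have "signed_wt S \<pi> = signed_wt P \<sigma> * (signed_wt P2 \<sigma>2 * signed_wt P3 \<sigma>3)"
        using 1(6) 2(6) P3 by simp
      also have "\<dots> < 0" using neg1 neg2 neg3 by (simp add: mult_neg_neg mult_neg_pos)
      finally show False using pos by simp
    next
      case False
      then obtain s4 where s4: "s4 \<in> S - P - P2 - P3" by auto
      note 4 = split_orbit[OF S3 3(3,4) s4]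
      define P4 where "P4 = orbit \<tau>3 s4"
      note 4 = 4[folded P4_def]
      have "dj (card P) (card P2)" "dj (card P3) (card P4)"
        unfolding dj_def using 1(2) 2(1,2) 3(2) 4(1,2) by blast+
      then have "d < card P + card P2" "d < card P3 + card P4" using D by blast+
      then have "n < (card P + card P2) + (card P3 + card P4)" using n by linarith
      also have "\<dots> = card ((P \<union> P2) \<union> (P3 \<union> P4))"
      proof -
        have f: "finite P" "finite P2" "finite P3" "finite P4"
          by (rule finite_subset[OF _ fin]; use 1(1) 2(1) 3(1) 4(1) in blast)+
        have "card (P \<union> P2) = card P + card P2" "card (P3 \<union> P4) = card P3 + card P4"
          by (rule card_Un_disjoint; use f 2(1) 4(1) in blast)+
        moreover have "card ((P \<union> P2) \<union> (P3 \<union> P4)) = card (P \<union> P2) + card (P3 \<union> P4)"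
          by (rule card_Un_disjoint) (use f 3(1) 4(1) in blast)+
        ultimately show ?thesis by simp
      qed
      also have "\<dots> \<le> card {0..<n}"
        using 1(1) 2(1) 3(1) 4(1) S by (intro card_mono) auto
      finally show False by simp
    qed
  qed
  then have P2: "P2 = S - P" using 2(1) by auto
  then have "\<sigma>2 = \<tau>" using 1(3) by (simp add: \<sigma>2_def)
  then have c2: "cyc (S - P) \<tau>" using 2(2) P2 by simp
  have "signed_wt S \<pi> = wt S \<pi>"
    using 1(6,7) signed_wt_cyc[OF 1(2)] signed_wt_cyc[OF c2] by simp
  then show ?thesis using that[OF 1(1,2) c2 1(5,7)] by simp
qed

lemma a_le_terms:
  assumes nonpos: "\<And>S \<pi>. (S, \<pi>) \<in> perms m \<Longrightarrow> signed_wt S \<pi> \<le> 0" and X: "X \<subseteq> perms m"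
  shows "a m \<le> (\<Sum>(S, \<pi>)\<in>X. signed_wt S \<pi>)"
proof -
  have "a m = (\<Sum>(S, \<pi>)\<in>X. signed_wt S \<pi>) + (\<Sum>(S, \<pi>)\<in>perms m - X. signed_wt S \<pi>)"
    unfolding a_def using sum.subset_diff[OF X finite_perms] by (simp add: add.commute)
  moreover have "(\<Sum>(S, \<pi>)\<in>perms m - X. signed_wt S \<pi>) \<le> 0"
    using nonpos by (intro sum_nonpos) auto
  ultimately show ?thesis by simp
qed

lemma small_term:
  assumes D: "\<And>p q. dj p q \<Longrightarrow> d < p + q" and m: "0 < m" "m \<le> d" and S: "(S, \<pi>) \<in> perms m"
  shows "signed_wt S \<pi> = (if cyc S \<pi> then - wt S \<pi> else 0)"
proof (cases "cyc S \<pi>")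
  case False
  have "S \<noteq> {}" using permsD[OF S] m by auto
  then have "\<not> 0 < wt S \<pi>"
    using small_cyc[of d S \<pi>, OF D] permsD[OF S] m False by auto
  then have "signed_wt S \<pi> = 0"
    using signed_wt_nonzeroD permsD[OF S] by blast
  then show ?thesis using False by simp
qed (simp add: signed_wt_cyc)

lemma small_term_nonpos:
  assumes D: "\<And>p q. dj p q \<Longrightarrow> d < p + q" and m: "0 < m" "m \<le> d" and S: "(S, \<pi>) \<in> perms m"
  shows "signed_wt S \<pi> \<le> 0"
  using small_term[OF assms] by (auto simp: cyc_def)

lemma a_nonpos:
  assumes D: "\<And>p q. dj p q \<Longrightarrow> d < p + q" and m: "0 < m" "m \<le> d"
  shows "a m \<le> 0"
  unfolding a_def using small_term_nonpos[OF D m] by (intro sum_nonpos) auto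

lemma a_neg_iff:
  assumes D: "\<And>p q. dj p q \<Longrightarrow> d < p + q" and m: "0 < m" "m \<le> d"
  shows "a m < 0 \<longleftrightarrow> len m"
proof
  assume "a m < 0"
  have "\<exists>x\<in>perms m. case_prod signed_wt x < 0"
  proof (rule ccontr)
    assume "\<not> ?thesis"
    then have "0 \<le> a m" unfolding a_def by (intro sum_nonneg) (simp add: not_less)
    then show False using \<open>a m < 0\<close> by simp
  qed
  then obtain S \<pi> where S: "(S, \<pi>) \<in> perms m" "signed_wt S \<pi> < 0" by auto
  then have "cyc S \<pi>" using small_term[OF D m S(1)] by (auto split: if_splits)
  then show "len m" using permsD[OF S(1)] by (auto simp: len_def)
next
  assume "len m"
  then obtain S \<pi> where S: "cyc S \<pi>" "card S = m" by (auto simp: len_def)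
  then have "a m \<le> (\<Sum>(S, \<pi>)\<in>{(S, \<pi>)}. signed_wt S \<pi>)"
    using cyc_perms[OF S(1)] by (intro a_le_terms small_term_nonpos[OF D m]) auto
  also have "\<dots> = - wt S \<pi>" using signed_wt_cyc[OF S(1)] by simp
  finally show "a m < 0" using S(1) by (simp add: cyc_def)
qed

lemma a_le_two:
  assumes D: "\<And>p q. dj p q \<Longrightarrow> d < p + q" and m: "0 < m" "m \<le> d"
    and S: "cyc S \<pi>" "card S = m" and S': "cyc S' \<pi>'" "card S' = m" and ne: "(S, \<pi>) \<noteq> (S', \<pi>')"
  shows "a m \<le> - wt S \<pi> - wt S' \<pi>'"
proof -
  have "a m \<le> (\<Sum>(S, \<pi>)\<in>{(S, \<pi>), (S', \<pi>')}. signed_wt S \<pi>)"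
    using cyc_perms[OF S(1)] cyc_perms[OF S'(1)] S S'
    by (intro a_le_terms small_term_nonpos[OF D m]) auto
  also have "\<dots> = - wt S \<pi> - wt S' \<pi>'"
    using ne signed_wt_cyc[OF S(1)] signed_wt_cyc[OF S'(1)] by simp
  finally show ?thesis .
qed

lemma dj_same:
  assumes D: "\<And>p q. dj p q \<Longrightarrow> d < p + q" and m: "m \<le> d" and dj: "dj m m"
  shows "a m \<le> - 2"
proof -
  obtain S \<pi> S' \<pi>' where S: "cyc S \<pi>" "card S = m" and S': "cyc S' \<pi>'" "card S' = m"
    and disj: "S \<inter> S' = {}" using dj by (auto simp: dj_def)
  have "0 < m" using card_cyc[OF S(1)] S by simp
  moreover have "(S, \<pi>) \<noteq> (S', \<pi>')" using disj cyc_ne[OF S(1)] by auto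
  ultimately have "a m \<le> - wt S \<pi> - wt S' \<pi>'" using a_le_two[OF D _ m S S'] by blast
  then show ?thesis using S S' by (simp add: cyc_def)
qed

text \<open>At most one cycle of length \<open>m\<close> exists, and it has weight 1: two disjoint
  ones are excluded by \<open>2 * m \<le> d\<close>, two that meet by \<open>cyc_meet\<close>, and
  weight 2 or more by \<open>cyc_heavy\<close>.\<close>

lemma a_ge_minus_one:
  assumes D: "\<And>p q. dj p q \<Longrightarrow> d < p + q" and m: "0 < m" "2 * m \<le> d" and t: "1 < 2 * t ^ m"
  shows "- 1 \<le> a m"
proof -
  have m': "m \<le> d" using m by simp
  have one: "x = y" if "x \<in> perms m" "y \<in> perms m"
    "case_prod signed_wt x \<noteq> 0" "case_prod signed_wt y \<noteq> 0" for x y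
  proof (rule ccontr)
    assume ne: "x \<noteq> y"
    obtain S \<pi> S' \<pi>' where xy: "x = (S, \<pi>)" "y = (S', \<pi>')" by (cases x, cases y)
    have c: "cyc S \<pi>" "cyc S' \<pi>'"
      using small_term[OF D m(1) m'] that xy by (auto split: if_splits)
    have card: "card S = m" "card S' = m" using that xy permsD by auto
    show False
    proof (cases "S \<inter> S' = {}")
      case True
      then have "dj m m" using c card by (auto simp: dj_def)
      then show False using D m by fastforce
    next
      case False
      then show False using cyc_meet[OF c False] ne xy card t by auto
    qed
  qed
  have ge: "- 1 \<le> case_prod signed_wt x" if "x \<in> perms m" for x
  proof -
    obtain S \<pi> where x: "x = (S, \<pi>)" by (cases x)
    show ?thesis
    proof (cases "cyc S \<pi>")
      case True
      then have "\<not> 2 \<le> wt S \<pi>" using cyc_heavy[of S \<pi>] t that x permsD by auto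
      then show ?thesis using small_term[OF D m(1) m'] that x True by auto
    qed (use small_term[OF D m(1) m'] that x in auto)
  qed
  show ?thesis
  proof (cases "\<exists>x\<in>perms m. case_prod signed_wt x \<noteq> 0")
    case True
    then obtain x where x: "x \<in> perms m" "case_prod signed_wt x \<noteq> 0" by auto
    have "a m = (\<Sum>x\<in>{x}. case_prod signed_wt x)"
      unfolding a_def using x(1) one[OF _ x(1) _ x(2)]
      by (intro sum.mono_neutral_right finite_perms) blast+
    then show ?thesis using ge[OF x(1)] by simp
  next
    case False
    then have "a m = 0" unfolding a_def by (intro sum.neutral) auto
    then show ?thesis by simp
  qed
qed

text \<open>If \<open>a m = 0\<close> although a cycle of length \<open>m\<close> exists, its
  negative term must be cancelled by a positive one; so both alternatives produce a positive term,
  which \<open>pos_term\<close> splits into two disjoint cycles.\<close>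

lemma a_pos_dj:
  assumes D: "\<And>p q. dj p q \<Longrightarrow> d < p + q" and n: "n \<le> 2 * d + 1" and m: "0 < m"
    and am: "0 < a m \<or> a m = 0 \<and> len m"
  shows "\<exists>p q. dj p q \<and> p + q = m"
proof -
  have "\<exists>x\<in>perms m. 0 < case_prod signed_wt x"
  proof (rule ccontr)
    assume "\<not> ?thesis"
    then have le: "\<And>x. x \<in> perms m \<Longrightarrow> case_prod signed_wt x \<le> 0" by force
    then have "a m \<le> 0" unfolding a_def by (intro sum_nonpos) auto
    then have "a m = 0" "len m" using am by auto
    then obtain S \<pi> where S: "cyc S \<pi>" "card S = m" by (auto simp: len_def)
    then have "a m \<le> (\<Sum>(S, \<pi>)\<in>{(S, \<pi>)}. signed_wt S \<pi>)"
      using cyc_perms[OF S(1)] le by (intro a_le_terms) auto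
    also have "\<dots> = - wt S \<pi>" using signed_wt_cyc[OF S(1)] by simp
    finally show False using S(1) \<open>a m = 0\<close> by (simp add: cyc_def)
  qed
  then obtain S \<pi> where S: "(S, \<pi>) \<in> perms m" "0 < signed_wt S \<pi>" by auto
  note SD = permsD[OF S(1)]
  have "S \<noteq> {}" using SD m by auto
  from pos_term[OF D n SD(1,3) S(2) this] obtain P \<sigma> \<tau> where P: "P \<subseteq> S" "cyc P \<sigma>" "cyc (S - P) \<tau>"
    by metis
  have "dj (card P) (card (S - P))" unfolding dj_def using P by blast
  moreover have "card P + card (S - P) = m"
    using card_split[OF P(1) SD(4)] SD(2) by simp
  ultimately show ?thesis by blast
qed

lemma dj_sym: "dj p q \<Longrightarrow> dj q p"
  unfolding dj_def by blast

lemma dj_len: assumes "dj p q" shows "len p" "len q"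
  using assms unfolding dj_def len_def by blast+

lemma len_bounds: "len p \<Longrightarrow> 0 < p \<and> p \<le> n"
  using card_cyc by (auto simp: len_def)

lemma dj_bound:
  assumes "dj p q"
  shows "t ^ n \<le> (1 - t ^ p) * (1 - t ^ q) \<or> 4 * t ^ (2 * n - p - q) \<le> (1 - t ^ p) * (1 - t ^ q)"
    and "p + q \<le> n"
proof -
  obtain S \<pi> S' \<pi>' where S: "cyc S \<pi>" "card S = p" and S': "cyc S' \<pi>'" "card S' = q"
    and disj: "S \<inter> S' = {}" using assms by (auto simp: dj_def)
  show "t ^ n \<le> (1 - t ^ p) * (1 - t ^ q) \<or> 4 * t ^ (2 * n - p - q) \<le> (1 - t ^ p) * (1 - t ^ q)"
    using cyc_disjoint[OF S(1) S'(1) disj] S S' by simp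
  have "card (S \<union> S') \<le> card {0..<n}" using S S' by (intro card_mono) (auto simp: cyc_def)
  then show "p + q \<le> n" using S S' disj finite_cyc by (simp add: card_Un_disjoint)
qed

lemma len_meet:
  assumes "len p" "len q" "p \<noteq> q" "\<not> dj p q" shows "t ^ p + t ^ q \<le> 1"
proof -
  obtain S \<pi> S' \<pi>' where S: "cyc S \<pi>" "card S = p" "cyc S' \<pi>'" "card S' = q"
    using assms by (auto simp: len_def)
  then have "S \<inter> S' \<noteq> {}" using assms(4) by (auto simp: dj_def)
  then show ?thesis using cyc_meet[OF S(1,3)] S assms(3) by auto
qed

lemma a_zero: "a 0 = 1"
proof -
  have "perms 0 = {({}, id)}"
    using finite_subset[of _ "{0..<n}"] by (auto simp: perms_def)
  then show ?thesis by (simp add: a_def signed_wt_def wt_def)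
qed

lemma cyc_singleton: "cyc {u} \<pi> \<Longrightarrow> \<pi> = id"
  by (auto simp: cyc_def permutes_sing)

text \<open>There is exactly one loop, at \<open>u\<close>, and it has weight 1. A positive term of
  \<open>a 3\<close> splits 3 into 1 and 2, as three loops would contain two disjoint ones, so it is
  this loop together with a 2-cycle avoiding \<open>u\<close>. Deleting the loop maps the positive
  terms of \<open>a 3\<close> injectively to negative terms of \<open>a 2\<close>.\<close>

lemma a_three_le:
  assumes D: "\<And>p q. dj p q \<Longrightarrow> 2 < p + q" and a1: "a 1 = - 1"
  shows "a 3 \<le> - a 2"
proof -
  have "len 1" using a_neg_iff[of 2 1, OF D] a1 by simp
  then obtain u \<upsilon> where u: "cyc {u} \<upsilon>" by (auto simp: len_def card_1_singleton_iff)
  then have u: "cyc {u} id" using cyc_singleton by blast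
  have uniq: "w = u" if "cyc {w} id" for w
    using a_le_two[of 2 1 "{w}" id "{u}" id, OF D] that u a1
    by (auto simp: cyc_def)
  have "a 1 \<le> (\<Sum>(S, \<pi>)\<in>{({u}, id)}. signed_wt S \<pi>)"
    using cyc_perms[OF u] by (intro a_le_terms small_term_nonpos[of 2, OF D]) auto
  then have "wt {u} id \<le> 1" using signed_wt_cyc[OF u] a1 by simp
  then have Buu: "B u u = 1" using u by (simp add: cyc_def wt_def)
  define X where "X = {x \<in> perms 3. 0 < case_prod signed_wt x}"
  define f where "f = (\<lambda>(S :: nat set, \<pi> :: nat \<Rightarrow> nat). (S - {u}, \<pi>))"
  have key: "u \<in> S \<and> (S - {u}, \<pi>) \<in> perms 2 \<and> signed_wt S \<pi> = - signed_wt (S - {u}) \<pi>"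
    if SX: "(S, \<pi>) \<in> X" for S \<pi>
  proof -
    have S: "S \<subseteq> {0..<n}" "card S = 3" "\<pi> permutes S" "finite S" and pos: "0 < signed_wt S \<pi>"
      using SX permsD by (auto simp: X_def)
    have w: "0 < wt S \<pi>" using signed_wt_nonzeroD[OF S(1,3)] pos by simp
    obtain s where s: "s \<in> S" using S by force
    note 1 = split_orbit[OF S(1,3) w s]
    define P \<sigma> \<tau> where "P = orbit \<pi> s" and "\<sigma> = perm_restrict \<pi> P" and "\<tau> = perm_restrict \<pi> (S - P)"
    note 1 = 1[folded P_def, folded \<sigma>_def \<tau>_def]
    have neg: "signed_wt P \<sigma> < 0" using signed_wt_cyc[OF 1(2)] 1(2) by (simp add: cyc_def)
    have ne: "S - P \<noteq> {}"
    proof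
      assume "S - P = {}"
      then have "P = S" using 1(1) by auto
      then have "\<sigma> = \<pi>" using S by (simp add: \<sigma>_def)
      then show False using neg pos \<open>P = S\<close> by simp
    qed
    have cP: "0 < card P" using card_cyc[OF 1(2)] by simp
    have cs: "card P + card (S - P) = 3"
      using card_split[OF 1(1) S(4)] S(2) by simp
    have cR: "0 < card (S - P)" using ne S by (simp add: card_gt_0_iff)
    have cycR: "cyc (S - P) \<tau>"
      by (rule small_cyc[of 2, OF D _ 1(3,4) ne]) (use S cs cP in auto)
    consider "card P = 1" | "card (S - P) = 1" using cs cP cR by linarith
    then have fixu: "u \<in> S \<and> \<pi> u = u"
    proof cases
      case 1
      then obtain w where w: "P = {w}" by (auto simp: card_1_singleton_iff)
      then have "\<sigma> = id" using cyc_singleton \<open>cyc P \<sigma>\<close> by blast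
      then have "w = u" using uniq \<open>cyc P \<sigma>\<close> w by blast
      moreover have "\<pi> w = \<sigma> w" using w by (simp add: \<sigma>_def perm_restrict_def)
      ultimately show ?thesis using \<open>\<sigma> = id\<close> w \<open>P \<subseteq> S\<close> by auto
    next
      case 2
      then obtain w where w: "S - P = {w}" by (auto simp: card_1_singleton_iff)
      then have "\<tau> = id" using cyc_singleton cycR by metis
      then have "w = u" using uniq cycR w by metis
      moreover have "\<pi> w = \<tau> w" using w by (simp add: \<tau>_def perm_restrict_def)
      ultimately show ?thesis using \<open>\<tau> = id\<close> w by auto
    qed
    then have per: "\<pi> permutes (S - {u})" using permutes_fixing_iff[of "{u}" S \<pi>] S by auto
    have c2: "card (S - {u}) = 2" using fixu S by simp
    then have p2: "(S - {u}, \<pi>) \<in> perms 2" using per S by (auto simp: perms_def)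
    have "wt S \<pi> = B u (\<pi> u) * wt (S - {u}) \<pi>"
      unfolding wt_def using fixu S by (subst prod.remove[of _ u]) auto
    then have ww: "wt S \<pi> = wt (S - {u}) \<pi>" using fixu Buu by simp
    have ne2: "S - {u} \<noteq> {}" using c2 by force
    have cu: "cyc (S - {u}) \<pi>"
      by (rule small_cyc[of 2, OF D _ per _ ne2]) (use S c2 w ww in auto)
    have "signed_wt S \<pi> = signed_wt P \<sigma> * signed_wt (S - P) \<tau>" by (rule 1(6))
    also have "\<dots> = wt S \<pi>" using signed_wt_cyc[OF 1(2)] signed_wt_cyc[OF cycR] 1(7) by simp
    finally show ?thesis using fixu p2 ww signed_wt_cyc[OF cu] by simp
  qed
  have "a 3 = (\<Sum>x\<in>X. case_prod signed_wt x) + (\<Sum>x\<in>perms 3 - X. case_prod signed_wt x)"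
    unfolding a_def using finite_perms by (subst sum.subset_diff[of X]) (auto simp: X_def)
  also have "(\<Sum>x\<in>perms 3 - X. case_prod signed_wt x) \<le> 0"
    by (intro sum_nonpos) (auto simp: X_def)
  also have "(\<Sum>x\<in>X. case_prod signed_wt x) = (\<Sum>x\<in>X. - case_prod signed_wt (f x))"
    using key by (intro sum.cong) (auto simp: f_def)
  also have "\<dots> = (\<Sum>x\<in>f ` X. - case_prod signed_wt x)"
  proof (rule sum.reindex[symmetric, unfolded o_def])
    show "inj_on f X"
    proof (rule inj_onI)
      fix x y assume xy: "x \<in> X" "y \<in> X" "f x = f y"
      obtain S \<pi> S' \<pi>' where "x = (S, \<pi>)" "y = (S', \<pi>')" by (cases x, cases y)
      then show "x = y" using xy key[of S \<pi>] key[of S' \<pi>'] by (auto simp: f_def)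
    qed
  qed
  also have "\<dots> \<le> (\<Sum>x\<in>perms 2. - case_prod signed_wt x)"
  proof (rule sum_mono2[OF finite_perms])
    show "f ` X \<subseteq> perms 2" using key by (auto simp: f_def)
    show "0 \<le> - case_prod signed_wt x" if "x \<in> perms 2 - f ` X" for x
      using small_term_nonpos[of 2 2, OF D] that by (cases x) auto
  qed
  also have "\<dots> = - a 2" by (simp add: a_def sum_negf)
  finally show ?thesis by simp
qed

text \<open>The two disjoint 2-cycles already exhaust \<open>a 2 = - 2\<close>, so they have weight
  1 and there is no other. Without loops a positive term of \<open>a 4\<close> consists of two
  2-cycles, which leaves a single candidate.\<close>

lemma a_four_le:
  assumes D: "\<And>p q. dj p q \<Longrightarrow> 3 < p + q" and n: "n \<le> 7" and no1: "\<not> len 1"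
    and a2: "a 2 = - 2" and dj: "dj 2 2"
  shows "a 4 \<le> 1"
proof -
  obtain S1 \<pi>1 S2 \<pi>2 where S1: "cyc S1 \<pi>1" "card S1 = 2" and S2: "cyc S2 \<pi>2" "card S2 = 2"
    and disj: "S1 \<inter> S2 = {}" using dj by (auto simp: dj_def)
  have ne: "(S1, \<pi>1) \<noteq> (S2, \<pi>2)" using disj cyc_ne[OF S1(1)] by auto
  have le: "a 2 \<le> - wt S1 \<pi>1 - wt S2 \<pi>2"
    by (rule a_le_two[of 3, OF D _ _ S1 S2 ne]) auto
  have wpos: "0 < wt S \<pi>" if "cyc S \<pi>" for S \<pi> using that by (simp add: cyc_def)
  have w1: "wt S1 \<pi>1 = 1" "wt S2 \<pi>2 = 1"
    using le a2 wpos[OF S1(1)] wpos[OF S2(1)] by linarith+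
  have only: "(S, \<pi>) = (S1, \<pi>1) \<or> (S, \<pi>) = (S2, \<pi>2)" if S: "cyc S \<pi>" "card S = 2" for S \<pi>
  proof (rule ccontr)
    assume ne': "\<not> ?thesis"
    have sub: "{(S, \<pi>), (S1, \<pi>1), (S2, \<pi>2)} \<subseteq> perms 2"
      using cyc_perms[OF S(1)] cyc_perms[OF S1(1)] cyc_perms[OF S2(1)] S S1 S2 by auto
    have "a 2 \<le> (\<Sum>(S, \<pi>)\<in>{(S, \<pi>), (S1, \<pi>1), (S2, \<pi>2)}. signed_wt S \<pi>)"
      by (rule a_le_terms[OF small_term_nonpos[of 3, OF D] sub]) auto
    also have "\<dots> = - wt S \<pi> - wt S1 \<pi>1 - wt S2 \<pi>2"
      using ne ne' signed_wt_cyc[OF S(1)] signed_wt_cyc[OF S1(1)] signed_wt_cyc[OF S2(1)] by auto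
    finally show False using a2 wpos[OF S1(1)] wpos[OF S2(1)] wpos[OF S(1)] by linarith
  qed
  define X where "X = {x \<in> perms 4. 0 < case_prod signed_wt x}"
  have comm: "\<pi>1 \<circ> \<pi>2 = \<pi>2 \<circ> \<pi>1"
  proof
    fix x
    have p: "\<pi>1 permutes S1" "\<pi>2 permutes S2" using S1 S2 by (auto simp: cyc_def)
    consider "x \<in> S1" | "x \<in> S2" | "x \<notin> S1" "x \<notin> S2" by blast
    then show "(\<pi>1 \<circ> \<pi>2) x = (\<pi>2 \<circ> \<pi>1) x"
    proof cases
      case 1
      then have "x \<notin> S2" "\<pi>1 x \<notin> S2" using disj permutes_in_image[OF p(1), of x] by auto
      then show ?thesis using p by (simp add: permutes_not_in)
    next
      case 2
      then have "x \<notin> S1" "\<pi>2 x \<notin> S1" using disj permutes_in_image[OF p(2), of x] by auto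
      then show ?thesis using p by (simp add: permutes_not_in)
    qed (use p in \<open>simp add: permutes_not_in\<close>)
  qed
  have key: "(S, \<pi>) = (S1 \<union> S2, \<pi>1 \<circ> \<pi>2) \<and> signed_wt S \<pi> = 1" if SX: "(S, \<pi>) \<in> X" for S \<pi>
  proof -
    have S: "S \<subseteq> {0..<n}" "card S = 4" "\<pi> permutes S" "finite S" and pos: "0 < signed_wt S \<pi>"
      using SX permsD by (auto simp: X_def)
    have nn: "n \<le> 2 * 3 + 1" using n by simp
    have "S \<noteq> {}" using S by auto
    from pos_term[OF D nn S(1,3) pos this] obtain P \<sigma> \<tau> where P: "P \<subseteq> S" "cyc P \<sigma>" "cyc (S - P) \<tau>"
      "\<pi> = \<sigma> \<circ> \<tau>" "wt S \<pi> = wt P \<sigma> * wt (S - P) \<tau>" "signed_wt S \<pi> = wt S \<pi>"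
      by metis
    have cs: "card P + card (S - P) = 4"
      using card_split[OF P(1) S(4)] S(2) by simp
    have "card P \<noteq> 1" "card (S - P) \<noteq> 1" "card P \<noteq> 0" "card (S - P) \<noteq> 0"
      using no1 P card_cyc[OF P(2)] card_cyc[OF P(3)] by (auto simp: len_def)
    then have c: "card P = 2" "card (S - P) = 2" using cs by linarith+
    have SU: "S = P \<union> (S - P)" using P(1) by auto
    have PR: "P \<inter> (S - P) = {}" "P \<noteq> {}" using cyc_ne[OF P(2)] by auto
    from only[OF P(2) c(1)] only[OF P(3) c(2)] PR
    consider "P = S1" "\<sigma> = \<pi>1" "S - P = S2" "\<tau> = \<pi>2" | "P = S2" "\<sigma> = \<pi>2" "S - P = S1" "\<tau> = \<pi>1"
      by auto
    then show ?thesis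
      by cases (use P SU w1 comm in \<open>auto simp: Un_commute\<close>)
  qed
  have "a 4 = (\<Sum>x\<in>X. case_prod signed_wt x) + (\<Sum>x\<in>perms 4 - X. case_prod signed_wt x)"
    unfolding a_def using finite_perms by (subst sum.subset_diff[of X]) (auto simp: X_def)
  also have "(\<Sum>x\<in>perms 4 - X. case_prod signed_wt x) \<le> 0"
    by (intro sum_nonpos) (auto simp: X_def)
  also have "(\<Sum>x\<in>X. case_prod signed_wt x) = (\<Sum>x\<in>X. 1)"
    using key by (intro sum.cong) auto
  also have "\<dots> \<le> 1"
  proof -
    have "X \<subseteq> {(S1 \<union> S2, \<pi>1 \<circ> \<pi>2)}" using key by auto
    then have "card X \<le> 1" using card_mono[of "{(S1 \<union> S2, \<pi>1 \<circ> \<pi>2)}" X] by simp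
    then show ?thesis by simp
  qed
  finally show ?thesis by simp
qed

end

subsection \<open>Existence of Perron vectors\<close>

text \<open>Vectors are plain functions and the matrix stays integral, so that one matrix acts on
  real and on complex vectors alike.\<close>

definition act :: "int mat \<Rightarrow> (nat \<Rightarrow> 'a :: comm_ring_1) \<Rightarrow> nat \<Rightarrow> 'a" where
  "act A x i = (\<Sum>j<dim_col A. of_int (A $$ (i, j)) * x j)"

lemma index_mult_mat_sum:
  assumes "A \<in> carrier_mat n n" "B \<in> carrier_mat n n" "i < n" "j < n"
  shows "(A * B) $$ (i, j) = (\<Sum>k<n. A $$ (i, k) * B $$ (k, j))"
  using assms by (auto simp: scalar_prod_def lessThan_atLeast0)

lemma act_mult:
  assumes A: "A \<in> carrier_mat n n" and B: "B \<in> carrier_mat n n" and i: "i < n"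
  shows "act (A * B) x i = act A (act B x) i"
proof -
  have "act (A * B) x i = (\<Sum>j<n. (\<Sum>k<n. of_int (A $$ (i, k)) * of_int (B $$ (k, j))) * x j)"
    using A B unfolding act_def
    by (intro sum.cong) (auto simp: index_mult_mat_sum[OF A B i] simp del: index_mult_mat(1))
  also have "\<dots> = (\<Sum>k<n. of_int (A $$ (i, k)) * (\<Sum>j<n. of_int (B $$ (k, j)) * x j))"
    unfolding sum_distrib_right sum_distrib_left
    by (subst sum.swap) (simp add: mult.assoc)
  finally show ?thesis using A B by (simp add: act_def)
qed

lemma act_cong: "A \<in> carrier_mat n n \<Longrightarrow> (\<And>j. j < n \<Longrightarrow> x j = y j) \<Longrightarrow> act A x i = act A y i"
  by (auto simp: act_def intro!: sum.cong)

lemma act_scale: "act A (\<lambda>j. c * x j) i = c * act A x i"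
  by (simp add: act_def sum_distrib_left mult.left_commute)

lemma act_pow_Suc:
  assumes A: "A \<in> carrier_mat n n" and i: "i < n"
  shows "act (A ^\<^sub>m Suc k) x i = act (A ^\<^sub>m k) (act A x) i"
  using act_mult[OF pow_carrier_mat[OF A] A i] by simp

lemma act_pow_0:
  assumes A: "A \<in> carrier_mat n n" and i: "i < n"
  shows "act (A ^\<^sub>m 0) x i = x i"
proof -
  have "act (A ^\<^sub>m 0) x i = (\<Sum>j<n. if j = i then x j else 0)"
    unfolding act_def using A i by (intro sum.cong) auto
  then show ?thesis using i by simp
qed

lemma act_pow_comm:
  assumes A: "A \<in> carrier_mat n n" and i: "i < n"
  shows "act A (act (A ^\<^sub>m k) x) i = act (A ^\<^sub>m k) (act A x) i"
  using i
proof (induction k arbitrary: x i)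
  case 0
  have "act A (act (A ^\<^sub>m 0) x) i = act A x i"
    by (rule act_cong[OF A act_pow_0[OF A]])
  then show ?case using act_pow_0[OF A 0] by metis
next
  case (Suc k)
  have "act A (act (A ^\<^sub>m Suc k) x) i = act A (act (A ^\<^sub>m k) (act A x)) i"
    using act_pow_Suc[OF A] by (intro act_cong[OF A]) blast
  also have "\<dots> = act (A ^\<^sub>m k) (act A (act A x)) i" by (rule Suc.IH[OF Suc.prems])
  also have "\<dots> = act (A ^\<^sub>m Suc k) (act A x) i" by (rule act_pow_Suc[OF A Suc.prems, symmetric])
  finally show ?case .
qed

lemma act_pow_eigen:
  assumes A: "A \<in> carrier_mat n n" and eig: "\<And>i. i < n \<Longrightarrow> act A x i = c * x i" and i: "i < n"
  shows "act (A ^\<^sub>m k) x i = c ^ k * x i"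
  using i
proof (induction k arbitrary: i)
  case 0
  then show ?case using act_pow_0[OF A] by simp
next
  case (Suc k)
  have "act (A ^\<^sub>m Suc k) x i = act (A ^\<^sub>m k) (act A x) i" by (rule act_pow_Suc[OF A Suc.prems])
  also have "\<dots> = act (A ^\<^sub>m k) (\<lambda>j. c * x j) i" by (rule act_cong[OF pow_carrier_mat[OF A] eig])
  also have "\<dots> = c * (c ^ k * x i)" using Suc.IH[OF Suc.prems] by (simp only: act_scale)
  finally show ?case by simp
qed

lemma act_mono:
  fixes x y :: "nat \<Rightarrow> real"
  assumes A: "A \<in> carrier_mat n n" and nn: "nonneg_matrix A" and i: "i < n"
    and le: "\<And>j. j < n \<Longrightarrow> x j \<le> y j"
  shows "act A x i \<le> act A y i"
  using assms by (auto simp: act_def nonneg_matrix_def intro!: sum_mono mult_left_mono)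

lemma act_pos:
  fixes x :: "nat \<Rightarrow> real"
  assumes A: "A \<in> carrier_mat n n" and pos: "pos_matrix A" and i: "i < n"
    and x: "\<And>j. j < n \<Longrightarrow> 0 \<le> x j" and j: "j < n" "x j \<noteq> 0"
  shows "0 < act A x i"
proof -
  have "0 < x j" using x[OF j(1)] j(2) by simp
  then have "0 < of_int (A $$ (i, j)) * x j"
    using A pos i j by (auto simp: pos_matrix_def intro!: mult_pos_pos)
  also have "\<dots> \<le> act A x i"
    unfolding act_def using assms
    by (intro member_le_sum mult_nonneg_nonneg) (auto simp: pos_matrix_def less_imp_le)
  finally show ?thesis .
qed

lemma pow_smult_mat:
  fixes A :: "'a :: comm_semiring_1 mat"
  assumes A: "A \<in> carrier_mat n n"
  shows "(c \<cdot>\<^sub>m A) ^\<^sub>m k = c ^ k \<cdot>\<^sub>m (A ^\<^sub>m k)"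
proof (induction k)
  case 0
  show ?case using A by (intro eq_matI) auto
next
  case (Suc k)
  have "(c \<cdot>\<^sub>m A) ^\<^sub>m Suc k = (c ^ k \<cdot>\<^sub>m (A ^\<^sub>m k)) * (c \<cdot>\<^sub>m A)" using Suc by simp
  also have "\<dots> = c ^ Suc k \<cdot>\<^sub>m (A ^\<^sub>m k * A)"
    using A pow_carrier_mat[OF A, of k]
    by (simp add: mult_smult_distrib[of _ n n _ n] mult_smult_assoc_mat[of _ n n _ n])
      (intro eq_matI, auto simp: mult_ac)
  finally show ?case by simp
qed

text \<open>The Collatz-Wielandt lower bound. For \<open>u\<close> strictly between the spectral
  radius and \<open>s\<close>, the powers of the matrix divided by \<open>u\<close> are bounded, by
  its Jordan form; but iterating the hypothesis makes them grow at least like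
  \<open>(s / u) ^ k\<close>.\<close>

lemma spectral_radius_ge_of_super:
  fixes A :: "int mat" and b :: "nat \<Rightarrow> real"
  assumes A: "A \<in> carrier_mat n n" and n: "0 < n" and nn: "nonneg_matrix A"
    and b: "\<And>i. i < n \<Longrightarrow> 0 < b i" and sup: "\<And>i. i < n \<Longrightarrow> s * b i \<le> act A b i"
  shows "s \<le> spectral_radius (complex_of_int_mat A)"
proof (rule ccontr)
  let ?C = "complex_of_int_mat A" and ?r = "spectral_radius (complex_of_int_mat A)"
  assume "\<not> ?thesis"
  then have rs: "?r < s" by simp
  have C: "?C \<in> carrier_mat n n" using A by simp
  have "0 \<le> ?r" using spectral_radius_mem_max(1)[OF C n] by auto
  define u where "u = (?r + s) / 2"
  have u: "?r < u" "u < s" "0 < u" using rs \<open>0 \<le> ?r\<close> by (auto simp: u_def)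
  define M where "M = complex_of_real (1 / u) \<cdot>\<^sub>m ?C"
  have M: "M \<in> carrier_mat n n" using C by (simp add: M_def)
  have "spectral_radius M < 1"
  proof -
    obtain \<mu> where \<mu>: "eigenvalue M \<mu>" "spectral_radius M = norm \<mu>"
      using spectral_radius_mem_max(1)[OF M n] by (auto simp: spectrum_def)
    then obtain w where w: "eigenvector M w \<mu>" by (auto simp: eigenvalue_def)
    have CM: "?C = complex_of_real u \<cdot>\<^sub>m M"
      using u by (intro eq_matI) (auto simp: M_def)
    have "w \<in> carrier_vec n" using w M by (auto simp: eigenvector_def)
    then have "?C *\<^sub>v w = complex_of_real u \<cdot>\<^sub>v (M *\<^sub>v w)"
      using M unfolding CM
      by (intro eq_vecI) (auto simp: scalar_prod_def sum_distrib_left mult.assoc)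
    also have "\<dots> = (complex_of_real u * \<mu>) \<cdot>\<^sub>v w"
      using w by (simp add: eigenvector_def smult_smult_assoc)
    finally have "eigenvector ?C w (complex_of_real u * \<mu>)"
      using w M C by (auto simp: eigenvector_def)
    then have "norm (complex_of_real u * \<mu>) \<in> norm ` spectrum ?C"
      unfolding spectrum_def eigenvalue_def by (intro imageI) blast
    from spectral_radius_mem_max(2)[OF C n this] have "u * norm \<mu> \<le> ?r"
      using u by (simp add: norm_mult)
    then have "u * norm \<mu> < u * 1" using u by linarith
    then show ?thesis using u \<mu> by simp
  qed
  from spectral_radius_jnf_norm_bound_less_1_upper_triangular[OF M this]
  obtain c where c: "\<And>k. norm_bound (M ^\<^sub>m k) c" by blast
  have nnk: "nonneg_matrix (A ^\<^sub>m k)" for k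
  proof (induction k)
    case 0
    show ?case using A by (auto simp: nonneg_matrix_def)
  next
    case (Suc k)
    show ?case unfolding nonneg_matrix_def
    proof (intro allI impI)
      fix i j assume "i < dim_row (A ^\<^sub>m Suc k)" "j < dim_col (A ^\<^sub>m Suc k)"
      then have ij: "i < n" "j < n" using A by auto
      have "(A ^\<^sub>m Suc k) $$ (i, j) = (\<Sum>l<n. (A ^\<^sub>m k) $$ (i, l) * A $$ (l, j))"
        using index_mult_mat_sum[OF pow_carrier_mat[OF A] A ij] by simp
      also have "\<dots> \<ge> 0" using Suc nn ij A
        by (intro sum_nonneg mult_nonneg_nonneg) (auto simp: nonneg_matrix_def)
      finally show "0 \<le> (A ^\<^sub>m Suc k) $$ (i, j)" .
    qed
  qed
  have ge: "s ^ k * b i \<le> act (A ^\<^sub>m k) b i" if "i < n" for k i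
    using that
  proof (induction k arbitrary: i)
    case 0
    then show ?case using act_pow_0[OF A, of i b] by simp
  next
    case (Suc k)
    have "s ^ Suc k * b i = s * (s ^ k * b i)" by simp
    also have "\<dots> \<le> s * act (A ^\<^sub>m k) b i" using Suc u by (intro mult_left_mono) auto
    also have "\<dots> = act (A ^\<^sub>m k) (\<lambda>j. s * b j) i" by (simp add: act_scale)
    also have "\<dots> \<le> act (A ^\<^sub>m k) (act A b) i"
      by (rule act_mono[OF pow_carrier_mat[OF A] nnk Suc.prems sup])
    also have "\<dots> = act (A ^\<^sub>m Suc k) b i" by (rule act_pow_Suc[OF A Suc.prems, symmetric])
    finally show ?case .
  qed
  define K where "K = c * (\<Sum>j<n. b j)"
  have bound: "(s / u) ^ k * b 0 \<le> K" for k
  proof -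
    have entry: "(A ^\<^sub>m k) $$ (0, j) \<le> c * u ^ k" if j: "j < n" for j
    proof -
      have "norm ((M ^\<^sub>m k) $$ (0, j)) \<le> c"
        using c[of k] j n M by (auto simp: norm_bound_def)
      moreover have "(M ^\<^sub>m k) $$ (0, j) = complex_of_real (1 / u) ^ k * of_int ((A ^\<^sub>m k) $$ (0, j))"
        unfolding M_def pow_smult_mat[OF C] of_int_hom.mat_hom_pow[OF A, symmetric]
        using A j n by simp
      ultimately have "real_of_int \<bar>(A ^\<^sub>m k) $$ (0, j)\<bar> / u ^ k \<le> c"
        using u by (simp add: norm_mult norm_power power_divide norm_divide)
      then have "real_of_int \<bar>(A ^\<^sub>m k) $$ (0, j)\<bar> \<le> c * u ^ k"
        using u by (simp add: divide_le_eq)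
      then show ?thesis by linarith
    qed
    have "s ^ k * b 0 \<le> act (A ^\<^sub>m k) b 0" using ge n by blast
    also have "\<dots> \<le> (\<Sum>j<n. (c * u ^ k) * b j)"
      unfolding act_def using A entry b
      by (auto intro!: sum_mono mult_right_mono simp: less_imp_le)
    also have "\<dots> = K * u ^ k" by (simp add: K_def sum_distrib_left sum_distrib_right mult_ac)
    finally show ?thesis using u by (simp add: power_divide divide_le_eq)
  qed
  have "1 < s / u" using u by simp
  then obtain k where "K / b 0 < (s / u) ^ k" using real_arch_pow by blast
  then show False using bound[of k] b[OF n] by (simp add: divide_less_eq)
qed

text \<open>Wielandt's argument. The moduli \<open>a\<close> of a dominant eigenvector satisfy
  \<open>?r * a i \<le> act A a i\<close> by the triangle inequality. A strict inequality at one
  index becomes strict at all indices after applying the positive power \<open>P\<close>, against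
  the Collatz-Wielandt bound. So \<open>a\<close> is a Perron vector, and equality in the triangle
  inequality for a row of \<open>P\<close> aligns the entries of the eigenvector, which forces
  \<open>l\<close> to be real.\<close>

theorem perron_vector:
  fixes A :: "int mat"
  defines "C \<equiv> complex_of_int_mat A"
  assumes A: "A \<in> carrier_mat n n" and n: "0 < n" and prim: "primitive_matrix A"
    and ev: "eigenvalue C l" and nl: "norm l = spectral_radius C"
  shows "\<exists>v :: nat \<Rightarrow> real. (\<forall>i<n. 0 < v i) \<and> (\<forall>i<n. act A v i = spectral_radius C * v i)"
    and "l = of_real (spectral_radius C)"
proof -
  let ?r = "spectral_radius C"
  have C: "C \<in> carrier_mat n n" using A by (simp add: C_def)
  have nn: "nonneg_matrix A" using prim by (simp add: primitive_matrix_def)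
  obtain k where k: "pos_matrix (A ^\<^sub>m k)" using prim by (auto simp: primitive_matrix_def)
  define P where "P = A ^\<^sub>m k"
  have P: "P \<in> carrier_mat n n" "pos_matrix P" using A k by (auto simp: P_def)
  obtain x where x: "eigenvector C x l" using ev by (auto simp: eigenvalue_def)
  define w where "w j = x $ j" for j
  have dx: "dim_vec x = n" using x C by (auto simp: eigenvector_def)
  have Aw: "act A w i = l * w i" if i: "i < n" for i
  proof -
    have "(C *\<^sub>v x) $ i = (l \<cdot>\<^sub>v x) $ i" using x by (simp add: eigenvector_def)
    then show ?thesis using i A dx
      by (simp add: C_def w_def act_def scalar_prod_def lessThan_atLeast0)
  qed
  obtain j0 where j0: "j0 < n" "w j0 \<noteq> 0"
  proof -
    have "\<exists>j<n. x $ j \<noteq> 0"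
    proof (rule ccontr)
      assume "\<not> ?thesis"
      then have "x = 0\<^sub>v n" using dx by (intro eq_vecI) auto
      then show False using x C by (auto simp: eigenvector_def)
    qed
    then show ?thesis using that by (auto simp: w_def)
  qed
  define a where "a j = norm (w j)" for j
  have a: "0 \<le> a j" for j by (simp add: a_def)
  have Aa: "?r * a i \<le> act A a i" if i: "i < n" for i
  proof -
    have "?r * a i = norm (act A w i)" using Aw[OF i] nl by (simp add: a_def norm_mult)
    also have "\<dots> \<le> (\<Sum>j<n. norm (of_int (A $$ (i, j)) * w j))"
      using A by (simp add: act_def norm_sum)
    also have "\<dots> = act A a i"
      using A i nn by (auto simp: act_def a_def norm_mult nonneg_matrix_def intro!: sum.cong)
    finally show ?thesis .
  qed
  have eq: "act A a i = ?r * a i" if i: "i < n" for i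
  proof (rule ccontr)
    assume ne: "act A a i \<noteq> ?r * a i"
    define b where "b = act P a"
    define d where "d j = act A a j - ?r * a j" for j
    have b: "0 < b j" if "j < n" for j
      unfolding b_def using act_pos[OF P that, of a j0] a j0 by (simp add: a_def)
    have Pd: "0 < act P d j" if "j < n" for j
      using act_pos[OF P that, of d i] Aa ne i by (auto simp: d_def)
    have Ab: "act A b j = ?r * b j + act P d j" if j: "j < n" for j
    proof -
      have "act A b j = act P (act A a) j"
        unfolding b_def P_def by (rule act_pow_comm[OF A j])
      also have "\<dots> = act P (\<lambda>j. ?r * a j + d j) j" by (simp add: d_def)
      also have "\<dots> = act P (\<lambda>j. ?r * a j) j + act P d j"
        by (simp add: act_def algebra_simps sum.distrib)
      finally show ?thesis by (simp add: act_scale b_def)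
    qed
    \<comment> \<open>The least relative surplus over all indices, so that \<open>b\<close>
      satisfies the Collatz-Wielandt hypothesis with \<open>?r + e\<close>.\<close>
    define e where "e = Min ((\<lambda>j. act P d j / b j) ` {..<n})"
    have "e \<in> (\<lambda>j. act P d j / b j) ` {..<n}" unfolding e_def using n by (intro Min_in) auto
    then have "0 < e" using Pd b by auto
    have "(?r + e) * b j \<le> act A b j" if j: "j < n" for j
    proof -
      have "e \<le> act P d j / b j" unfolding e_def using j by (intro Min_le) auto
      then have "e * b j \<le> act P d j" using b[OF j] by (simp add: le_divide_eq)
      then show ?thesis using Ab[OF j] by (simp add: algebra_simps)
    qed
    from spectral_radius_ge_of_super[OF A n nn b this] show False
      using \<open>0 < e\<close> by (simp add: C_def)
  qed
  have Pa: "act P a i = ?r ^ k * a i" if "i < n" for i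
    unfolding P_def by (rule act_pow_eigen[OF A eq that])
  have apos: "0 < a i" if i: "i < n" for i
  proof -
    have "0 < act P a i" using act_pos[OF P i, of a j0] a j0 by (simp add: a_def)
    then have "a i \<noteq> 0" using Pa[OF i] by auto
    then show ?thesis using a[of i] by linarith
  qed
  show "\<exists>v :: nat \<Rightarrow> real. (\<forall>i<n. 0 < v i) \<and> (\<forall>i<n. act A v i = ?r * v i)"
    using apos eq by blast
  define z where "z = l ^ k * w 0"
  have Pw: "act P w 0 = z" unfolding z_def P_def by (rule act_pow_eigen[OF A Aw n])
  have nz: "norm z = act P a 0"
    using Pa[OF n] nl by (simp add: z_def norm_mult norm_power a_def)
  have "0 < act P a 0" using act_pos[OF P n, of a j0] a j0 by (simp add: a_def)
  then have "z \<noteq> 0" using nz by auto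
  \<comment> \<open>\<open>c\<close> is the common phase of all \<open>w j\<close>: row 0 of
    \<open>P\<close> has positive entries, so no single summand may lose anything when projected to
    the direction of the sum \<open>z\<close>.\<close>
  define c where "c = z / of_real (norm z)"
  have nc: "norm c = 1" using \<open>z \<noteq> 0\<close> by (simp add: c_def norm_divide)
  have ccn: "cnj c * c = 1" using nc complex_norm_square[of c] by (simp add: mult.commute)
  have czn: "cnj c * z = of_real (norm z)"
  proof -
    have "z = c * of_real (norm z)" using \<open>z \<noteq> 0\<close> by (simp add: c_def)
    then have "cnj c * z = (cnj c * c) * of_real (norm z)" by (metis mult.assoc)
    then show ?thesis using ccn by simp
  qed
  have "(\<Sum>j<n. of_int (P $$ (0, j)) * (a j - Re (cnj c * w j))) = act P a 0 - Re (cnj c * act P w 0)"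
  proof -
    have "Re (act P y 0) = (\<Sum>j<n. of_int (P $$ (0, j)) * Re (y j))" for y :: "nat \<Rightarrow> complex"
      using P(1) by (simp add: act_def)
    from this[of "\<lambda>j. cnj c * w j"] show ?thesis
      using P(1) unfolding act_scale by (simp only: right_diff_distrib sum_subtractf)
        (simp add: act_def)
  qed
  also have "\<dots> = 0" using Pw czn nz by simp
  finally have sum0: "(\<Sum>j<n. of_int (P $$ (0, j)) * (a j - Re (cnj c * w j))) = 0" .
  have le: "Re (cnj c * w j) \<le> a j" for j
    using complex_Re_le_cmod[of "cnj c * w j"] nc by (simp add: norm_mult a_def)
  have Ppos: "0 < P $$ (0, j)" if "j < n" for j using P n that by (auto simp: pos_matrix_def)
  have wj: "w j = c * of_real (a j)" if j: "j < n" for j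
  proof -
    have "of_int (P $$ (0, j)) * (a j - Re (cnj c * w j)) = 0"
      using sum_nonneg_0[OF _ _ sum0, of j] le Ppos j by (auto simp: less_imp_le)
    then have Re: "Re (cnj c * w j) = norm (cnj c * w j)"
      using Ppos[OF j] nc by (simp add: norm_mult a_def)
    then have "cnj c * w j = of_real (a j)"
      using nc cmod_power2[of "cnj c * w j"] by (simp add: complex_eq_iff norm_mult a_def)
    then have "c * (cnj c * w j) = c * of_real (a j)" by simp
    then show ?thesis using ccn by (simp add: mult.assoc[symmetric] mult.commute[of c])
  qed
  have "l * w 0 = act A w 0" using Aw n by simp
  also have "\<dots> = act A (\<lambda>j. c * of_real (a j)) 0" by (rule act_cong[OF A wj])
  also have "\<dots> = c * of_real (act A a 0)" by (simp add: act_scale) (simp add: act_def)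
  also have "\<dots> = of_real ?r * w 0" using eq[OF n] wj[OF n] by simp
  finally have "(l - of_real ?r) * w 0 = 0" by (simp add: algebra_simps)
  moreover have "w 0 \<noteq> 0" using apos[OF n] by (simp add: a_def)
  ultimately show "l = of_real ?r" by simp
qed

lemma walk_of_pow_pos:
  fixes A :: "int mat"
  assumes A: "A \<in> carrier_mat n n" and nn: "nonneg_matrix A"
    and "i < n" "j < n" "0 < (A ^\<^sub>m k) $$ (i, j)"
  shows "\<exists>f. f 0 = i \<and> f k = j \<and> (\<forall>l<k. f l < n \<and> f (Suc l) < n \<and> 0 < A $$ (f l, f (Suc l)))"
  using assms(3-)
proof (induction k arbitrary: j)
  case 0
  then have "i = j" using A by (auto split: if_splits)
  then show ?case by auto
next
  case (Suc k)
  have "(A ^\<^sub>m Suc k) $$ (i, j) = (\<Sum>l<n. (A ^\<^sub>m k) $$ (i, l) * A $$ (l, j))"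
    using index_mult_mat_sum[OF pow_carrier_mat[OF A] A] Suc by simp
  then have "\<exists>l\<in>{..<n}. 0 < (A ^\<^sub>m k) $$ (i, l) * A $$ (l, j)"
    using Suc.prems(3) sum_nonpos[of "{..<n}" "\<lambda>l. (A ^\<^sub>m k) $$ (i, l) * A $$ (l, j)"]
    by (metis not_less)
  then obtain l where l: "l < n" "0 < (A ^\<^sub>m k) $$ (i, l) * A $$ (l, j)" by auto
  moreover have "0 \<le> A $$ (l, j)" using nn A l Suc by (auto simp: nonneg_matrix_def)
  ultimately have pos: "0 < (A ^\<^sub>m k) $$ (i, l)" "0 < A $$ (l, j)"
    by (auto simp: zero_less_mult_iff)
  from Suc.IH[OF Suc.prems(1) l(1) pos(1)] obtain f where f: "f 0 = i" "f k = l"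
    "\<forall>l<k. f l < n \<and> f (Suc l) < n \<and> 0 < A $$ (f l, f (Suc l))" by blast
  show ?case
    by (rule exI[of _ "f(Suc k := j)"]) (use f l pos Suc.prems in \<open>auto simp: less_Suc_eq\<close>)
qed

subsection \<open>Skew-reciprocal coefficient sequences\<close>

lemma nontrivial_root_of_unity:
  assumes "2 \<le> (i :: nat)" obtains \<omega> :: complex where "norm \<omega> = 1" "\<omega> ^ i = 1" "\<omega> \<noteq> 1"
proof
  let ?\<omega> = "cis (2 * pi / i)"
  show "?\<omega> ^ i = 1" using assms by (simp add: DeMoivre)
  show "?\<omega> \<noteq> 1"
  proof
    assume "?\<omega> = 1"
    then have "cos (2 * pi / i) = 1" by (simp add: complex_eq_iff)
    then obtain k :: int where "2 * pi / i = of_int k * (2 * pi)"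
      using cos_one_2pi_int by auto
    then have "1 = of_int k * real i" using assms by (simp add: field_simps)
    then have "1 = k * int i" by (metis of_int_1 of_int_eq_iff of_int_mult of_int_of_nat_eq)
    then have "int i dvd 1" by (metis dvd_triv_right)
    then show False using assms by simp
  qed
qed simp

text \<open>\<open>\<epsilon>\<close> is the determinant. By \<open>Q0\<close> and
  \<open>dom\<close>, \<open>t\<close> is the only root of modulus \<open>t\<close> of the reversed
  characteristic polynomial; this is what primitivity contributes. \<open>M\<close> says
  \<open>1 < recip_sum g t\<close>, that is, \<open>1 / mu g < t\<close>.\<close>

locale skew_coeffs =
  fixes g :: nat and t :: real and a :: "nat \<Rightarrow> int" and \<epsilon> :: int
  assumes g: "2 \<le> g" and t: "0 < t" "t < 1" and a0: "a 0 = 1"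
    and eps: "\<epsilon> = 1 \<or> \<epsilon> = - 1"
    and skew: "m \<le> 2 * g \<Longrightarrow> a (2 * g - m) = \<epsilon> * (- 1) ^ m * a m"
    and Q0: "(\<Sum>m\<le>2 * g. of_int (a m) * t ^ m) = 0"
    and dom: "norm (z :: complex) = t \<Longrightarrow> (\<Sum>m\<le>2 * g. of_int (a m) * z ^ m) = 0 \<Longrightarrow> z = of_real t"
    and M: "1 < t ^ (g - (if odd g then 2 else 1)) + t ^ (g + (if odd g then 2 else 1)) + t ^ (2 * g)"
begin

abbreviation x :: real where "x \<equiv> t ^ g"
abbreviation y :: real where "y \<equiv> t ^ (2 * g)"
definition c :: "nat \<Rightarrow> real" where "c m = - of_int (a m)"
text \<open>The factor of \<open>c m\<close> after the terms at \<open>m\<close> and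
  \<open>2 * g - m\<close> are merged. Its two powers are added for even \<open>m\<close> if
  \<open>\<epsilon> = 1\<close>, for odd \<open>m\<close> if \<open>\<epsilon> = - 1\<close>, and
  subtracted otherwise.\<close>

definition w :: "nat \<Rightarrow> real" where "w m = t ^ m + of_int \<epsilon> * (- 1) ^ m * t ^ (2 * g - m)"

lemma y: "y = x * x" by (simp add: power_mult power2_eq_square mult.commute[of 2])

lemma x01: "0 < x" "x < 1" using t g by (auto simp: power_less_one_iff)

lemma poly_split:
  fixes z :: "'a :: comm_ring_1"
  shows "(\<Sum>m\<le>2 * g. of_int (a m) * z ^ m) =
    1 + of_int \<epsilon> * z ^ (2 * g) + of_int (a g) * z ^ g +
    (\<Sum>m\<in>{1..<g}. of_int (a m) * (z ^ m + of_int \<epsilon> * (- 1) ^ m * z ^ (2 * g - m)))"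
proof -
  let ?f = "\<lambda>m. of_int (a m) * z ^ m"
  have "{..2 * g} = {..<g} \<union> {g..2 * g}" using g by auto
  then have "sum ?f {..2 * g} = sum ?f {..<g} + sum ?f {g..2 * g}"
    by (simp only:) (rule sum.union_disjoint; auto)
  also have "sum ?f {g..2 * g} = ?f g + sum ?f {g<..2 * g}" using g by (intro sum.head) simp
  also have "sum ?f {g<..2 * g} = (\<Sum>m<g. ?f (2 * g - m))"
    by (rule sum.reindex_bij_witness[of _ "\<lambda>m. 2 * g - m" "\<lambda>m. 2 * g - m"]) auto
  also have "\<dots> = (\<Sum>m<g. of_int (a m) * (of_int \<epsilon> * (- 1) ^ m * z ^ (2 * g - m)))"
  proof (intro sum.cong refl)
    fix m assume "m \<in> {..<g}"
    then have "a (2 * g - m) = \<epsilon> * (- 1) ^ m * a m" by (intro skew) auto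
    then show "?f (2 * g - m) = of_int (a m) * (of_int \<epsilon> * (- 1) ^ m * z ^ (2 * g - m))"
      by simp
  qed
  also have "sum ?f {..<g} + (?f g + \<dots>) = ?f g +
     (\<Sum>m<g. of_int (a m) * (z ^ m + of_int \<epsilon> * (- 1) ^ m * z ^ (2 * g - m)))"
    by (simp add: sum.distrib algebra_simps)
  also have "{..<g} = insert 0 {1..<g}" using g by auto
  finally show ?thesis by (simp add: a0 add_ac)
qed

lemma key: "(\<Sum>m\<in>{1..<g}. c m * w m) + c g * x = 1 + of_int \<epsilon> * y"
  using Q0 unfolding poly_split by (simp add: c_def w_def sum_negf)

lemma pw: "j \<le> 2 * g \<Longrightarrow> t ^ j * t ^ (2 * g - j) = y" by (simp flip: power_add)

lemma w_pos: assumes "j < g" shows "0 < w j"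
proof -
  have "t ^ (2 * g - j) < t ^ j" using t assms by (intro power_strict_decreasing) auto
  moreover have "0 < t ^ (2 * g - j)" using t by simp
  moreover have "of_int \<epsilon> * (- 1 :: real) ^ j = 1 \<or> of_int \<epsilon> * (- 1 :: real) ^ j = - 1"
    using eps by (cases "even j") auto
  ultimately show ?thesis by (auto simp: w_def)
qed

lemma amgm: assumes "j \<le> 2 * g" shows "2 * x \<le> t ^ j + t ^ (2 * g - j)"
proof -
  have J: "0 < t ^ j" using t by simp
  have "0 \<le> (t ^ j - x)\<^sup>2" by simp
  also have "\<dots> = t ^ j * (t ^ j + t ^ (2 * g - j) - 2 * x)"
    using pw[OF assms] y by (simp add: power2_eq_square algebra_simps)
  finally show ?thesis using J by (simp add: zero_le_mult_iff)
qed

text \<open>\<open>g - d\<close> is the largest odd number below \<open>g\<close>, and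
  \<open>t ^ j + t ^ (2 * g - j)\<close> shrinks as \<open>j\<close> moves up to the middle. So the
  extreme case is \<open>j = g - d\<close>, which is \<open>M\<close>.\<close>

lemma odd_big:
  assumes j: "odd j" "j < g" shows "1 < t ^ j + t ^ (2 * g - j) + y"
proof -
  define d :: nat where "d = (if odd g then 2 else 1)"
  have jd: "j + d \<le> g" using j by (auto simp: d_def) presburger+
  define u where "u = g - d - j"
  have e: "g - d = j + u" "2 * g - j = g + d + u" using jd by (auto simp: u_def)
  have "t ^ (g + d) \<le> t ^ j" using t jd by (intro power_decreasing) auto
  moreover have "t ^ u \<le> 1" using t by (simp add: power_le_one)
  ultimately have "0 \<le> (1 - t ^ u) * (t ^ j - t ^ (g + d))" by simp
  also have "\<dots> = t ^ j + t ^ (2 * g - j) - (t ^ (g - d) + t ^ (g + d))"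
    unfolding e by (simp add: power_add algebra_simps)
  finally show ?thesis using M unfolding d_def[symmetric] by linarith
qed

text \<open>Multiplying \<open>t\<close> by a nontrivial \<open>i\<close>-th root of unity would
  give a second root of modulus \<open>t\<close>.\<close>

lemma dom_root_of_unity:
  assumes "2 \<le> i" and "\<And>z :: complex. z ^ i = of_real (t ^ i) \<Longrightarrow> (\<Sum>m\<le>2 * g. of_int (a m) * z ^ m) = 0"
  shows False
proof -
  obtain \<omega> :: complex where w: "norm \<omega> = 1" "\<omega> ^ i = 1" "\<omega> \<noteq> 1"
    using nontrivial_root_of_unity[OF assms(1)] by blast
  have "\<omega> * of_real t = of_real t"
    using w t by (intro dom assms(2)) (auto simp: norm_mult power_mult_distrib)
  then show False using w t by simp
qed

text \<open>Otherwise the symmetry kills all odd coefficients, the polynomial is even, and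
  \<open>- t\<close> is a second root of modulus \<open>t\<close>.\<close>

lemma some_odd: "\<exists>m\<le>g. odd m \<and> a m \<noteq> 0"
proof (rule ccontr)
  assume "\<not> ?thesis"
  then have z: "a m = 0" if "odd m" "m \<le> g" for m using that by auto
  have z': "a m = 0" if m: "odd m" "m \<le> 2 * g" for m
  proof (cases "m \<le> g")
    case False
    then have "a (2 * g - m) = 0" using m by (intro z) auto
    then show ?thesis using skew[OF m(2)] eps by auto
  qed (use z m in auto)
  show False
  proof (rule dom_root_of_unity[of 2])
    fix z :: complex assume zz: "z ^ 2 = of_real (t ^ 2)"
    have "(\<Sum>m\<le>2 * g. of_int (a m) * z ^ m) = (\<Sum>m\<le>2 * g. of_int (a m) * of_real t ^ m)"
    proof (intro sum.cong refl)
      fix m assume m: "m \<in> {..2 * g}"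
      show "of_int (a m) * z ^ m = of_int (a m) * of_real t ^ m"
      proof (cases "even m")
        case True
        then show ?thesis using zz by (auto simp: power_mult elim!: evenE)
      qed (use z' m in simp)
    qed
    also have "\<dots> = of_real (\<Sum>m\<le>2 * g. of_int (a m) * t ^ m)" by simp
    finally show "(\<Sum>m\<le>2 * g. of_int (a m) * z ^ m) = 0" using Q0 by simp
  qed simp
qed

lemma sub_sum:
  assumes nonpos: "\<And>m. 0 < m \<Longrightarrow> m < g \<Longrightarrow> a m \<le> 0" and X: "X \<subseteq> {1..<g}"
  shows "(\<Sum>m\<in>X. c m * w m) + c g * x \<le> 1 + of_int \<epsilon> * y"
proof -
  have "(\<Sum>m\<in>X. c m * w m) \<le> (\<Sum>m\<in>{1..<g}. c m * w m)"
  proof (rule sum_mono2)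
    fix m assume "m \<in> {1..<g} - X"
    then have "0 \<le> c m" "0 \<le> w m" using nonpos[of m] w_pos[of m] by (auto simp: c_def)
    then show "0 \<le> c m * w m" by simp
  qed (use X in auto)
  then show ?thesis using key by simp
qed

text \<open>The case of determinant \<open>-1\<close> is settled here, up to the possibility that the only odd
  length below the middle is \<open>g\<close> itself, with a single cycle.\<close>
lemma minus_case:
  assumes nonpos: "\<And>m. 0 < m \<Longrightarrow> m \<le> g \<Longrightarrow> a m \<le> 0" and e: "\<epsilon> = - 1" and t1: "1 < t + t\<^sup>2"
  shows "odd g" "a g = - 1" "\<And>m. odd m \<Longrightarrow> m < g \<Longrightarrow> a m = 0" "\<exists>m\<in>{1..<g}. even m \<and> a m < 0"
proof -
  have le: "(\<Sum>m\<in>X. c m * w m) + c g * x \<le> 1 - y" if "X \<subseteq> {1..<g}" for X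
    using sub_sum[of X] nonpos that e by simp
  have cg: "0 \<le> c g" using nonpos[of g] g by (simp add: c_def)
  show z: "a m = 0" if m: "odd m" "m < g" for m
  proof (rule ccontr)
    assume "a m \<noteq> 0"
    then have "1 \<le> c m" using nonpos[of m] m odd_pos[of m] by (auto simp: c_def)
    \<comment> \<open>For odd \<open>m\<close> and \<open>\<epsilon> = - 1\<close> both powers count
      positively, so this single term exceeds the available \<open>1 - y\<close> by
      \<open>odd_big\<close>.\<close>
    moreover have "w m = t ^ m + t ^ (2 * g - m)" by (subst w_def) (use m e in simp)
    moreover have "0 < w m" using w_pos m by simp
    ultimately have "t ^ m + t ^ (2 * g - m) \<le> c m * w m"
      using mult_right_mono[of 1 "c m" "w m"] by simp
    moreover have "c m * w m + c g * x \<le> 1 - y" using le[of "{m}"] m odd_pos[of m] by simp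
    moreover have "0 \<le> c g * x" using cg x01 by simp
    ultimately show False using odd_big[OF m] by linarith
  qed
  show og: "odd g"
  proof
    assume "even g"
    then have "a g = 0" using skew[of g] e by simp
    then show False using some_odd z \<open>even g\<close> by (metis le_neq_implies_less)
  qed
  have ag: "a g < 0" using some_odd z nonpos[of g] g by (metis le_neq_implies_less order_le_less
        less_le_trans zero_less_numeral)
  show "\<exists>m\<in>{1..<g}. even m \<and> a m < 0"
  proof (rule ccontr)
    \<comment> \<open>Then \<open>a g\<close> is the only coefficient left strictly between the
      ends, and the polynomial depends on \<open>u ^ g\<close> alone.\<close>
    assume no: "\<not> ?thesis"
    have zero: "a m = 0" if "m \<in> {1..<g}" for m
      using that no z[of m] nonpos[of m] by (cases "even m") force+
    show False
    proof (rule dom_root_of_unity[OF g])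
      fix u :: complex assume u: "u ^ g = of_real (t ^ g)"
      have "(\<Sum>m\<le>2 * g. of_int (a m) * u ^ m) = 1 - (u ^ g) ^ 2 + of_int (a g) * u ^ g"
        unfolding poly_split using zero e by (simp add: mult.commute[of 2] power_mult)
      also have "\<dots> = of_real (1 - (t ^ g) ^ 2 + of_int (a g) * t ^ g)" unfolding u by simp
      also have "1 - (t ^ g) ^ 2 + of_int (a g) * t ^ g = (\<Sum>m\<le>2 * g. of_int (a m) * t ^ m)"
        unfolding poly_split using zero e by (simp add: mult.commute[of 2] power_mult)
      finally show "(\<Sum>m\<le>2 * g. of_int (a m) * u ^ m) = 0" using Q0 by simp
    qed
  qed
  then obtain j where "j \<in> {1..<g}" "even j" "a j < 0" by blast
  then have j: "0 < j" "j < g" "even j" "a j < 0" by auto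
  show "a g = - 1"
  proof (rule ccontr)
    assume "a g \<noteq> - 1"
    then have "2 \<le> c g" using ag by (simp add: c_def)
    then have "2 * x \<le> c g * x" using x01 by (intro mult_right_mono) auto
    moreover have "c j * w j + c g * x \<le> 1 - y" using le[of "{j}"] j by simp
    moreover have "1 * w j \<le> c j * w j"
      using j w_pos[of j] by (intro mult_right_mono) (auto simp: c_def)
    \<comment> \<open>For even \<open>m\<close> and \<open>\<epsilon> = - 1\<close> the weight
      \<open>w m\<close> decreases in \<open>m\<close>, so the worst case is
      \<open>g - 1\<close>.\<close>
    moreover have "t ^ (g - 1) - t ^ (g + 1) \<le> w j"
    proof -
      have "t ^ (g - 1) \<le> t ^ j" using t j by (intro power_decreasing) auto
      moreover have "t ^ (2 * g - j) \<le> t ^ (g + 1)" using t j by (intro power_decreasing) auto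
      ultimately show ?thesis by (subst w_def) (use j e in simp)
    qed
    ultimately have "t ^ (g - 1) - t ^ (g + 1) + 2 * t ^ g \<le> 1 - y" by linarith
    also have "\<dots> < t ^ (g - 2) + t ^ (g + 2)" using M og by simp
    finally have "t ^ (g - 1) - t ^ (g + 1) + 2 * t ^ g < t ^ (g - 2) + t ^ (g + 2)" .
    moreover obtain k where k: "g = k + 2" using g by (metis le_iff_add add.commute)
    ultimately have "t ^ k * (t - t ^ 3 + 2 * t\<^sup>2) < t ^ k * (1 + t ^ 4)"
      by (simp add: power_add algebra_simps eval_nat_numeral)
    then have "t - t ^ 3 + 2 * t\<^sup>2 < 1 + t ^ 4" using t by simp
    \<comment> \<open>Division by \<open>t ^ (g - 2)\<close> has removed \<open>g\<close>, and the
      remaining quartic has the factor \<open>t + t\<^sup>2 - 1\<close>, which \<open>t1\<close>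
      makes positive.\<close>
    then have "(1 - t\<^sup>2) * (t + t\<^sup>2 - 1) < 0" by (simp add: algebra_simps eval_nat_numeral)
    moreover have "0 < 1 - t\<^sup>2" using t by (simp add: power_less_one_iff)
    ultimately show False using t1 by (simp add: mult_less_0_iff)
  qed
qed

end

text \<open>\<open>L\<close> and \<open>D\<close> stand for \<open>len\<close> and
  \<open>dj\<close>. The graph is forgotten here: the contradiction is derived from the lengths, the
  coefficients and the inequalities between powers of \<open>t\<close>.\<close>

locale cycle_lengths = skew_coeffs +
  fixes L :: "nat \<Rightarrow> bool" and D :: "nat \<Rightarrow> nat \<Rightarrow> bool"
  assumes x_gt: "(3 - sqrt 5) / 2 < t ^ g"
    and L_bounds: "L p \<Longrightarrow> 0 < p \<and> p \<le> 2 * g"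
    and nonpos: "0 < m \<Longrightarrow> m \<le> g \<Longrightarrow> a m \<le> 0"
    and neg_iff: "0 < m \<Longrightarrow> m \<le> g \<Longrightarrow> a m < 0 \<longleftrightarrow> L m"
    and D_L: "D p q \<Longrightarrow> L p"
    and D_sym: "D p q \<Longrightarrow> D q p"
    and D_bound: "D p q \<Longrightarrow> t ^ (2 * g) \<le> (1 - t ^ p) * (1 - t ^ q)"
    and L_sum: "L p \<Longrightarrow> L q \<Longrightarrow> p \<noteq> q \<Longrightarrow> g < p + q"
    and ge_minus_one: "0 < m \<Longrightarrow> 2 * m \<le> g \<Longrightarrow> - 1 \<le> a m"
    and D_same: "m \<le> g \<Longrightarrow> D m m \<Longrightarrow> a m \<le> - 2"
    and D_exists: "0 < m \<Longrightarrow> m \<le> 2 * g \<Longrightarrow> 0 < a m \<or> a m = 0 \<and> L m \<Longrightarrow> \<exists>p q. D p q \<and> p + q = m"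
    and L_meet: "L p \<Longrightarrow> L q \<Longrightarrow> p \<noteq> q \<Longrightarrow> \<not> D p q \<Longrightarrow> t ^ p + t ^ q \<le> 1"
begin

text \<open>\<open>(3 - sqrt 5) / 2\<close> and \<open>(3 + sqrt 5) / 2\<close> are the zeros of
  \<open>x^2 - 3 * x + 1\<close>, and \<open>x\<close> lies strictly between them. The decimals
  round the smaller zero and its square down.\<close>

lemma x_bounds: "0.3819 < x" "0.1458 < y" "0 < 3 * x - 1 - x * x" "(1 - x) * (1 - x) < x"
proof -
  have s: "sqrt 5 * sqrt 5 = 5" "0 \<le> sqrt 5" by simp_all
  have "sqrt 5 < 2.2361" by (rule real_less_lsqrt) (simp_all add: power2_eq_square)
  then show x: "0.3819 < x" using x_gt by simp
  have "0.3819 * 0.3819 < x * x" using x by (intro mult_strict_mono) auto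
  then show "0.1458 < y" unfolding y by simp
  have "0 < (x - (3 - sqrt 5) / 2) * ((3 + sqrt 5) / 2 - x)"
    using x_gt x01 s by (intro mult_pos_pos) auto
  also have "\<dots> = 3 * x - 1 - x * x" using s by (simp add: field_simps)
  finally show "0 < 3 * x - 1 - x * x" .
  then show "(1 - x) * (1 - x) < x" by (simp add: algebra_simps)
qed

lemma D_L2: "D p q \<Longrightarrow> L q" using D_L D_sym by blast

lemma L_iff: "L m \<Longrightarrow> m \<le> g \<Longrightarrow> a m < 0" using neg_iff[of m] L_bounds[of m] by auto

lemma c_ge_1: "L m \<Longrightarrow> m \<le> g \<Longrightarrow> 1 \<le> c m" using L_iff[of m] by (simp add: c_def)

lemma t_le: assumes "p \<le> q" shows "t ^ q \<le> t ^ p"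
  using t assms by (intro power_decreasing) auto

lemma mono_sum:
  assumes X: "X \<subseteq> {1..<g}" and k: "\<And>m. m \<in> X \<Longrightarrow> k m \<le> c m"
  shows "(\<Sum>m\<in>X. k m * w m) \<le> 1 + of_int \<epsilon> * y - c g * x"
proof -
  have "(\<Sum>m\<in>X. k m * w m) \<le> (\<Sum>m\<in>X. c m * w m)"
    using X k w_pos by (intro sum_mono mult_right_mono) (auto simp: less_imp_le subset_iff)
  then show ?thesis using sub_sum[OF nonpos X] by simp
qed

lemma w_even_minus: "\<epsilon> = - 1 \<Longrightarrow> even m \<Longrightarrow> w m = t ^ m - t ^ (2 * g - m)"
  by (subst w_def) simp

lemma w_even_plus: "\<epsilon> = 1 \<Longrightarrow> even m \<Longrightarrow> w m = t ^ m + t ^ (2 * g - m)"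
  by (subst w_def) simp

lemma w_odd_plus: "\<epsilon> = 1 \<Longrightarrow> odd m \<Longrightarrow> w m = t ^ m - t ^ (2 * g - m)"
  by (subst w_def) simp

text \<open>By \<open>minus_case\<close> the lengths below \<open>g\<close> are even. For the
  largest one, \<open>j\<close>, the symmetry gives \<open>a (2 * g - j) > 0\<close>, hence disjoint
  cycles with \<open>p + q + j = 2 * g\<close>. If all three lengths are below \<open>g\<close>,
  their weights alone overfill the identity. Otherwise \<open>p = j\<close>, and either
  \<open>q = j\<close> or \<open>j\<close> is so short that it is the only length below
  \<open>g\<close>.\<close>

lemma minus_impossible:
  assumes e: "\<epsilon> = - 1" shows False
proof -
  have t1: "1 < t + t\<^sup>2"
  proof -
    have "x \<le> t\<^sup>2" using g by (rule t_le)
    then have "0.3819 < t * t" using x_bounds(1) by (simp add: power2_eq_square)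
    have "0.6179 < t"
    proof (rule ccontr)
      assume "\<not> ?thesis"
      then have "t * t \<le> 0.6179 * 0.6179" using t by (intro mult_mono) auto
      then show False using \<open>0.3819 < t * t\<close> by simp
    qed
    moreover have "x \<le> t\<^sup>2" by fact
    moreover have "(1 - x) * (1 - x) < x" by (rule x_bounds)
    \<comment> \<open>If this fails, then \<open>t \<le> 1 - t * t \<le> 1 - x\<close>, so
      \<open>x \<le> t * t \<le> (1 - x) * (1 - x) < x\<close>.\<close>
    moreover have "1 - t < t\<^sup>2"
    proof (rule ccontr)
      assume "\<not> ?thesis"
      then have "t * t \<le> 1 - t" by (simp add: power2_eq_square)
      then have "t \<le> 1 - x" using \<open>x \<le> t\<^sup>2\<close> by (simp add: power2_eq_square)
      then have "t * t \<le> (1 - x) * (1 - x)" using t by (intro mult_mono) auto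
      then show False using x_bounds(4) \<open>x \<le> t\<^sup>2\<close> by (simp add: power2_eq_square)
    qed
    ultimately show ?thesis by simp
  qed
  note mc = minus_case[OF nonpos e t1]
  have x1: "1 - x * x - x < 2 * x * (1 - x)" using x_bounds(3) by (simp add: algebra_simps)
  have cg: "c g = 1" using mc(2) by (simp add: c_def)
  have bound: "(\<Sum>m\<in>X. k m * w m) \<le> 1 - y - x" if "X \<subseteq> {1..<g}" "\<And>m. m \<in> X \<Longrightarrow> k m \<le> c m" for X k
    using mono_sum[OF that] e cg by simp
  have even_short: "even m \<and> 0 < m" if "L m" "m < g" for m
    using L_iff[of m] mc(3)[of m] L_bounds[of m] that by force
  define Ev where "Ev = {j \<in> {1..<g}. L j}"
  have "finite Ev" by (simp add: Ev_def)
  moreover have "Ev \<noteq> {}"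
  proof -
    obtain m where "m \<in> {1..<g}" "a m < 0" using mc(4) by blast
    then show ?thesis using neg_iff[of m] by (auto simp: Ev_def)
  qed
  ultimately obtain j where j: "j \<in> Ev" and jmax: "\<And>m. m \<in> Ev \<Longrightarrow> m \<le> j"
    using Max_in Max_ge by metis
  have jg: "0 < j" "j < g" "L j" "even j" using j even_short by (auto simp: Ev_def)
  have EvI: "m \<in> Ev" if "L m" "m < g" for m using that L_bounds[of m] by (auto simp: Ev_def)
  have cj: "1 \<le> c j" using c_ge_1[of j] jg by simp
  define J where "J = t ^ j"
  have J: "0 < J" "J < 1" "x \<le> J" using t jg t_le[of j g] by (auto simp: J_def power_less_one_iff)
  have wj: "w j = J - t ^ (2 * g - j)" unfolding J_def by (rule w_even_minus[OF e jg(4)])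
  \<comment> \<open>With \<open>J\<close> between \<open>x\<close> and \<open>1 - x\<close>,
    concavity gives \<open>J * (1 - J) \<ge> x * (1 - x)\<close>, which contradicts
    \<open>x1\<close>.\<close>
  have final: False if "J \<le> 1 - x" "2 * J * (1 - J) \<le> 1 - y - x"
  proof -
    have "0 \<le> (J - x) * (1 - x - J)" using that J by (intro mult_nonneg_nonneg) auto
    then have "x * (1 - x) \<le> J * (1 - J)" by (simp add: algebra_simps)
    then show False using that x1 y by simp
  qed
  have "0 < a (2 * g - j)" using skew[of j] e jg L_iff[of j] by simp
  then obtain p0 q0 where "D p0 q0" "p0 + q0 = 2 * g - j"
    using D_exists[of "2 * g - j"] jg by auto
  then obtain p q where D: "D p q" and pq: "p + q = 2 * g - j" and le: "p \<le> q"
    by (metis D_sym add.commute linear)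
  have pg: "p < g" using pq le jg by linarith
  have Lp: "L p" "L q" using D D_L D_L2 by auto
  have p: "even p" "0 < p" "p \<le> j" using even_short[of p] Lp pg jmax EvI by auto
  have qe: "even q" using p jg pq
    by (metis add_diff_inverse_nat even_add even_mult_iff even_numeral jg(2) less_or_eq_imp_le
        linorder_not_less mult_2 trans_less_add1)
  define P Q where "P = t ^ p" and "Q = t ^ q"
  have P: "0 < P" "P < 1" "x \<le> P" "J \<le> P"
    using t p pg t_le[of p g] t_le[of p j] by (auto simp: P_def J_def power_less_one_iff)
  have pqj: "p + q + j = 2 * g" using pq jg by simp
  have "P * Q * J = t ^ (p + q + j)" unfolding P_def Q_def J_def by (simp add: power_add)
  then have PQJ: "P * Q * J = y" unfolding pqj .
  have wj': "w j = J - P * Q"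
  proof -
    have "2 * g - j = p + q" using pq by simp
    then show ?thesis unfolding wj P_def Q_def by (simp add: power_add)
  qed
  have wp': "w p = P - Q * J"
  proof -
    have "2 * g - p = q + j" using pqj by simp
    then show ?thesis unfolding P_def Q_def J_def w_even_minus[OF e p(1)] by (simp add: power_add)
  qed
  have Dpq: "y \<le> (1 - P) * (1 - Q)" using D_bound[OF D] by (simp add: P_def Q_def)
  show False
  proof (cases "p = j")
    case False
    then have pj: "p < j" using p by simp
    then have "g < p + j" using L_sum[OF Lp(1) jg(3)] by simp
    then have qg: "q < g" using pqj by simp
    then have q: "q \<le> j" "0 < q" using jmax[OF EvI[OF Lp(2) qg]] le p by auto
    have Q: "0 < Q" "Q < 1" "x \<le> Q"
      using t q qg t_le[of q g] by (auto simp: Q_def power_less_one_iff)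
    have wq': "w q = Q - P * J"
    proof -
      have "2 * g - q = p + j" using pqj by simp
      then show ?thesis unfolding P_def Q_def J_def w_even_minus[OF e qe] by (simp add: power_add)
    qed
    \<comment> \<open>Since \<open>P * Q * J = y\<close>, the sum of the three weights completes the
      product \<open>(1 - P) * (1 - Q) * (1 - J)\<close>.\<close>
    have three: False if "w p + w q + w j \<le> 1 - y - x"
    proof -
      have "w p + w q + w j = 1 - y - (1 - P) * (1 - Q) * (1 - J)"
        unfolding wp' wq' wj' PQJ[symmetric] by (simp add: algebra_simps)
      then have "x \<le> (1 - P) * (1 - Q) * (1 - J)" using that by simp
      also have "\<dots> \<le> (1 - x) * (1 - x) * 1"
        using P Q J x01 by (intro mult_mono mult_nonneg_nonneg) auto
      finally show False using x_bounds(4) by simp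
    qed
    have cp: "1 \<le> c p" "1 \<le> c q" using c_ge_1 Lp pg qg by auto
    \<comment> \<open>If lengths coincide, \<open>three\<close> needs a coefficient of size 2: for
      \<open>p = q\<close> it comes from the disjoint pair itself, for \<open>q = j\<close> it may
      be missing, and then \<open>final\<close> takes over.\<close>
    consider "p = q" | "p \<noteq> q" "q \<noteq> j" | "q = j" "2 \<le> c j" | "q = j" "c j < 2" by linarith
    then show False
    proof cases
      case 1
      then have "a p \<le> - 2" using D_same[of p] D pg by simp
      then have "2 \<le> c p" by (simp add: c_def)
      then have "(\<Sum>m\<in>{p, j}. (if m = p then 2 else 1) * w m) \<le> 1 - y - x"
        using pg jg p cj by (intro bound) auto
      then show False using pj 1 by (intro three) simp
    next
      case 2
      then have "(\<Sum>m\<in>{p, q, j}. 1 * w m) \<le> 1 - y - x"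
        using pg jg p q qg cj cp by (intro bound) auto
      then show False using pj 2 by (intro three) simp
    next
      case 3
      then have "(\<Sum>m\<in>{p, j}. (if m = j then 2 else 1) * w m) \<le> 1 - y - x"
        using pg jg p cp by (intro bound) auto
      then show False using pj 3 by (intro three) simp
    next
      case 4
      then have QJ: "Q = J" by (simp add: Q_def J_def)
      have "(\<Sum>m\<in>{p, j}. 1 * w m) \<le> 1 - y - x"
        using pg jg p cp cj by (intro bound) auto
      then have "w p + w j \<le> 1 - y - x" using pj by simp
      moreover have "w p + w j = (1 - J) * (P + J)" unfolding wp' wj' QJ by (simp add: algebra_simps)
      moreover have "(1 - J) * (2 * J) \<le> (1 - J) * (P + J)" using J P by (intro mult_left_mono) auto
      ultimately have "2 * J * (1 - J) \<le> 1 - y - x" by (simp add: algebra_simps)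
      moreover have "J \<le> 1 - x"
      proof (rule ccontr)
        assume "\<not> ?thesis"
        then have "(1 - P) * (1 - Q) < x * x" using P J QJ by (intro mult_strict_mono) auto
        then show False using Dpq y by simp
      qed
      ultimately show False by (intro final)
    qed
  next
    case True
    show False
    proof (cases "q = j")
      case qj: True
      then have "a j \<le> - 2" using D_same[of j] D True jg by simp
      then have "2 \<le> c j" by (simp add: c_def)
      then have "(\<Sum>m\<in>{j}. 2 * w m) \<le> 1 - y - x" using jg by (intro bound) auto
      then have "2 * (J - J * J) \<le> 1 - y - x"
        using wj' True qj by (simp add: P_def Q_def J_def)
      then have "2 * J * (1 - J) \<le> 1 - y - x" by (simp add: algebra_simps)
      moreover have "J \<le> 1 - x"
      proof (rule ccontr)
        assume "\<not> ?thesis"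
        then have "(1 - P) * (1 - Q) < x * x"
          using True qj J by (intro mult_strict_mono) (auto simp: P_def Q_def J_def)
        then show False using Dpq y by simp
      qed
      ultimately show False by (intro final)
    next
      case False
      \<comment> \<open>\<open>q = 2 * g - 2 * j\<close> turns out to exceed \<open>g\<close>, so
        \<open>2 * j < g\<close> and \<open>j\<close> is the only length below \<open>g\<close>. As
        \<open>2 * j\<close> is no length, symmetry gives \<open>a q = 0\<close> although
        \<open>L q\<close> holds, so \<open>q\<close> is the total length of another disjoint pair.
        This pair contains \<open>j\<close> and a length of at least \<open>g\<close>, whence
        \<open>3 * j \<le> g\<close>.\<close>
      then have "j < q" using le True by simp
      then have "\<not> q < g" using jmax[OF EvI[OF Lp(2)]] by auto
      moreover have "q \<noteq> g" using qe mc(1) by auto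
      ultimately have qg: "g < q" by simp
      then have j2: "2 * j < g" using pqj True by simp
      have only: "m = j" if "m \<in> Ev" for m
        using that jmax[OF that] L_sum[of m j] jg j2 by (auto simp: Ev_def)
      have "- 1 \<le> a j" using ge_minus_one[of j] jg j2 by simp
      then have cj1: "c j = 1" using cj by (simp add: c_def)
      have "(\<Sum>m\<in>{1..<g}. c m * w m) = (\<Sum>m\<in>{j}. c m * w m)"
      proof (rule sum.mono_neutral_right)
        show "\<forall>m\<in>{1..<g} - {j}. c m * w m = 0"
        proof
          fix m assume m: "m \<in> {1..<g} - {j}"
          then have "\<not> L m" using only[of m] EvI[of m] by auto
          then have "a m = 0" using neg_iff[of m] nonpos[of m] m by force
          then show "c m * w m = 0" by (simp add: c_def)
        qed
      qed (use jg in auto)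
      then have eq: "w j = 1 - y - x" using key e cg cj1 by simp
      have "a q = 0"
      proof -
        have "\<not> L (2 * j)" using only[of "2 * j"] EvI[of "2 * j"] j2 jg by auto
        then have "a (2 * j) = 0" using neg_iff[of "2 * j"] nonpos[of "2 * j"] j2 jg by force
        moreover have "q = 2 * g - 2 * j" using pqj True by simp
        ultimately show ?thesis using skew[of "2 * j"] j2 by simp
      qed
      then obtain p1 q1 where "D p1 q1" "p1 + q1 = q"
        using D_exists[of q] Lp qg pqj by auto
      then obtain p' q' where D': "D p' q'" and pq': "p' + q' = q" and le': "p' \<le> q'"
        by (metis D_sym add.commute linear)
      have Lp': "L p'" "L q'" using D' D_L D_L2 by auto
      have "p' < g" using pq' le' pqj jg by linarith
      then have p': "p' = j" using only EvI Lp' by blast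
      have "q' \<noteq> j"
      proof
        assume "q' = j"
        then have "a j \<le> - 2" using D_same[of j] D' p' jg by simp
        then show False using \<open>- 1 \<le> a j\<close> by simp
      qed
      then have "\<not> q' < g" using only EvI Lp' by blast
      then have j3: "3 * j \<le> g" using pq' p' pqj True by simp
      have J3: "x \<le> J ^ 3" using t_le[OF j3] by (simp add: J_def power_mult mult.commute[of 3])
      \<comment> \<open>\<open>0.725 ^ 3\<close> is about 0.3811, just below the lower bound 0.3819
        of \<open>x \<le> J ^ 3\<close>.\<close>
      have J7: "0.725 < J"
      proof (rule ccontr)
        assume "\<not> ?thesis"
        then have "J ^ 3 \<le> 0.725 ^ 3" using J by (intro power_mono) auto
        then show False using J3 x_bounds(1) by (simp add: eval_nat_numeral)
      qed
      have Jy: "J * t ^ (2 * g - j) = y" unfolding J_def by (rule pw) (use jg in simp)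
      have J': "t ^ (2 * g - j) = J - 1 + x + y" using eq wj by simp
      have Lg: "L g" using neg_iff[of g] mc(2) g by simp
      show False
      \<comment> \<open>A cycle of length \<open>g\<close> exists because \<open>a g = - 1\<close>.
        If it meets the cycle of length \<open>j\<close>, then \<open>J + x \<le> 1\<close>; if they
        can be chosen disjoint, \<open>D_bound\<close> applies. Either way the exact value
        \<open>J'\<close> is violated.\<close>
      proof (cases "D j g")
        case False
        then have "J + x \<le> 1" using L_meet[OF jg(3) Lg] jg by (simp add: J_def)
        moreover have "y < t ^ (2 * g - j)" using t jg by (intro power_strict_decreasing) auto
        ultimately show False using J' by simp
      next
        case True
        then have "y \<le> (1 - J) * (1 - x)" using D_bound by (simp add: J_def)
        then have "J * (J - 1 + x + y) \<le> (1 - J) * (1 - x)" using Jy J' by simp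
        then have "J * J + y * J \<le> 1 - x" by (simp add: algebra_simps)
        moreover have "0.725 * 0.725 \<le> J * J" using J7 by (intro mult_mono) auto
        moreover have "0.1458 * 0.725 \<le> y * J" using J7 x_bounds(2) by (intro mult_mono) auto
        ultimately show False using x_bounds(1) by simp
      qed
    qed
  qed
qed

text \<open>Even lengths now weigh at least \<open>2 * x\<close>, and \<open>1 + y < 3 * x\<close>
  leaves room for one of them below \<open>g\<close>. An odd length \<open>i < g\<close> exists by
  \<open>some_odd\<close>. Without an even length the identity has just \<open>i\<close> and
  \<open>g\<close> left. With an even length \<open>j\<close>, every odd one satisfies
  \<open>2 * i + j = 2 * g\<close>, and the polynomial then factors so that \<open>t\<close> is not
  its only dominant root.\<close>

lemma plus_impossible:
  assumes e: "\<epsilon> = 1" shows False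
proof -
  have bound: "(\<Sum>m\<in>X. k m * w m) \<le> 1 + y - c g * x"
    if "X \<subseteq> {1..<g}" "\<And>m. m \<in> X \<Longrightarrow> k m \<le> c m" for X k
    using mono_sum[OF that] e by simp
  have cg0: "0 \<le> c g" using nonpos[of g] g by (simp add: c_def)
  have cgx: "0 \<le> c g * x" using cg0 x01 by simp
  have ag_odd: "a g = 0" if "odd g" using skew[of g] that e by simp
  have big: "1 + y < 3 * x" using x_bounds(3) y by simp
  have we: "2 * x \<le> w j" if "even j" "j < g" for j
    using amgm[of j] that w_even_plus[OF e, of j] by simp
  have short: "m \<in> {1..<g}" if "L m" "m < g" for m using that L_bounds[of m] by auto
  have cint: "c m = of_int (- a m)" for m by (simp add: c_def)
  have no_two_even: "j = j'" if "L j" "L j'" "even j" "even j'" "j < g" "j' < g" for j j'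
  proof (rule ccontr)
    assume "j \<noteq> j'"
    have "(\<Sum>m\<in>{j, j'}. 1 * w m) \<le> 1 + y - c g * x"
      using that short c_ge_1 by (intro bound) auto
    then have "w j + w j' \<le> 1 + y" using cgx \<open>j \<noteq> j'\<close> by simp
    then show False using we[of j] we[of j'] that big x01 by linarith
  qed
  have c_even: "c j = 1 \<and> c g = 0" if "L j" "even j" "j < g" for j
  proof -
    have cj: "1 \<le> c j" using c_ge_1 that by simp
    have "(\<Sum>m\<in>{j}. c m * w m) \<le> 1 + y - c g * x" using that short by (intro bound) auto
    then have le: "c j * w j + c g * x \<le> 1 + y" by simp
    have "c j * (2 * x) \<le> c j * w j" using we[of j] that cj by (intro mult_left_mono) auto
    then have le: "(2 * c j + c g) * x < 3 * x" using le big by (simp add: algebra_simps)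
    then have "2 * c j + c g < 3" using x01 by simp
    then have "2 * (- a j) + (- a g) < 3" "1 \<le> - a j" "0 \<le> - a g"
      using cj cg0 unfolding cint by linarith+
    then have "a j = - 1" "a g = 0" by linarith+
    then show ?thesis by (simp add: cint)
  qed
  have cg2: "c g = 0 \<or> c g = 1 \<or> c g = 2"
  proof -
    have "c g * x \<le> 1 + y" using bound[of "{}" c] by simp
    then have "c g * x < 3 * x" using big by simp
    then have "c g < 3" using x01 by simp
    then have "- a g = 0 \<or> - a g = 1 \<or> - a g = 2" using cg0 unfolding cint by linarith
    then show ?thesis unfolding cint by (metis of_int_0 of_int_1 of_int_numeral)
  qed
  obtain i where i0: "i \<le> g" "odd i" "a i \<noteq> 0" using some_odd by blast
  have oddL: "L m" if "odd m" "m \<le> g" "a m \<noteq> 0" for m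
    using neg_iff[of m] nonpos[of m] that odd_pos[of m] by force
  have i: "L i" "i < g" "odd i" using i0 oddL ag_odd by (auto simp: le_less)
  \<comment> \<open>Here \<open>t ^ i\<close> is at least the square root of \<open>x\<close>, which
    exceeds \<open>1 - x\<close>.\<close>
  have small: "t ^ i * (1 - x) \<le> w i \<and> 1 - x < t ^ i" if "odd i" "2 * i \<le> g" for i
  proof -
    define I where "I = t ^ i"
    have I: "0 < I" "I < 1" using that t odd_pos[of i] by (auto simp: I_def power_less_one_iff)
    have xI: "x \<le> I * I" using t_le[OF that(2)] by (simp add: I_def power_mult power2_eq_square mult.commute[of 2])
    have II: "I * t ^ (2 * g - i) = y" unfolding I_def by (rule pw) (use that in simp)
    have "I * t ^ (2 * g - i) \<le> I * (x * I)" unfolding II y using xI x01 by (simp add: mult.left_commute)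
    then have "t ^ (2 * g - i) \<le> x * I" using I by simp
    then have "t ^ i * (1 - x) \<le> w i"
      using w_odd_plus[OF e that(1)] by (simp add: I_def algebra_simps)
    moreover have "1 - x < I"
    proof (rule ccontr)
      assume "\<not> ?thesis"
      then have "I * I \<le> (1 - x) * (1 - x)" using I by (intro mult_mono) auto
      then show False using xI x_bounds(4) by simp
    qed
    ultimately show ?thesis by (simp add: I_def)
  qed
  \<comment> \<open>For odd \<open>i\<close> symmetry makes \<open>a (2 * g - i)\<close> positive,
    which yields a disjoint pair of an odd \<open>p\<close> and an even \<open>q\<close>. If
    \<open>q \<ge> g\<close>, then \<open>p + i \<le> g\<close> contradicts \<open>L_sum\<close>;
    and \<open>g < i + q\<close> then gives \<open>p < g\<close>.\<close>
  have pair: "\<exists>j p. L j \<and> even j \<and> j < g \<and> L p \<and> odd p \<and> p < g \<and> i + p + j = 2 * g"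
    if i: "L i" "odd i" "i < g" "g < 2 * i" for i
  proof -
    have "0 < a (2 * g - i)" using skew[of i] e i L_iff[of i] by simp
    then obtain p0 q0 where p0: "D p0 q0" "p0 + q0 = 2 * g - i"
      using D_exists[of "2 * g - i"] i by auto
    have "odd (p0 + q0)" using p0 i by simp
    then obtain p q where D: "D p q" and pq: "p + q = 2 * g - i" and par: "odd p" "even q"
    proof (cases "odd p0")
      case True
      then have "even q0" using \<open>odd (p0 + q0)\<close> by simp
      then show thesis using that[of p0 q0] p0 True by blast
    next
      case False
      then have "odd q0" using \<open>odd (p0 + q0)\<close> by simp
      moreover have "D q0 p0" "q0 + p0 = 2 * g - i" using p0 D_sym by auto
      ultimately show thesis using that[of q0 p0] False by blast
    qed
    have Lp: "L p" "L q" using D D_L D_L2 by auto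
    have qg: "q < g"
    proof (rule ccontr)
      assume "\<not> q < g"
      then have "p \<le> g - i" using pq by linarith
      then have "p + i \<le> g" "p \<noteq> i" using i by auto
      then show False using L_sum[OF Lp(1) i(1)] by simp
    qed
    have "i \<noteq> q" using i par by auto
    then have "g < i + q" using L_sum[OF i(1) Lp(2)] by simp
    then have "p < g" using pq i(3) by linarith
    then show ?thesis using Lp qg par pq i by (intro exI[of _ q] exI[of _ p]) auto
  qed
  show False
  proof (cases "\<exists>j. L j \<and> even j \<and> j < g")
    case False
    \<comment> \<open>A longer odd length would come with an even one by \<open>pair\<close>. Two
      different lengths up to \<open>g / 2\<close> are excluded by \<open>L_sum\<close>, so only
      \<open>i\<close> remains below \<open>g\<close>.\<close>
    have half: "2 * m \<le> g" if "L m" "odd m" "m < g" for m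
      using pair[OF that] False by force
    have only: "m = i" if "L m" "m < g" for m
    proof (rule ccontr)
      assume "m \<noteq> i"
      then have "g < m + i" using L_sum[OF that(1) i(1)] by simp
      moreover have "odd m" using False that by blast
      ultimately show False using half[of m] half[of i] that i by simp
    qed
    have "- 1 \<le> a i" using ge_minus_one[of i] half i L_bounds by auto
    then have ci: "c i = 1" using c_ge_1[of i] i by (simp add: c_def)
    have "(\<Sum>m\<in>{1..<g}. c m * w m) = (\<Sum>m\<in>{i}. c m * w m)"
    proof (rule sum.mono_neutral_right)
      show "\<forall>m\<in>{1..<g} - {i}. c m * w m = 0"
      proof
        fix m assume m: "m \<in> {1..<g} - {i}"
        then have "a m = 0" using only[of m] neg_iff[of m] nonpos[of m] by force
        then show "c m * w m = 0" by (simp add: c_def)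
      qed
    qed (use i short in auto)
    then have eq: "w i = 1 + y - c g * x" using key e ci by simp
    define I where "I = t ^ i"
    have I: "0 < I" "I < 1" using i t odd_pos[of i] by (auto simp: I_def power_less_one_iff)
    have wi: "w i = I - t ^ (2 * g - i)" unfolding I_def by (rule w_odd_plus[OF e i(3)])
    have I': "0 < t ^ (2 * g - i)" "0 < y" using t by auto
    consider "c g = 0" | "c g = 1" | "c g = 2" using cg2 by blast
    then show False
    proof cases
      case 1
      then show False using eq wi I I' by simp
    next
      case 2
      have Lg: "L g" using 2 neg_iff[of g] g by (simp add: c_def)
      show False
      proof (cases "D i g")
        case False
        then have "I + x \<le> 1" using L_meet[OF i(1) Lg] i by (simp add: I_def)
        then show False using eq wi 2 I' by simp
      next
        case True
        \<comment> \<open>The identity gives \<open>1 - I < x - y = x * (1 - x)\<close>, so this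
          bound would imply \<open>x < (1 - x) * (1 - x)\<close>.\<close>
        then have "y \<le> (1 - I) * (1 - x)" using D_bound by (simp add: I_def)
        also have "\<dots> \<le> x * (1 - x) "
          using eq wi 2 I' x01 I by (intro mult_right_mono) auto
        also have "1 - I < x * (1 - x)" using eq wi 2 I' y by (simp add: algebra_simps)
        then have "(1 - I) * (1 - x) < x * (1 - x) * (1 - x)"
          using x01 by (intro mult_strict_right_mono) auto
        then have "y < x * ((1 - x) * (1 - x))"
          using \<open>y \<le> (1 - I) * (1 - x)\<close> by (simp add: mult.assoc)
        then have "x < (1 - x) * (1 - x)" unfolding y using x01 by simp
        then show False using x_bounds(4) by simp
      qed
    next
      case 3
      then have "w i = (1 - x) * (1 - x)" using eq y by (simp add: algebra_simps)
      moreover have "I * (1 - x) \<le> w i" "1 - x < I"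
        using small[of i] half i by (auto simp: I_def)
      moreover have "(1 - x) * (1 - x) < I * (1 - x)"
        using \<open>1 - x < I\<close> x01 by (intro mult_strict_right_mono) auto
      ultimately show False by simp
    qed
  next
    case True
    then obtain j where j: "L j" "even j" "j < g" by blast
    have cj: "c j = 1" "c g = 0" using c_even[OF j] by auto
    define J J' where "J = t ^ j" and "J' = t ^ (2 * g - j)"
    have wj: "w j = J + J'" unfolding J_def J'_def by (rule w_even_plus[OF e j(2)])
    have JJ: "J * J' = y" unfolding J_def J'_def by (rule pw) (use j in simp)
    have J: "0 < J" "J < 1" using t j L_bounds[of j] by (auto simp: J_def power_less_one_iff)
    have only: "m = j" if "L m" "even m" "m < g" for m using no_two_even[OF that(1) j(1)] that j by simp
    \<comment> \<open>Removing the weight \<open>J + J'\<close> of the even length from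
      \<open>1 + y\<close> leaves \<open>(1 - J) * (1 - J')\<close>, because
      \<open>J * J' = y\<close>.\<close>
    have bound': "(\<Sum>m\<in>X. k m * w m) \<le> (1 - J) * (1 - J')"
      if X: "X \<subseteq> {1..<g}" "j \<notin> X" "\<And>m. m \<in> X \<Longrightarrow> k m \<le> c m" for X k
    proof -
      have "finite X" using X(1) finite_subset by blast
      then have "(\<Sum>m\<in>insert j X. (k(j := 1)) m * w m) = w j + (\<Sum>m\<in>X. (k(j := 1)) m * w m)"
        using X by simp
      also have "(\<Sum>m\<in>X. (k(j := 1)) m * w m) = (\<Sum>m\<in>X. k m * w m)"
        using X by (intro sum.cong) auto
      finally have "w j + (\<Sum>m\<in>X. k m * w m) = (\<Sum>m\<in>insert j X. (k(j := 1)) m * w m)" by simp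
      also have "\<dots> \<le> 1 + y - c g * x"
        using X j short[OF j(1,3)] cj by (intro bound) auto
      finally show ?thesis using wj cj JJ by (simp add: algebra_simps)
    qed
    have half: "g < 2 * m" if m: "L m" "odd m" "m < g" for m
    proof (rule ccontr)
      assume "\<not> ?thesis"
      then have m2: "2 * m \<le> g" by simp
      have "(\<Sum>m\<in>{m}. 1 * w m) \<le> (1 - J) * (1 - J')"
        using m j short[of m] c_ge_1[of m] by (intro bound') auto
      moreover have "(1 - J) * (1 - J') \<le> (1 - x) * (1 - x)"
        using JJ y amgm[of j] j by (simp add: J_def J'_def algebra_simps)
      moreover have "(1 - x) * (1 - x) < t ^ m * (1 - x)"
        using small[of m] m m2 x01 by (intro mult_strict_right_mono) auto
      ultimately show False using small[of m] m m2 by simp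
    qed
    \<comment> \<open>Otherwise \<open>pair\<close> gives a second odd length \<open>p\<close> with
      \<open>m + p + j = 2 * g\<close>. The factor \<open>1 - J\<close> cancels from the two odd
      weights, and what is left, \<open>I + K + I * K \<le> 1\<close>, contradicts
      \<open>odd_big\<close>.\<close>
    have sym: "m + m + j = 2 * g" if m: "L m" "odd m" "m < g" for m
    proof (rule ccontr)
      assume ne: "\<not> ?thesis"
      obtain j' p where "L j'" "even j'" "j' < g" "L p" "odd p" "p < g" "m + p + j' = 2 * g"
        using pair[OF m(1-3) half[OF m]] by blast
      then have p: "L p" "odd p" "p < g" "m + p + j = 2 * g" using only by auto
      define I K where "I = t ^ m" and "K = t ^ p"
      have mp: "m \<noteq> p" using p ne by auto
      have "(\<Sum>m\<in>{m, p}. 1 * w m) \<le> (1 - J) * (1 - J')"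
        using m p j short c_ge_1 by (intro bound') auto
      then have sum: "w m + w p \<le> (1 - J) * (1 - J')" using mp by simp
      have "2 * g - m = p + j" "2 * g - p = m + j" "2 * g - j = m + p" using p by simp_all
      then have "w m = I - K * J" "w p = K - I * J" and J': "J' = I * K"
        using w_odd_plus[OF e m(2)] w_odd_plus[OF e p(2)]
        by (simp_all add: I_def K_def J_def J'_def power_add)
      then have "(1 - J) * (I + K) \<le> (1 - J) * (1 - I * K)" using sum by (simp add: algebra_simps)
      then have "I + K \<le> 1 - I * K" using J by simp
      moreover have "t ^ (2 * g - m) \<le> K" unfolding K_def using p by (intro t_le) simp
      moreover have "y \<le> I * K" unfolding J'[symmetric] J'_def by (intro t_le) simp
      ultimately show False using odd_big[OF m(2,3)] by (simp add: I_def)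
    qed
    have ij: "i + i + j = 2 * g" using sym i by simp
    have i2: "2 \<le> i"
      using half[OF i(1,3,2)] g i by presburger
    have zero: "a m = 0" if m: "m \<in> {1..<g} - {i, j}" for m
    proof -
      have "\<not> L m"
      proof
        assume "L m"
        then show False using only[of m] sym[of m] ij m by (cases "even m") auto
      qed
      then show ?thesis using neg_iff[of m] nonpos[of m] m by force
    qed
    have "i \<noteq> j" using i j by auto
    have ag: "a g = 0" "a j = - 1" using cj by (simp_all add: c_def)
    \<comment> \<open>The coefficients sit at \<open>i\<close>, \<open>j\<close>, their mirror
      images \<open>i + j\<close> and \<open>2 * i\<close>, and the two ends. Since
      \<open>t ^ j < 1\<close>, the root \<open>t\<close> belongs to the second factor, which
      depends on \<open>z ^ i\<close> only.\<close>
    have factor: "(\<Sum>m\<le>2 * g. of_int (a m) * z ^ m) = (1 - z ^ j) * (1 + of_int (a i) * z ^ i - (z ^ i) * (z ^ i))"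
      for z :: "'a :: comm_ring_1"
    proof -
      have "(\<Sum>m\<in>{1..<g}. of_int (a m) * (z ^ m + of_int \<epsilon> * (- 1) ^ m * z ^ (2 * g - m))) =
        (\<Sum>m\<in>{i, j}. of_int (a m) * (z ^ m + of_int \<epsilon> * (- 1) ^ m * z ^ (2 * g - m)))"
        using zero i j short by (intro sum.mono_neutral_right) auto
      also have "\<dots> = of_int (a i) * (z ^ i - z ^ (i + j)) - (z ^ j + z ^ (i + i))"
      proof -
        have "2 * g - i = i + j" "2 * g - j = i + i" using ij by simp_all
        then show ?thesis using \<open>i \<noteq> j\<close> e i j ag by simp
      qed
      finally have S: "(\<Sum>m\<in>{1..<g}. of_int (a m) * (z ^ m + of_int \<epsilon> * (- 1) ^ m * z ^ (2 * g - m))) =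
        of_int (a i) * (z ^ i - z ^ (i + j)) - (z ^ j + z ^ (i + i))" .
      have Z: "z ^ (2 * g) = z ^ i * z ^ i * z ^ j" unfolding ij[symmetric] by (simp add: power_add)
      show ?thesis unfolding poly_split unfolding S unfolding Z ag e by (simp add: power_add algebra_simps)
    qed
    show False
    proof (rule dom_root_of_unity[OF i2])
      fix z :: complex assume z: "z ^ i = of_real (t ^ i)"
      have "(1 - t ^ j) * (1 + of_int (a i) * t ^ i - t ^ i * t ^ i) = 0"
        using Q0 factor[of t] by simp
      then have "1 + of_int (a i) * t ^ i - t ^ i * t ^ i = 0" using J by (simp add: J_def)
      then have "of_real (1 + of_int (a i) * t ^ i - t ^ i * t ^ i) = (0 :: complex)" by simp
      then have "1 + of_int (a i) * z ^ i - z ^ i * z ^ i = 0" unfolding z by simp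
      then show "(\<Sum>m\<le>2 * g. of_int (a m) * z ^ m) = 0" unfolding factor by simp
    qed
  qed
qed

lemma impossible: False
  using minus_impossible plus_impossible eps by blast

end

section \<open>The exceptional case \<open>g = 3\<close>\<close>

context skew_coeffs
begin

text \<open>For \<open>\<epsilon> = 1\<close> no odd coefficient survives. For
  \<open>\<epsilon> = - 1\<close> the symmetry \<open>a 4 = - a 2\<close> and the bound
  \<open>a 4 \<le> 1\<close> at \<open>a 2 = - 2\<close> push \<open>a 2\<close> down to
  \<open>- 3\<close>, and then the identity exceeds its budget by a perfect cube.\<close>

lemma three_loopfree:
  assumes g3: "g = 3" and a1: "a 1 = 0" and nonpos: "\<And>m. 0 < m \<Longrightarrow> m \<le> g \<Longrightarrow> a m \<le> 0"
    and t1: "1 < t + t\<^sup>2"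
    and a4: "0 < a 4 \<Longrightarrow> a 2 \<le> - 2 \<and> (a 2 = - 2 \<longrightarrow> a 4 \<le> 1)"
  shows False
  using eps
proof
  assume e: "\<epsilon> = 1"
  have "a 3 = 0" using skew[of 3] g3 e by simp
  then have "a m = 0" if "odd m" "m \<le> 3" for m
    using that a1 by (cases "m = 1 \<or> m = 3") (auto simp: le_Suc_eq numeral_3_eq_3)
  then show False using some_odd g3 by auto
next
  assume e: "\<epsilon> = - 1"
  note mc = minus_case[OF nonpos e t1]
  obtain m where "m \<in> {1..<3}" "even m" "a m < 0" using mc(4) g3 by auto
  then have "m = 2" by (auto simp: numeral_3_eq_3 less_Suc_eq numeral_2_eq_2)
  then have a2: "a 2 < 0" using \<open>a m < 0\<close> by simp
  have "a 4 = - a 2" using skew[of 2] g3 e by simp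
  then have a3: "a 2 \<le> - 3" using a2 a4 by auto
  have "c 1 * w 1 + c 2 * w 2 + c 3 * t ^ 3 = 1 - y"
  proof -
    have "{1..<3} = {1, 2 :: nat}" by auto
    then show ?thesis using key g3 e by simp
  qed
  moreover have "c 1 = 0" "c 3 = 1" using a1 mc(2) g3 by (simp_all add: c_def)
  moreover have "3 * w 2 \<le> c 2 * w 2"
    using a3 w_pos[of 2] g3 by (intro mult_right_mono) (auto simp: c_def)
  moreover have "w 2 = t ^ 2 - t ^ 4" by (subst w_def) (use g3 e in simp)
  ultimately have le: "3 * (t ^ 2 - t ^ 4) + t ^ 3 \<le> 1 - t ^ 6" using g3 by simp
  \<comment> \<open>Expanded, \<open>le\<close> is exactly
    \<open>t ^ 3 \<le> (1 - t\<^sup>2) ^ 3\<close>, the reverse of this.\<close>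
  have "(1 - t\<^sup>2) ^ 3 < t ^ 3"
    using t t1 by (intro power_strict_mono) (auto simp: power_le_one)
  then show False using le by (simp add: algebra_simps eval_nat_numeral)
qed

text \<open>If there is a 2-cycle, \<open>t\<close> is trapped between 0.704 and 0.72. For
  \<open>\<epsilon> = - 1\<close> positivity of the polynomial at one point below \<open>t\<close>
  leaves few coefficients, and none of them lets it vanish in this interval.\<close>

lemma three_loop:
  assumes g3: "g = 3" and a1: "a 1 = - 1" and a2: "a 2 \<le> 0" and a3: "a 3 \<le> - a 2"
    and dj: "a 2 < 0 \<Longrightarrow> t ^ 6 \<le> (1 - t) * (1 - t\<^sup>2) \<or> 4 * t ^ 9 \<le> (1 - t) * (1 - t\<^sup>2)"
    and pos: "\<And>s. 0 < s \<Longrightarrow> s < t \<Longrightarrow> 0 < (\<Sum>m\<le>6. of_int (a m) * s ^ m)"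
  shows False
proof -
  have Q: "(\<Sum>m\<le>6. of_int (a m) * z ^ m) = 1 + of_int \<epsilon> * z ^ 6 + of_int (a 3) * z ^ 3
    - (z - of_int \<epsilon> * z ^ 5) + of_int (a 2) * (z ^ 2 + of_int \<epsilon> * z ^ 4)" for z :: real
  proof -
    have "{1..<3} = {1, 2 :: nat}" by auto
    then show ?thesis using poly_split[of z] a1 by (simp add: g3)
  qed
  have Qt: "1 + of_int \<epsilon> * t ^ 6 + of_int (a 3) * t ^ 3
    - (t - of_int \<epsilon> * t ^ 5) + of_int (a 2) * (t ^ 2 + of_int \<epsilon> * t ^ 4) = 0"
    using Q0 Q[of t] g3 by simp
  have M3: "1 < t + t ^ 5 + t ^ 6" using M g3 by simp
  \<comment> \<open>Just below the root of \<open>t + t ^ 5 + t ^ 6 = 1\<close>, which is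
    \<open>1 / mu 3\<close>.\<close>
  have lo: "0.704 < t"
  proof (rule ccontr)
    assume "\<not> ?thesis"
    then have "t \<le> 0.704" by simp
    then have "t ^ 5 \<le> 0.704 ^ 5" "t ^ 6 \<le> 0.704 ^ 6" using t by (intro power_mono; simp)+
    then show False using M3 \<open>t \<le> 0.704\<close> by (simp add: eval_nat_numeral)
  qed
  have plo: "0.704 ^ k \<le> t ^ k" for k using lo by (intro power_mono) auto
  have skew3: "a 3 = - (\<epsilon> * a 3)" using skew[of 3] g3 by simp
  show False
  proof (cases "a 2 = 0")
    case True
    then have a3': "of_int (a 3) * t ^ 3 \<le> 0" using a3 t by (intro mult_nonpos_nonneg) auto
    show False using eps
    proof
      assume e: "\<epsilon> = 1"
      then have "a 3 = 0" using skew3 by simp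
      then have "1 + t ^ 6 + t ^ 5 = t" using Qt e True by simp
      then show False using t by (smt (verit) zero_less_power)
    next
      assume e: "\<epsilon> = - 1"
      then show False using Qt True a3' M3 by simp
    qed
  next
    case False
    then have a2: "a 2 < 0" using a2 by simp
    \<comment> \<open>From 0.72 on both alternatives for a disjoint loop and 2-cycle fail.\<close>
    have up: "t < 0.72"
    proof (rule ccontr)
      assume "\<not> ?thesis"
      then have t72: "0.72 \<le> t" by simp
      have "0.72 ^ k \<le> t ^ k" for k using t72 by (intro power_mono) auto
      from this[of 2] this[of 6] this[of 9]
      have p: "0.5184 \<le> t ^ 2" "0.139 \<le> t ^ 6" "0.05 \<le> t ^ 9" by (simp_all add: eval_nat_numeral)
      have "(1 - t) * (1 - t\<^sup>2) \<le> 0.28 * 0.4816"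
        using t72 t p by (intro mult_mono) (auto simp: power_le_one)
      then show False using dj[OF a2] p by auto
    qed
    have pup: "t ^ k \<le> 0.72 ^ k" for k using up t by (intro power_mono) auto
    have p: "0.4956 \<le> t ^ 2" "0.348 \<le> t ^ 3" "0.245 \<le> t ^ 4" 
      "t ^ 4 \<le> 0.27" "t ^ 5 \<le> 0.194" "t ^ 6 \<le> 0.14" "0.042 \<le> t ^ 9" "t ^ 3 \<le> 0.374" "t ^ 2 \<le> 0.5184"
      using plo[of 2] plo[of 3] plo[of 4] pup[of 4] pup[of 5] pup[of 6] plo[of 9] pup[of 3] pup[of 2]
      by (simp_all add: eval_nat_numeral)
    show False using eps
    proof
      assume e: "\<epsilon> = 1"
      then have "a 3 = 0" using skew3 by simp
      then have "1 + t ^ 6 - t + t ^ 5 + of_int (a 2) * (t ^ 2 + t ^ 4) = 0" using Qt e by simp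
      moreover have "of_int (a 2) * (t ^ 2 + t ^ 4) \<le> - 1 * (t ^ 2 + t ^ 4)"
        using a2 t by (intro mult_right_mono) auto
      ultimately show False using p lo by simp
    next
      assume e: "\<epsilon> = - 1"
      \<comment> \<open>In these parameters the factor of \<open>b\<close> is
        \<open>z ^ 2 * (z ^ 2 + z - 1)\<close>. It changes sign at the inverse golden ratio, about
        0.618: negative at 3/5 and positive at \<open>t\<close>.\<close>
      define b d :: int where "b = - a 2" and "d = - a 2 - a 3"
      have bd: "1 \<le> b" "0 \<le> d" using a2 a3 by (simp_all add: b_def d_def)
      have ab: "of_int (a 2) = - real_of_int b" "of_int (a 3) = real_of_int b - real_of_int d"
        by (simp_all add: b_def d_def)
      have Qz: "(\<Sum>m\<le>6. of_int (a m) * z ^ m) = 1 - z - z ^ 5 - z ^ 6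
        + of_int b * (z ^ 3 + z ^ 4 - z ^ 2) - of_int d * z ^ 3" for z :: real
        unfolding Q ab e by (simp add: algebra_simps)
      have z: "1 - t - t ^ 5 - t ^ 6 + of_int b * (t ^ 3 + t ^ 4 - t ^ 2) - of_int d * t ^ 3 = 0"
        using Qz[of t] Q0 g3 by simp
      \<comment> \<open>The value at 3/5, scaled by 100000 and rounded. It leaves
        \<open>d = 0\<close>, or \<open>d = 1\<close> with \<open>b \<le> 4\<close>.\<close>
      have "1440 * real_of_int b + 21600 * real_of_int d < 28000"
        using pos[of "3 / 5"] lo unfolding Qz by (simp add: eval_nat_numeral)
      then have "1440 * b + 21600 * d < 28000" by linarith
      then have "d < 2" "d = 1 \<Longrightarrow> b < 5" using bd by linarith+
      then consider "d = 0" | "d = 1" "b \<le> 3" | "d = 1" "b = 4" using bd by linarith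
      then show False
      proof cases
        case 1
        have "1 * (t ^ 3 + t ^ 4 - t ^ 2) \<le> of_int b * (t ^ 3 + t ^ 4 - t ^ 2)"
          using bd p by (intro mult_right_mono) auto
        then show False using z 1 up p by simp
      next
        case 2
        have "of_int b * (t ^ 3 + t ^ 4 - t ^ 2) \<le> 3 * (t ^ 3 + t ^ 4 - t ^ 2)"
          using 2 p by (intro mult_right_mono) auto
        moreover have "t ^ 2 * (3 * t ^ 2 + 2 * t - 3) < 0"
          using up p(9) t by (intro mult_pos_neg) auto
        ultimately show False using z 2 M3 by (simp add: algebra_simps eval_nat_numeral)
      next
        case 3
        \<comment> \<open>The interval is halved at 0.712, since one pair of bounds on the powers of
          \<open>t\<close> is too coarse to separate the two sides.\<close>
        have eq: "t ^ 2 * (4 * t ^ 2 + 3 * t - 4) = t + t ^ 5 + t ^ 6 - 1"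
          using z 3 by (simp add: algebra_simps eval_nat_numeral)
        show False
        proof (cases "t \<le> 0.712")
          case True
          then have "t ^ 5 \<le> 0.712 ^ 5" "t ^ 6 \<le> 0.712 ^ 6" using t by (intro power_mono; simp)+
          then have "t ^ 5 \<le> 0.183" "t ^ 6 \<le> 0.1303" by (simp_all add: eval_nat_numeral)
          moreover have "0.4956 * 0.094 \<le> t ^ 2 * (4 * t ^ 2 + 3 * t - 4)"
            using p lo by (intro mult_mono) auto
          ultimately show False using eq True by simp
        next
          case False
          then have "0.712 ^ 2 \<le> t ^ 2" by (intro power_mono) auto
          then have "0.5069 \<le> t ^ 2" by (simp add: eval_nat_numeral)
          then have "0.5069 * 0.163 \<le> t ^ 2 * (4 * t ^ 2 + 3 * t - 4)"
            using False by (intro mult_mono) auto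
          then show False using eq up p by simp
        qed
      qed
    qed
  qed
qed

end

subsection \<open>The lower bound\<close>

text \<open>\<open>T\<close> is the polynomial \<open>(- z) ^ n * P (- 1 / z)\<close>, and
  \<open>F\<close> is the monic polynomial whose roots are the images of the roots of
  \<open>P\<close> under \<open>f\<close>. They agree up to the factor \<open>coeff P 0\<close>, so
  invariance of the root multiset, that is \<open>F = P\<close>, becomes a comparison of
  coefficients.\<close>

lemma skew_reciprocal_iff:
  fixes C :: "complex mat"
  assumes C: "C \<in> carrier_mat n n" and n: "even n" and p0: "coeff (char_poly C) 0 \<noteq> 0"
  shows "skew_reciprocal C \<longleftrightarrow> (\<forall>k\<le>n. coeff (char_poly C) (n - k) =
    (- 1) ^ k * coeff (char_poly C) 0 * coeff (char_poly C) k)"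
proof -
  define P where "P = char_poly C"
  define f :: "complex \<Rightarrow> complex" where "f z = - (1 / z)" for z
  define R where "R = proots P"
  have deg: "degree P = n" and lc: "lead_coeff P = 1"
    using degree_monic_char_poly[OF C] by (auto simp: P_def)
  have P0: "P \<noteq> 0" using p0 by (auto simp: P_def)
  have sz: "size R = n" unfolding R_def size_proots_complex deg ..
  have dec: "P = (\<Prod>r\<in>#R. [:- r, 1:])"
    using complex_poly_decompose_multiset[of P] lc by (simp add: R_def)
  have "poly P 0 \<noteq> 0" using p0 by (simp add: P_def poly_0_coeff_0)
  then have nz: "0 \<notin># R" using P0 by (simp add: R_def)
  have polyP: "poly P z = (\<Prod>r\<in>#R. z - r)" for z
    by (subst dec) (simp add: poly_prod_mset image_mset.compositionality o_def)
  define F where "F = (\<Prod>r\<in>#R. [:- f r, 1:])"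
  define T where "T = pcompose (reflect_poly P) [:0, - 1:]"
  have T: "T = Polynomial.smult (coeff P 0) F"
  proof -
    have TF: "poly T z = poly (Polynomial.smult (coeff P 0) F) z" if z: "z \<noteq> 0" for z
    proof -
      have "poly T z = (- z) ^ n * poly P (inverse (- z))"
        using z by (simp add: T_def poly_pcompose poly_reflect_poly_nz deg)
      also have "\<dots> = (- z) ^ size R * (\<Prod>r\<in>#R. inverse (- z) - r)"
        unfolding sz polyP ..
      also have "\<dots> = (\<Prod>r\<in>#R. - z * (inverse (- z) - r))"
        unfolding prod_mset.distrib by simp
      also have "\<dots> = (\<Prod>r\<in>#R. (- r) * (- (z - f r)))"
        using nz z by (intro arg_cong[of _ _ prod_mset] image_mset_cong) (auto simp: f_def field_simps)
      also have "\<dots> = (\<Prod>r\<in>#R. - r) * ((- 1) ^ n * (\<Prod>r\<in>#R. z - f r))"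
      proof -
        have "(\<Prod>r\<in>#R. - (z - f r)) = (\<Prod>r\<in>#R. (- 1) * (z - f r))" by simp
        also have "\<dots> = (- 1) ^ n * (\<Prod>r\<in>#R. z - f r)"
          unfolding prod_mset.distrib by (simp add: sz)
        finally show ?thesis by (simp only: prod_mset.distrib)
      qed
      also have "(\<Prod>r\<in>#R. - r) = poly P 0"
        by (simp add: polyP)
      also have "(\<Prod>r\<in>#R. z - f r) = poly F z"
        unfolding F_def by (simp add: poly_prod_mset image_mset.compositionality o_def)
      finally show ?thesis using n by (simp add: poly_0_coeff_0)
    qed
    have "T - Polynomial.smult (coeff P 0) F = 0"
    proof (rule ccontr)
      assume "T - Polynomial.smult (coeff P 0) F \<noteq> 0"
      then have "finite {z. poly (T - Polynomial.smult (coeff P 0) F) z = 0}" by (rule poly_roots_finite)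
      moreover have "UNIV - {0} \<subseteq> {z. poly (T - Polynomial.smult (coeff P 0) F) z = 0}" using TF by auto
      ultimately have "finite (UNIV - {0 :: complex})" using finite_subset by blast
      then show False using infinite_UNIV_char_0[where ?'a = complex] by simp
    qed
    then show ?thesis by simp
  qed
  have "skew_reciprocal C \<longleftrightarrow> image_mset f R = R"
    using C nz by (simp add: skew_reciprocal_def eigenvalue_mset_def R_def P_def f_def[abs_def])
  also have "\<dots> \<longleftrightarrow> F = P"
  proof
    assume "image_mset f R = R"
    then have "(\<Prod>r\<in>#image_mset f R. [:- r, 1:]) = P" using dec by simp
    then show "F = P" by (simp add: F_def image_mset.compositionality o_def)
  next
    assume "F = P"
    have "proots F = (\<Sum>r\<in>#R. proots [:- f r, 1:])"
    proof -
      have "0 \<notin># image_mset (\<lambda>r. [:- f r, 1:]) R"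
      proof
        assume "0 \<in># image_mset (\<lambda>r. [:- f r, 1:]) R"
        then obtain r where "0 = [:- f r, 1:]" by auto
        from this[symmetric] show False by simp
      qed
      from proots_prod_mset[OF this] show ?thesis
        by (simp add: F_def image_mset.compositionality o_def)
    qed
    also have "\<dots> = image_mset f R" by (induction R) auto
    finally show "image_mset f R = R" using \<open>F = P\<close> by (simp add: R_def)
  qed
  also have "\<dots> \<longleftrightarrow> T = Polynomial.smult (coeff P 0) P"
  proof
    assume "T = Polynomial.smult (coeff P 0) P"
    then have "Polynomial.smult (inverse (coeff P 0)) (Polynomial.smult (coeff P 0) F) =
      Polynomial.smult (inverse (coeff P 0)) (Polynomial.smult (coeff P 0) P)" using T by simp
    then show "F = P" using p0 by (simp add: P_def)
  qed (use T in simp)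
  also have "\<dots> \<longleftrightarrow> (\<forall>k. coeff T k = coeff P 0 * coeff P k)" by (auto simp: poly_eq_iff)
  also have "\<dots> \<longleftrightarrow> (\<forall>k\<le>n. (- 1) ^ k * coeff P (n - k) = coeff P 0 * coeff P k)"
  proof -
    have "coeff T k = (if k \<le> n then (- 1) ^ k * coeff P (n - k) else 0)" for k
      by (simp add: T_def coeff_pcompose_linear coeff_reflect_poly deg)
    moreover have "coeff P k = 0" if "\<not> k \<le> n" for k using that deg by (simp add: coeff_eq_0)
    ultimately show ?thesis by auto
  qed
  also have "\<dots> \<longleftrightarrow> (\<forall>k\<le>n. coeff P (n - k) = (- 1) ^ k * coeff P 0 * coeff P k)"
  proof -
    have "(- 1) ^ k * u = v \<longleftrightarrow> u = (- 1) ^ k * v" for k :: nat and u v :: complex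
      by (cases "even k") auto
    then show ?thesis by (simp add: mult.assoc)
  qed
  finally show ?thesis by (simp add: P_def)
qed

section \<open>From cycles to the arithmetic of lengths\<close>

context perron_graph
begin

text \<open>The mean \<open>s\<close> of \<open>t ^ p\<close> and \<open>t ^ q\<close> has
  \<open>s * s \<ge> t ^ g\<close>, hence \<open>s > 1 - t ^ g\<close>; and the product on the left
  is at most \<open>(1 - s) * (1 - s)\<close>.\<close>

lemma short_pair:
  assumes x: "(1 - t ^ g) * (1 - t ^ g) < t ^ g" and pq: "p + q \<le> g"
  shows "(1 - t ^ p) * (1 - t ^ q) < t ^ g * t ^ g"
proof -
  let ?x = "t ^ g"
  define s where "s = (t ^ p + t ^ q) / 2"
  have K: "0 < t ^ p" "t ^ p \<le> 1" "0 < t ^ q" "t ^ q \<le> 1"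
    using t_pos t_less_1 by (auto simp: power_le_one)
  have "?x \<le> t ^ (p + q)" using t_pos t_less_1 pq by (intro power_decreasing) auto
  also have "\<dots> = t ^ p * t ^ q" by (rule power_add)
  also have "\<dots> \<le> s * s"
    using sum_squares_ge_zero[of "t ^ p - t ^ q" 0] by (simp add: s_def field_simps)
  finally have ss: "?x \<le> s * s" .
  have s: "1 - ?x < s"
  proof (rule ccontr)
    assume "\<not> ?thesis"
    then have "s * s \<le> (1 - ?x) * (1 - ?x)" using K by (intro mult_mono) (auto simp: s_def)
    then show False using ss x by simp
  qed
  have "(1 - t ^ p) * (1 - t ^ q) \<le> (1 - s) * (1 - s)"
    using sum_squares_ge_zero[of "t ^ p - t ^ q" 0] by (simp add: s_def field_simps)
  also have "\<dots> < ?x * ?x"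
  proof -
    have "0 \<le> 1 - s" using K by (simp add: s_def)
    moreover have "1 - s < ?x" using s by linarith
    ultimately show ?thesis by (intro mult_strict_mono')
  qed
  finally show ?thesis .
qed

text \<open>The second alternative of \<open>dj_bound\<close>, multiplied by
  \<open>t ^ p * t ^ q\<close>, bounds \<open>4 * (t ^ n)^2\<close> by a product of two terms
  \<open>u * (1 - u) \<le> 1 / 4\<close>, so it needs \<open>t ^ n \<le> 1 / 8\<close>.\<close>

lemma dj_bound_strong:
  assumes dj: "dj p q" and n: "1 / 8 < t ^ n"
  shows "t ^ n \<le> (1 - t ^ p) * (1 - t ^ q)"
proof -
  have "\<not> 4 * t ^ (2 * n - p - q) \<le> (1 - t ^ p) * (1 - t ^ q)"
  proof
    assume le: "4 * t ^ (2 * n - p - q) \<le> (1 - t ^ p) * (1 - t ^ q)"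
    have quarter: "0 \<le> u * (1 - u) \<and> u * (1 - u) \<le> 1 / 4" if "0 \<le> u" "u \<le> 1" for u :: real
    proof
      show "0 \<le> u * (1 - u)" using that by simp
      show "u * (1 - u) \<le> 1 / 4" using sum_squares_ge_zero[of "u - 1 / 2" 0] by (simp add: field_simps)
    qed
    have "p + q \<le> n" by (rule dj_bound(2)[OF dj])
    then have "4 * (t ^ n * t ^ n) = (t ^ p * t ^ q) * (4 * t ^ (2 * n - p - q))"
      by (simp add: mult_2 flip: power_add)
    also have "\<dots> \<le> (t ^ p * t ^ q) * ((1 - t ^ p) * (1 - t ^ q))"
      using le t_pos by (intro mult_left_mono) auto
    also have "\<dots> = (t ^ p * (1 - t ^ p)) * (t ^ q * (1 - t ^ q))" by (simp add: mult_ac)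
    also have "\<dots> \<le> 1 / 4 * (1 / 4)"
      using quarter[of "t ^ p"] quarter[of "t ^ q"] t_pos t_less_1
      by (intro mult_mono) (auto simp: power_le_one)
    finally have "4 * (t ^ n * t ^ n) \<le> 1 / 16" by simp
    moreover have "1 / 8 * (1 / 8) < t ^ n * t ^ n" using n by (intro mult_strict_mono) auto
    ultimately show False by simp
  qed
  then show ?thesis using dj_bound(1)[OF dj] by blast
qed

lemma generic_impossible:
  assumes n: "n = 2 * g" and sk: "skew_coeffs g t a \<epsilon>" and x0: "(3 - sqrt 5) / 2 < t ^ g"
  shows False
proof -
  interpret skew_coeffs g t a \<epsilon> by (rule sk)
  have xq: "19 / 50 < x" "(1 - x) * (1 - x) < x"
  proof -
    have s: "sqrt 5 * sqrt 5 = 5" "0 \<le> sqrt 5" by simp_all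
    have "sqrt 5 < 2.24" by (rule real_less_lsqrt) (simp_all add: power2_eq_square)
    then show "19 / 50 < x" using x0 by simp
    have "0 < (x - (3 - sqrt 5) / 2) * ((3 + sqrt 5) / 2 - x)"
      using x0 x01 s by (intro mult_pos_pos) auto
    also have "\<dots> = 3 * x - 1 - x * x" using s by (simp add: field_simps)
    finally show "(1 - x) * (1 - x) < x" by (simp add: algebra_simps)
  qed
  have "19 / 50 * (19 / 50) < x * x" using xq by (intro mult_strict_mono) auto
  then have n8: "1 / 8 < t ^ n" unfolding n y by simp
  have bound: "y \<le> (1 - t ^ p) * (1 - t ^ q)" if "dj p q" for p q
    using dj_bound_strong[OF that n8] by (simp add: n)
  have D: "g < p + q" if "dj p q" for p q
    using bound[OF that] short_pair[OF xq(2), of p q] y by fastforce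
  have Lsum: "g < p + q" if "len p" "len q" "p \<noteq> q" for p q
  proof (cases "dj p q")
    case False
    show ?thesis
    \<comment> \<open>For meeting cycles with \<open>p + q \<le> g\<close>, AM-GM turns
      \<open>t ^ p + t ^ q \<le> 1\<close> into \<open>x \<le> 1 / 4\<close>.\<close>
    proof (rule ccontr)
      assume "\<not> ?thesis"
      then have "p + q \<le> g" by simp
      have le1: "t ^ p + t ^ q \<le> 1" by (rule len_meet[OF that False])
      have "x \<le> t ^ p * t ^ q" using t \<open>p + q \<le> g\<close>
        by (simp flip: power_add add: power_decreasing)
      moreover have "4 * (t ^ p * t ^ q) \<le> (t ^ p + t ^ q) * (t ^ p + t ^ q)"
        using sum_squares_ge_zero[of "t ^ p - t ^ q" 0] by (simp add: algebra_simps)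
      moreover have "(t ^ p + t ^ q) * (t ^ p + t ^ q) \<le> 1 * 1"
        using le1 t by (intro mult_mono) auto
      ultimately show False using xq(1) by linarith
    qed
  qed (rule D)
  interpret cycle_lengths g t a \<epsilon> len dj
  proof
    show "(3 - sqrt 5) / 2 < t ^ g" by (rule x0)
    show "0 < p \<and> p \<le> 2 * g" if "len p" for p using len_bounds[OF that] n by simp
    show "a m \<le> 0" if "0 < m" "m \<le> g" for m by (rule a_nonpos[OF D that])
    show "a m < 0 \<longleftrightarrow> len m" if "0 < m" "m \<le> g" for m by (rule a_neg_iff[OF D that])
    show "len p" if "dj p q" for p q by (rule dj_len(1)[OF that])
    show "dj q p" if "dj p q" for p q by (rule dj_sym[OF that])
    show "- 1 \<le> a m" if m: "0 < m" "2 * m \<le> g" for m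
    proof (rule a_ge_minus_one[OF D m])
      have "x \<le> t ^ m * t ^ m" using t m by (simp flip: power_add add: power_decreasing mult_2)
      moreover have "t ^ m * t ^ m \<le> 1 / 2 * (1 / 2)" if "t ^ m \<le> 1 / 2"
        using that t by (intro mult_mono) auto
      ultimately show "1 < 2 * t ^ m" using xq(1) by fastforce
    qed
    show "a m \<le> - 2" if "m \<le> g" "dj m m" for m by (rule dj_same[OF D that])
    show "\<exists>p q. dj p q \<and> p + q = m" if "0 < m" "m \<le> 2 * g" "0 < a m \<or> a m = 0 \<and> len m" for m
      by (rule a_pos_dj[of g, OF D _ that(1,3)]) (simp_all add: n)
    show "t ^ p + t ^ q \<le> 1" if "len p" "len q" "p \<noteq> q" "\<not> dj p q" for p q
      by (rule len_meet[OF that])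
  qed (use bound Lsum in auto)
  show False by (rule impossible)
qed

text \<open>The bound \<open>0.704 < t\<close> only gives \<open>t ^ 6 > 0.12\<close>, short of the
  1/8 in \<open>dj_bound_strong\<close>, so both alternatives of \<open>dj_bound\<close> are carried
  along. The split is by the number of loops, \<open>- a 1\<close>, which is 0 or 1.\<close>

lemma three_impossible:
  assumes n: "n = 6" and sk: "skew_coeffs 3 t a \<epsilon>"
    and pos: "\<And>s. 0 < s \<Longrightarrow> s < t \<Longrightarrow> 0 < (\<Sum>m\<le>6. of_int (a m) * s ^ m)"
  shows False
proof -
  interpret skew_coeffs 3 t a \<epsilon> by (rule sk)
  have M3: "1 < t + t ^ 5 + t ^ 6" using M by simp
  have lo: "0.704 < t"
  proof (rule ccontr)
    assume "\<not> ?thesis"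
    then have "t \<le> 0.704" by simp
    then have "t ^ 5 \<le> 0.704 ^ 5" "t ^ 6 \<le> 0.704 ^ 6" using t by (intro power_mono; simp)+
    then show False using M3 \<open>t \<le> 0.704\<close> by (simp add: eval_nat_numeral)
  qed
  have plo: "0.704 ^ k \<le> t ^ k" for k using lo by (intro power_mono) auto
  have t2: "0.4956 < t\<^sup>2" "0.12 < t ^ 6" "0.029 < t ^ 10"
    using plo[of 2] plo[of 6] plo[of 10] by (simp_all add: eval_nat_numeral)
  have D2: "2 < p + q" if dj: "dj p q" for p q
  proof (rule ccontr)
    assume "\<not> ?thesis"
    moreover have "0 < p" "0 < q" using len_bounds dj_len[OF dj] by blast+
    ultimately have pq: "p = 1" "q = 1" by auto
    have "(1 - t) * (1 - t) \<le> 0.296 * 0.296" using lo t by (intro mult_mono) auto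
    then show False using dj_bound(1)[OF dj] t2 unfolding pq n by simp
  qed
  have le0: "a m \<le> 0" "a m < 0 \<longleftrightarrow> len m" if "0 < m" "m \<le> 2" for m
    using a_nonpos[of 2 m, OF D2 that] a_neg_iff[of 2 m, OF D2 that] by auto
  have "- 1 \<le> a 1" by (rule a_ge_minus_one[of 2, OF D2]) (use lo in auto)
  then consider "a 1 = 0" | "a 1 = - 1" using le0(1)[of 1] by fastforce
  then show False
  proof cases
    case 1
    then have no1: "\<not> len 1" using le0(2)[of 1] by simp
    have D3: "3 < p + q" if dj: "dj p q" for p q
    proof -
      have "p \<noteq> 1" "q \<noteq> 1" "0 < p" "0 < q" using no1 dj_len[OF dj] len_bounds by auto
      then show ?thesis by linarith
    qed
    show False
    proof (rule three_loopfree)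
      show "a 1 = 0" by (rule 1)
      show "a m \<le> 0" if "0 < m" "m \<le> 3" for m by (rule a_nonpos[of 3, OF D3 that])
      show "1 < t + t\<^sup>2" using lo t2 by simp
      assume "0 < a 4"
      then obtain p q where dj: "dj p q" and pq: "p + q = 4"
        using a_pos_dj[of 3 4, OF D3] n by auto
      have "p \<noteq> 1" "q \<noteq> 1" "0 < p" "0 < q" using no1 dj_len[OF dj] len_bounds by auto
      then have "p = 2" "q = 2" using pq by linarith+
      then have "dj 2 2" using dj by simp
      then show "a 2 \<le> - 2 \<and> (a 2 = - 2 \<longrightarrow> a 4 \<le> 1)"
        using dj_same[of 3 2, OF D3] a_four_le[OF D3 _ no1] n by auto
    qed simp
  next
    case 2
    show False
    proof (rule three_loop)
      show "a 1 = - 1" by (rule 2)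
      show "a 2 \<le> 0" using le0(1)[of 2] by simp
      show "a 3 \<le> - a 2" by (rule a_three_le[OF D2 2])
      show "t ^ 6 \<le> (1 - t) * (1 - t\<^sup>2) \<or> 4 * t ^ 9 \<le> (1 - t) * (1 - t\<^sup>2)" if "a 2 < 0"
      proof -
        have "len 1" "len 2" using le0(2)[of 1] le0(2)[of 2] 2 that by auto
        moreover have "\<not> t ^ 1 + t ^ 2 \<le> 1" using lo t2 by simp
        ultimately have "dj 1 2" using len_meet[of 1 2] by fastforce
        from dj_bound(1)[OF this] show ?thesis by (simp add: n)
      qed
      show "0 < (\<Sum>m\<le>6. of_int (a m) * s ^ m)" if "0 < s" "s < t" for s
        by (rule pos[OF that])
    qed simp
  qed
qed

end

text \<open>Chosen so that \<open>g - gap g\<close> is the largest odd number below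
  \<open>g\<close>; as \<open>gap g\<close> is coprime to \<open>g\<close>, both
  \<open>g - gap g\<close> and \<open>g + gap g\<close> are coprime to \<open>2 * g\<close>.\<close>

definition gap :: "nat \<Rightarrow> nat" where
  "gap g = (if odd g then 2 else 1)"

text \<open>At \<open>1 / z\<close> it equals 1 exactly where \<open>mu_poly g\<close> vanishes at
  \<open>z > 0\<close>. Being increasing, it makes \<open>mu g\<close> the only positive root, and
  spectral radius below \<open>mu g\<close> means value above 1 at \<open>t\<close>.\<close>

definition recip_sum :: "nat \<Rightarrow> real \<Rightarrow> real" where
  "recip_sum g s = s ^ (g - gap g) + s ^ (g + gap g) + s ^ (2 * g)"

lemma gap_less: assumes "2 \<le> g" shows "gap g < g"
proof (cases "odd g")
  case True
  then have "g \<noteq> 2" by auto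
  then show ?thesis using assms by (simp add: gap_def)
qed (use assms in \<open>simp add: gap_def\<close>)

lemma poly_mu_poly: "poly (mu_poly g) z = z ^ (2 * g) - z ^ (g + gap g) - z ^ (g - gap g) - 1"
  by (simp add: mu_poly_def gap_def poly_monom)

lemma recip_sum_strict_mono:
  assumes "2 \<le> g" "0 \<le> s" "s < u" shows "recip_sum g s < recip_sum g u"
proof -
  have "s ^ k < u ^ k" if "0 < k" for k using assms that by (intro power_strict_mono) auto
  from this[of "g - gap g"] this[of "g + gap g"] this[of "2 * g"] show ?thesis
    using assms gap_less[of g] by (simp add: recip_sum_def)
qed

lemma poly_mu_poly_recip:
  assumes "2 \<le> g" "0 < z"
  shows "poly (mu_poly g) z = z ^ (2 * g) * (1 - recip_sum g (1 / z))"
proof -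
  have k: "z ^ (2 * g) * (1 / z) ^ k = z ^ (2 * g - k)" if "k \<le> 2 * g" for k
    using that assms by (simp add: power_diff power_divide)
  have "2 * g - (g - gap g) = g + gap g" "2 * g - (g + gap g) = g - gap g"
    using gap_less[OF assms(1)] by auto
  then show ?thesis
    using k[of "g - gap g"] k[of "g + gap g"] k[of "2 * g"] gap_less[OF assms(1)]
    unfolding poly_mu_poly recip_sum_def by (simp add: right_diff_distrib distrib_left)
qed

lemma mu_gt_1: assumes g: "2 \<le> g" shows "1 < mu g"
proof -
  \<comment> \<open>The three powers of 1/2 are at most 1/2, 1/4 and 1/4, so the polynomial changes
    sign between 1 and 2.\<close>
  have "recip_sum g (1 / 2) \<le> 1"
  proof -
    have p: "(1 / 2 :: real) ^ k \<le> (1 / 2) ^ l" if "l \<le> k" for k l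
      using that by (intro power_decreasing) auto
    have "1 \<le> g - gap g" using gap_less[OF g] by simp
    then show ?thesis using p[of 1 "g - gap g"] p[of 2 "g + gap g"] p[of 2 "2 * g"] g
      by (simp add: recip_sum_def power2_eq_square)
  qed
  then have "0 \<le> poly (mu_poly g) 2" using g by (simp add: poly_mu_poly_recip)
  moreover have "poly (mu_poly g) 1 < 0" by (simp add: poly_mu_poly)
  ultimately obtain z where "1 < z" "poly (mu_poly g) z = 0"
  proof (cases "poly (mu_poly g) 2 = 0")
    case True
    then show thesis using that[of 2] by simp
  next
    case False
    then show thesis
      using that poly_IVT_pos[of 1 2 "mu_poly g"] \<open>0 \<le> poly (mu_poly g) 2\<close>
        \<open>poly (mu_poly g) 1 < 0\<close> by auto
  qed
  then show ?thesis using mu_greatest_root(2)[OF g, of z] by linarith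
qed

lemma recip_sum_mu: assumes g: "2 \<le> g" shows "recip_sum g (1 / mu g) = 1"
  using mu_greatest_root(1)[OF g] mu_gt_1[OF g] by (simp add: poly_mu_poly_recip[OF g])

text \<open>For \<open>s ^ g = (3 - sqrt 5) / 2\<close>, the square of the inverse golden ratio,
  the power \<open>s ^ gap g\<close> is at least the inverse golden ratio; this fails for \<open>g = 3\<close> only.\<close>
lemma middle_power_gt:
  assumes g: "2 \<le> g" "g \<noteq> 3" and t: "0 < t" "t < 1" and M: "1 < recip_sum g t"
  shows "(3 - sqrt 5) / 2 < t ^ g"
proof (rule ccontr)
  assume "\<not> ?thesis"
  then have le: "t ^ g \<le> (3 - sqrt 5) / 2" by simp
  define p where "p = (sqrt 5 - 1) / 2"
  have s5: "sqrt 5 * sqrt 5 = 5" "0 \<le> sqrt 5" by simp_all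
  have s5': "2 < sqrt 5" "sqrt 5 < 3" by (rule real_less_rsqrt real_less_lsqrt; simp)+
  have pp: "p * p = (3 - sqrt 5) / 2" using s5 by (simp add: p_def field_simps)
  have p01: "0 < p" "p < 1" using s5' by (auto simp: p_def)
  define s where "s = root g (p * p)"
  have s: "s ^ g = p * p" "0 < s" using g p01 by (simp_all add: s_def)
  have s1: "s \<le> 1"
  proof (rule ccontr)
    assume "\<not> ?thesis"
    then have "1 \<le> s ^ g" by simp
    then show False using s p01 mult_strict_mono[of p 1 p 1] by simp
  qed
  have ts: "t \<le> s"
  proof (rule power_le_imp_le_base[of t "g - 1"])
    show "t ^ Suc (g - 1) \<le> s ^ Suc (g - 1)" using g s le pp by simp
  qed (use s in simp)
  define r where "r = s ^ gap g"
  \<comment> \<open>For \<open>g = 3\<close> this would read \<open>4 \<le> 3\<close>. It makes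
    \<open>r\<close> at least the square root of \<open>s ^ g\<close>, which is
    \<open>p\<close>.\<close>
  have d2: "2 * gap g \<le> g"
  proof (cases "odd g")
    case True
    then have "4 \<le> g" using g by presburger
    then show ?thesis by (simp add: gap_def)
  qed (use g in \<open>simp add: gap_def\<close>)
  have r: "0 < r" "r \<le> 1" "p \<le> r"
  proof -
    show "0 < r" "r \<le> 1" using s s1 by (auto simp: r_def power_le_one)
    have "p * p \<le> s ^ (2 * gap g)" unfolding s(1)[symmetric] using s s1 d2 by (intro power_decreasing) auto
    also have "\<dots> = r * r" by (simp add: r_def mult_2 power_add)
    finally show "p \<le> r" using \<open>0 < r\<close> p01 by (metis less_le mult_strict_mono not_less)
  qed
  have "s ^ (g + gap g) = p * p * r" by (simp add: power_add s r_def)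
  moreover have "s ^ (g - gap g) * r = p * p"
    using gap_less[OF g(1)] by (simp add: r_def s flip: power_add)
  moreover have "s ^ (2 * g) = (p * p) * (p * p)" by (simp add: mult_2 power_add s)
  ultimately have S: "recip_sum g s * r = p * p + p * p * r * r + (p * p) * (p * p) * r"
    by (simp add: recip_sum_def algebra_simps)
  have p1: "p * p = 1 - p" unfolding pp by (simp add: p_def field_simps)
  \<comment> \<open>This is \<open>r + 1 / r \<le> p + 1 / p\<close> without denominators:
    \<open>recip_sum g s\<close> is largest when \<open>r = p\<close>, where
    \<open>p * p = 1 - p\<close> makes it exactly 1.\<close>
  have "0 \<le> (r - p) * (1 - p * r)"
    using r p01 by (intro mult_nonneg_nonneg) (auto simp: mult_le_one)
  then have "p * (1 + r * r) \<le> r * (1 + p * p)" by (simp add: algebra_simps)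
  then have le': "p * (p * (1 + r * r)) \<le> p * (r * (1 + p * p))" using p01 by (intro mult_left_mono) auto
  have one: "p * (1 + p * p) + (p * p) * (p * p) = 1" unfolding p1 using p1 by (simp add: algebra_simps)
  have "recip_sum g s * r = p * (p * (1 + r * r)) + (p * p) * (p * p) * r"
    unfolding S by (simp add: algebra_simps)
  also have "\<dots> \<le> p * (r * (1 + p * p)) + (p * p) * (p * p) * r" using le' by simp
  also have "\<dots> = (p * (1 + p * p) + (p * p) * (p * p)) * r" by (simp add: algebra_simps)
  finally have "recip_sum g s * r \<le> 1 * r" unfolding one .
  then have "recip_sum g s \<le> 1" using r by simp
  moreover have "recip_sum g t \<le> recip_sum g s"
    using recip_sum_strict_mono[OF g(1), of t s] t ts by (cases "t = s") auto
  ultimately show False using M by simp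
qed

lemma a_eq_coeff:
  assumes "perron_graph n (\<lambda>i j. A $$ (i, j)) v t" and A: "A \<in> carrier_mat n n" and m: "m \<le> n"
  shows "perron_graph.a n (\<lambda>i j. A $$ (i, j)) m = coeff (char_poly A) (n - m)"
proof -
  interpret perron_graph n "\<lambda>i j. A $$ (i, j)" v t by fact
  have fin: "finite {S. S \<subseteq> {0..<n} \<and> card S = m}" by (rule finite_subset[of _ "Pow {0..<n}"]) auto
  have fin2: "finite {\<pi>. \<pi> permutes S}" if "S \<in> {S. S \<subseteq> {0..<n} \<and> card S = m}" for S
    using that finite_subset[of S "{0..<n}"] by (intro finite_permutations) auto
  have "a m = (\<Sum>S | S \<subseteq> {0..<n} \<and> card S = m. \<Sum>\<pi> | \<pi> permutes S. signed_wt S \<pi>)"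
    unfolding a_def perms_def using fin fin2 by (intro sum.Sigma[symmetric]) auto
  also have "\<dots> = coeff (char_poly A) (n - m)"
    unfolding coeff_char_poly[OF A m]
    by (intro sum.cong refl) (auto simp: signed_wt_def wt_def)
  finally show ?thesis .
qed

theorem lower_bound:
  assumes g: "2 \<le> g" and A: "A \<in> carrier_mat (2 * g) (2 * g)" and prim: "primitive_matrix A"
    and skew: "skew_reciprocal (complex_of_int_mat A)"
    and r1: "1 < spectral_radius (complex_of_int_mat A)"
  shows "mu g \<le> spectral_radius (complex_of_int_mat A)"
proof (rule ccontr)
  assume neg: "\<not> ?thesis"
  define n C r where "n = 2 * g" and "C = complex_of_int_mat A" and "r = spectral_radius C"
  have r: "1 < r" "r < mu g" using r1 neg by (auto simp: r_def C_def)
  have An: "A \<in> carrier_mat n n" and Cn: "C \<in> carrier_mat n n" and n0: "0 < n"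
    using A g by (auto simp: n_def C_def)
  obtain l where l: "eigenvalue C l" "norm l = r"
    using spectral_radius_mem_max(1)[OF Cn n0] by (auto simp: spectrum_def r_def)
  note pv = perron_vector[OF An n0 prim, folded C_def r_def]
  have nn: "nonneg_matrix A" using prim by (simp add: primitive_matrix_def)
  obtain v :: "nat \<Rightarrow> real" where v: "\<And>i. i < n \<Longrightarrow> 0 < v i" "\<And>i. i < n \<Longrightarrow> act A v i = r * v i"
    using pv(1)[OF l] by blast
  define t where "t = 1 / r"
  have t: "0 < t" "t < 1" using r by (auto simp: t_def)
  have pg: "perron_graph n (\<lambda>i j. A $$ (i, j)) v t"
  proof
    show "0 \<le> A $$ (i, j)" if "i < n" "j < n" for i j
      using nn An that by (auto simp: nonneg_matrix_def)
    show "t * (\<Sum>j<n. of_int (A $$ (i, j)) * v j) \<le> v i" if "i < n" for i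
      using v(2)[OF that] An r by (simp add: act_def t_def)
    obtain k where k: "pos_matrix (A ^\<^sub>m k)" using prim by (auto simp: primitive_matrix_def)
    show "\<exists>f m. f 0 = i \<and> f m = j \<and> (\<forall>l<m. f l < n \<and> f (Suc l) < n \<and> 0 < A $$ (f l, f (Suc l)))"
      if ij: "i < n" "j < n" for i j
    proof -
      have "0 < (A ^\<^sub>m k) $$ (i, j)" using k An ij by (simp add: pos_matrix_def)
      from walk_of_pow_pos[OF An nn ij this] show ?thesis by blast
    qed
  qed (use v t in auto)
  interpret perron_graph n "\<lambda>i j. A $$ (i, j)" v t by (rule pg)
  let ?P = "char_poly C"
  have cP: "coeff ?P k = of_int (coeff (char_poly A) k)" for k
    unfolding C_def of_int_hom.char_poly_hom[OF An] by simp
  have am: "of_int (a m) = coeff ?P (n - m)" if "m \<le> n" for m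
    using a_eq_coeff[OF pg An that] by (simp add: cP)
  have deg: "degree ?P = n" using degree_monic_char_poly[OF Cn] by simp
  have Qz: "(\<Sum>m\<le>n. of_int (a m) * z ^ m) = z ^ n * poly ?P (1 / z)" if z: "z \<noteq> 0" for z :: complex
  proof -
    have "z ^ n * poly ?P (1 / z) = (\<Sum>i\<le>n. coeff ?P i * z ^ (n - i))"
      unfolding poly_altdef deg sum_distrib_left using z
      by (intro sum.cong) (auto simp: power_diff power_divide)
    also have "\<dots> = (\<Sum>m\<le>n. coeff ?P (n - m) * z ^ m)"
      by (rule sum.reindex_bij_witness[of _ "\<lambda>m. n - m" "\<lambda>m. n - m"]) auto
    finally show ?thesis using am by simp
  qed
  have root: "eigenvalue C (1 / z) \<longleftrightarrow> (\<Sum>m\<le>n. of_int (a m) * z ^ m) = 0" if "z \<noteq> 0" for z :: complex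
    using eigenvalue_root_char_poly[OF Cn, of "1 / z"] Qz[OF that] that by simp
  have real_root: "eigenvalue C (of_real (1 / z)) \<longleftrightarrow> (\<Sum>m\<le>n. of_int (a m) * z ^ m) = 0"
    if "z \<noteq> 0" for z :: real
  proof -
    have "(\<Sum>m\<le>n. of_int (a m) * complex_of_real z ^ m) = of_real (\<Sum>m\<le>n. of_int (a m) * z ^ m)"
      by simp
    then show ?thesis using root[of "of_real z"] that by (simp only: of_real_eq_0_iff) simp
  qed
  have eig_le: "norm \<mu> \<le> r" if "eigenvalue C \<mu>" for \<mu>
    unfolding r_def using spectral_radius_mem_max(2)[OF Cn n0] that by (auto simp: spectrum_def)
  have p0: "coeff ?P 0 \<noteq> 0"
  proof -
    have "?P \<noteq> 0" using deg n0 by auto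
    then have "poly ?P 0 \<noteq> 0"
      using skew by (auto simp: skew_reciprocal_def eigenvalue_mset_def C_def)
    then show ?thesis by (simp add: poly_0_coeff_0)
  qed
  have en: "even n" by (simp add: n_def)
  have sk: "coeff ?P (n - k) = (- 1) ^ k * coeff ?P 0 * coeff ?P k" if "k \<le> n" for k
    using skew that unfolding C_def[symmetric] skew_reciprocal_iff[OF Cn en p0] by blast
  define \<epsilon> where "\<epsilon> = coeff (char_poly A) 0"
  have \<epsilon>: "coeff ?P 0 = of_int \<epsilon>" by (simp add: cP \<epsilon>_def)
  \<comment> \<open>The symmetry at \<open>k = 0\<close> compares the leading coefficient 1 with the
    square of the constant one.\<close>
  have "(of_int (\<epsilon> * \<epsilon>) :: complex) = of_int 1"
    using sk[of 0] degree_monic_char_poly[OF Cn] by (simp add: \<epsilon>)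
  then have "\<epsilon> * \<epsilon> = 1" by (simp only: of_int_eq_iff)
  then have eps: "\<epsilon> = 1 \<or> \<epsilon> = - 1" by (metis zmult_eq_1_iff)
  have Mt: "1 < recip_sum g t"
  proof -
    have "1 / mu g < t" using r by (simp add: t_def frac_less2)
    then show ?thesis
      using recip_sum_strict_mono[OF g, of "1 / mu g" t] recip_sum_mu[OF g] mu_gt_1[OF g] by simp
  qed
  have sc: "skew_coeffs g t a \<epsilon>"
  proof
    show "a (2 * g - m) = \<epsilon> * (- 1) ^ m * a m" if "m \<le> 2 * g" for m
    proof -
      have m: "m \<le> n" using that by (simp add: n_def)
      have "of_int (a (n - m)) = coeff ?P m" using am[of "n - m"] m by simp
      also have "\<dots> = (- 1) ^ m * coeff ?P 0 * ((- 1) ^ m * coeff ?P 0 * coeff ?P m)"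
      proof -
        have "(- 1) ^ m * (- 1) ^ m = (1 :: complex)" by (simp flip: power_mult_distrib)
        moreover have "coeff ?P 0 * coeff ?P 0 = 1"
          using \<open>\<epsilon> * \<epsilon> = 1\<close> unfolding \<epsilon> by (metis of_int_1 of_int_mult)
        ultimately show ?thesis by (metis (no_types, opaque_lifting) mult.assoc mult.commute mult.left_neutral)
      qed
      also have "\<dots> = (- 1) ^ m * coeff ?P 0 * coeff ?P (n - m)" by (simp only: sk[OF m])
      also have "\<dots> = of_int (\<epsilon> * (- 1) ^ m * a m)" using am[OF m] by (simp add: \<epsilon>)
      finally show ?thesis by (simp only: n_def of_int_eq_iff)
    qed
    have "l = of_real r" by (rule pv(2)[OF l])
    then show "(\<Sum>m\<le>2 * g. of_int (a m) * t ^ m) = 0"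
      using real_root[of t] l t by (simp add: t_def n_def)
    show "z = of_real t" if z: "norm z = t" "(\<Sum>m\<le>2 * g. of_int (a m) * z ^ m) = 0" for z :: complex
    proof -
      have z0: "z \<noteq> 0" using z t by auto
      then have "eigenvalue C (1 / z)" using root z by (simp add: n_def)
      moreover have "norm (1 / z) = r" using z r by (simp add: norm_divide t_def)
      ultimately have "1 / z = of_real r" by (rule pv(2))
      then show ?thesis using z0 r by (auto simp: t_def field_simps)
    qed
    show "1 < t ^ (g - (if odd g then 2 else 1)) + t ^ (g + (if odd g then 2 else 1)) + t ^ (2 * g)"
      using Mt by (simp only: recip_sum_def gap_def)
  qed (use g t a_zero eps in auto)
  show False
  proof (cases "g = 3")
    case False
    then show False
      using generic_impossible[OF n_def sc] middle_power_gt[OF g False t Mt] by blast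
  next
    case True
    show False
    proof (rule three_impossible)
      show "n = 6" using True by (simp add: n_def)
      show "skew_coeffs 3 t a \<epsilon>" using sc True by simp
      fix s assume s: "0 < s" "s < t"
      define Q where "Q z = (\<Sum>m\<le>n. of_int (a m) * z ^ m)" for z :: real
      \<comment> \<open>A zero below \<open>t\<close> would be the reciprocal of an eigenvalue
        larger than \<open>r\<close>; as \<open>Q 0 = 1\<close>, the polynomial therefore stays
        positive up to \<open>s\<close>.\<close>
      have nz: "Q z \<noteq> 0" if "0 < z" "z \<le> s" for z
      proof
        assume "Q z = 0"
        then have "eigenvalue C (of_real (1 / z))" using real_root[of z] that by (simp add: Q_def)
        then have "norm (complex_of_real (1 / z)) \<le> r" by (rule eig_le)
        then have "1 / z \<le> r" using that by (simp add: norm_divide)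
        moreover have "r < 1 / z"
        proof -
          have "r * s < 1" using s r by (simp add: t_def field_simps)
          moreover have "r * z \<le> r * s" using that r by (intro mult_left_mono) auto
          ultimately have "r * z < 1" by linarith
          then show ?thesis using that by (simp add: pos_less_divide_eq)
        qed
        ultimately show False by simp
      qed
      have Q0: "Q 0 = 1" 
      proof -
        have "Q 0 = (\<Sum>m\<in>{0}. of_int (a m) * 0 ^ m)"
          unfolding Q_def by (intro sum.mono_neutral_right) auto
        then show ?thesis using a_zero by simp
      qed
      have "0 < Q s"
      proof (rule ccontr)
        assume "\<not> ?thesis"
        then have "\<exists>z\<ge>0. z \<le> s \<and> Q z = 0"
          using s Q0 unfolding Q_def by (intro IVT2') (auto intro!: continuous_intros)
        then obtain z where z: "0 \<le> z" "z \<le> s" "Q z = 0" by auto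
        then show False using nz[of z] Q0 by (cases "z = 0") auto
      qed
      then show "0 < (\<Sum>m\<le>6. of_int (a m) * s ^ m)" using True by (simp add: Q_def n_def)
    qed
  qed
qed

subsection \<open>A matrix attaining the bound\<close>

text \<open>Reducing the Bezout multiplier modulo \<open>q\<close> keeps \<open>p * u\<close> below
  \<open>p * q\<close>, so the remainder \<open>m - p * u\<close> is not truncated and is divisible
  by \<open>q\<close>.\<close>

lemma coprime_nat_combination:
  fixes p q m :: nat
  assumes co: "coprime p q" and p: "0 < p" and q: "0 < q" and m: "p * q \<le> m"
  shows "\<exists>u v. m = u * p + v * q"
proof -
  obtain x y where xy: "p * x = q * y + 1"
    using bezout_nat[of p q] p co by auto
  define u where "u = (m * x) mod q"
  have "p * u \<le> p * q" using q by (simp add: u_def less_imp_le)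
  then have le: "p * u \<le> m" using m by (rule order_trans)
  have "(p * u) mod q = (m * (p * x)) mod q" by (simp add: u_def mod_mult_right_eq ac_simps)
  also have "\<dots> = (m + q * (y * m)) mod q" unfolding xy by (simp add: algebra_simps)
  also have "\<dots> = m mod q" by simp
  finally have "q dvd m - p * u" using le by (metis mod_eq_dvd_iff_nat)
  then obtain v where "m - p * u = v * q" by (metis dvd_def mult.commute)
  then show ?thesis using le by (intro exI[of _ u] exI[of _ v]) (simp add: mult.commute)
qed

lemma pow_mat_nonneg:
  fixes A :: "int mat"
  assumes A: "A \<in> carrier_mat n n" and nn: "nonneg_matrix A" and "i < n" "j < n"
  shows "0 \<le> (A ^\<^sub>m k) $$ (i, j)"
  using assms(3-)
proof (induction k arbitrary: j)
  case 0
  then show ?case using A by simp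
next
  case (Suc k)
  have "(A ^\<^sub>m Suc k) $$ (i, j) = (\<Sum>l<n. (A ^\<^sub>m k) $$ (i, l) * A $$ (l, j))"
    using index_mult_mat_sum[OF pow_carrier_mat[OF A] A Suc.prems] by simp
  also have "0 \<le> \<dots>" using Suc nn A by (intro sum_nonneg mult_nonneg_nonneg) (auto simp: nonneg_matrix_def)
  finally show ?case .
qed

lemma pow_mat_add:
  fixes A :: "'a :: semiring_1 mat"
  assumes A: "A \<in> carrier_mat n n"
  shows "A ^\<^sub>m (k + l) = A ^\<^sub>m k * A ^\<^sub>m l"
proof (induction l)
  case 0
  then show ?case using pow_carrier_mat[OF A, of k] A by simp
next
  case (Suc l)
  then show ?case
    using assoc_mult_mat[OF pow_carrier_mat[OF A, of k] pow_carrier_mat[OF A, of l] A] by simp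
qed

lemma pow_mat_pos_trans:
  fixes A :: "int mat"
  assumes A: "A \<in> carrier_mat n n" and nn: "nonneg_matrix A" and i: "i < n" "j < n" "h < n"
    and ij: "0 < (A ^\<^sub>m k) $$ (i, j)" and jh: "0 < (A ^\<^sub>m l) $$ (j, h)"
  shows "0 < (A ^\<^sub>m (k + l)) $$ (i, h)"
proof -
  have "0 < (A ^\<^sub>m k) $$ (i, j) * (A ^\<^sub>m l) $$ (j, h)" using ij jh by simp
  also have "\<dots> \<le> (\<Sum>m<n. (A ^\<^sub>m k) $$ (i, m) * (A ^\<^sub>m l) $$ (m, h))"
    using i pow_mat_nonneg[OF A nn] by (intro member_le_sum) auto
  also have "\<dots> = (A ^\<^sub>m (k + l)) $$ (i, h)"
    using index_mult_mat_sum[OF pow_carrier_mat[OF A] pow_carrier_mat[OF A] i(1,3)]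
    by (simp add: pow_mat_add[OF A])
  finally show ?thesis .
qed

text \<open>Through vertex \<open>n - 1\<close> pass cycles of the coprime lengths \<open>n\<close>
  and \<open>n - d\<close>, so closed walks of every length from \<open>n * (n - d)\<close> on exist
  there. Any \<open>i\<close> and \<open>j\<close> are joined through this vertex.\<close>

lemma primitive_of_coprime_loops:
  fixes A :: "int mat"
  assumes A: "A \<in> carrier_mat n n" and nn: "nonneg_matrix A" and n: "0 < n"
    and step: "\<And>i. Suc i < n \<Longrightarrow> 0 < A $$ (i, Suc i)"
    and last: "0 < A $$ (n - 1, 0)" "0 < A $$ (n - 1, d)" and d: "d < n" "coprime n d"
  shows "primitive_matrix A"
proof -
  have pt: "0 < (A ^\<^sub>m (k + l)) $$ (i, h)"
    if "0 < (A ^\<^sub>m k) $$ (i, j)" "0 < (A ^\<^sub>m l) $$ (j, h)" "i < n" "j < n" "h < n" for i j h k l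
    using pow_mat_pos_trans[OF A nn] that by blast
  have edge: "0 < (A ^\<^sub>m 1) $$ (i, j)" if "0 < A $$ (i, j)" for i j using that A by simp
  have path: "i + k < n \<Longrightarrow> 0 < (A ^\<^sub>m k) $$ (i, i + k)" for i k
  proof (induction k)
    case 0
    then show ?case using A by simp
  next
    case (Suc k)
    then show ?case using pt[OF Suc.IH edge[OF step[of "i + k"]]] by simp
  qed
  have loop: "0 < (A ^\<^sub>m (n - c)) $$ (n - 1, n - 1)" if "0 < A $$ (n - 1, c)" "c < n" for c
  proof -
    have "0 < (A ^\<^sub>m (1 + (n - 1 - c))) $$ (n - 1, n - 1)"
      by (rule pt[OF edge[OF that(1)]]) (use path[of c "n - 1 - c"] that n in auto)
    moreover have "1 + (n - 1 - c) = n - c" using that by simp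
    ultimately show ?thesis by (simp only:)
  qed
  have loops: "0 < (A ^\<^sub>m (u * l)) $$ (n - 1, n - 1)" if "0 < (A ^\<^sub>m l) $$ (n - 1, n - 1)" for u l
  proof (induction u)
    case 0
    then show ?case using A n by simp
  next
    case (Suc u)
    then show ?case using pt[OF that Suc.IH] n by simp
  qed
  have co: "coprime n (n - d)"
    using d gcd_diff2_nat[of d n] by (simp add: coprime_iff_gcd_eq_1 gcd.commute)
  have pos: "0 < (A ^\<^sub>m (n * (n - d) + 2 * n)) $$ (i, j)" if ij: "i < n" "j < n" for i j
  proof -
    \<comment> \<open>The length of the closed walk is chosen so that, with \<open>n - 1 - i\<close>
      steps before it and \<open>1 + j\<close> after it, the total does not depend on
      \<open>i\<close> and \<open>j\<close>.\<close>
    have "n * (n - d) \<le> n * (n - d) + (i + n - j)" by simp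
    from coprime_nat_combination[OF co n _ this] d obtain u v
      where uv: "n * (n - d) + (i + n - j) = u * n + v * (n - d)" by auto
    have "0 < (A ^\<^sub>m (u * n)) $$ (n - 1, n - 1)" "0 < (A ^\<^sub>m (v * (n - d))) $$ (n - 1, n - 1)"
      using loops loop[of 0] loop[of d] last d n by auto
    from pt[OF this] n have "0 < (A ^\<^sub>m (u * n + v * (n - d))) $$ (n - 1, n - 1)" by simp
    from pt[OF path[of i "n - 1 - i"], of "u * n + v * (n - d)" "n - 1"] this ij n
    have "0 < (A ^\<^sub>m ((n - 1 - i) + (u * n + v * (n - d)))) $$ (i, n - 1)" by simp
    from pt[OF this edge[OF last(1)]] ij n
    have "0 < (A ^\<^sub>m ((n - 1 - i) + (u * n + v * (n - d)) + 1)) $$ (i, 0)" by simp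
    from pt[OF this, of j j] path[of 0 j] ij n
    have "0 < (A ^\<^sub>m ((n - 1 - i) + (u * n + v * (n - d)) + 1 + j)) $$ (i, j)" by simp
    moreover have "(n - 1 - i) + (u * n + v * (n - d)) + 1 + j = n * (n - d) + 2 * n"
      unfolding uv[symmetric] using ij by simp
    ultimately show ?thesis by (simp only:)
  qed
  have "pos_matrix (A ^\<^sub>m (n * (n - d) + 2 * n))"
    using pos A pow_carrier_mat[OF A] by (auto simp: pos_matrix_def)
  moreover have "0 < n * (n - d) + 2 * n" using n by simp
  ultimately have "\<exists>k>0. pos_matrix (A ^\<^sub>m k)" by blast
  then show ?thesis using A nn by (simp add: primitive_matrix_def)
qed

definition companion :: "(nat \<Rightarrow> 'a :: comm_ring_1) \<Rightarrow> nat \<Rightarrow> 'a mat" where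
  "companion c n = mat n n (\<lambda>(i, j). if i + 1 = n then c j else if j = i + 1 then 1 else 0)"

lemma companion_carrier [simp]: "companion c n \<in> carrier_mat n n"
  by (simp add: companion_def)

text \<open>Multiplication by the unipotent \<open>T\<close>, whose first column holds the powers of
  the variable, clears column 0 except for its last entry, which becomes the polynomial itself. The
  complementary minor is minus the identity, whose determinant cancels the cofactor sign.\<close>

lemma char_poly_companion:
  fixes c :: "nat \<Rightarrow> 'a :: comm_ring_1"
  shows "char_poly (companion c (Suc m)) = monom 1 (Suc m) - (\<Sum>j\<le>m. monom (c j) j)" (is "_ = ?p")
proof -
  define M where "M = char_poly_matrix (companion c (Suc m))"
  define T where "T = mat (Suc m) (Suc m) (\<lambda>(i, j). if j \<le> i then monom (1 :: 'a) (i - j) else 0)"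
  have M: "M \<in> carrier_mat (Suc m) (Suc m)" by (simp add: M_def)
  have T: "T \<in> carrier_mat (Suc m) (Suc m)" by (simp add: T_def)
  have Mij: "M $$ (i, j) = (if i = j then monom 1 1 else 0) - [:companion c (Suc m) $$ (i, j):]"
    if "i \<le> m" "j \<le> m" for i j
    using that by (simp add: M_def char_poly_matrix_def companion_def monom_altdef)
  have Tij: "T $$ (i, j) = (if j \<le> i then monom 1 (i - j) else 0)" if "i \<le> m" "j \<le> m" for i j
    using that by (simp add: T_def)
  have detT: "det T = 1"
  proof -
    have "det T = prod_list (diag_mat T)"
      by (rule det_lower_triangular[OF _ T]) (auto simp: T_def)
    also have "diag_mat T = map (\<lambda>i. 1) [0..<Suc m]"
      unfolding diag_mat_def using T by (intro map_cong) (auto simp: Tij monom_altdef simp del: upt_Suc)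
    finally show ?thesis by (simp add: map_replicate_const del: upt_Suc)
  qed
  have MT: "(M * T) $$ (i, j) = (if i = m then M $$ (m, m) * T $$ (m, j) + (\<Sum>k<m. M $$ (m, k) * T $$ (k, j))
      else monom 1 1 * T $$ (i, j) - T $$ (i + 1, j))" if ij: "i \<le> m" "j \<le> m" for i j
  proof -
    have s: "(M * T) $$ (i, j) = (\<Sum>k\<le>m. M $$ (i, k) * T $$ (k, j))"
      using index_mult_mat_sum[OF M T, of i j] ij by (simp add: lessThan_Suc_atMost)
    show ?thesis
    proof (cases "i = m")
      case True
      then show ?thesis unfolding s by (simp add: add.commute flip: lessThan_Suc_atMost)
    next
      case False
      then have "(\<Sum>k\<le>m. M $$ (i, k) * T $$ (k, j)) = (\<Sum>k\<in>{i, i + 1}. M $$ (i, k) * T $$ (k, j))"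
        using ij by (intro sum.mono_neutral_right) (auto simp: Mij companion_def)
      also have "\<dots> = monom 1 1 * T $$ (i, j) - T $$ (i + 1, j)"
        using ij False by (simp add: Mij companion_def pCons_one)
      finally show ?thesis unfolding s using False by simp
    qed
  qed
  define U where "U = M * T"
  have U: "U \<in> carrier_mat (Suc m) (Suc m)" using M T by (simp add: U_def)
  have upper: "U $$ (i, j) = (if j = i + 1 then - 1 else 0)" if "i < m" "j \<le> m" for i j
  proof -
    have "U $$ (i, j) = monom 1 1 * T $$ (i, j) - T $$ (i + 1, j)" using MT[of i j] that by (simp add: U_def)
    then show ?thesis using that by (auto simp: Tij mult_monom Suc_diff_le monom_altdef one_pCons)
  qed
  have corner: "U $$ (m, 0) = ?p"
  proof -
    have "U $$ (m, 0) = M $$ (m, m) * monom 1 m + (\<Sum>k<m. M $$ (m, k) * monom 1 k)"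
      using MT[of m 0] by (simp add: U_def Tij)
    also have "(\<Sum>k<m. M $$ (m, k) * monom 1 k) = (\<Sum>k<m. - monom (c k) k)"
      by (intro sum.cong) (auto simp: Mij companion_def smult_monom minus_monom)
    also have "M $$ (m, m) * monom 1 m = monom 1 (Suc m) - monom (c m) m"
      by (simp add: Mij companion_def mult_monom smult_monom left_diff_distrib)
    also have "\<dots> + (\<Sum>k<m. - monom (c k) k) = ?p"
      by (simp add: sum_negf flip: lessThan_Suc_atMost)
    finally show ?thesis .
  qed
  have "det U = (\<Sum>i<Suc m. U $$ (i, 0) * cofactor U i 0)"
    by (rule laplace_expansion_column[OF U]) simp
  also have "\<dots> = (\<Sum>i\<in>{m}. U $$ (i, 0) * cofactor U i 0)"
    by (intro sum.mono_neutral_right) (auto simp: upper)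
  also have "\<dots> = ?p * cofactor U m 0" by (simp add: corner)
  also have "cofactor U m 0 = 1"
  proof -
    have "mat_delete U m 0 = (- 1) \<cdot>\<^sub>m 1\<^sub>m m"
      using U by (intro eq_matI) (auto simp: mat_delete_def upper)
    then show ?thesis
      by (simp add: cofactor_def det_smult flip: power_mult_distrib)
  qed
  finally have "det U = ?p" by simp
  moreover have "det U = det M" unfolding U_def using det_mult[OF M T] detT by simp
  ultimately show ?thesis by (simp add: char_poly_def M_def)
qed

text \<open>The adjugate is integral, and a determinant of square 1 is its own inverse.\<close>

lemma invertible_int_of_det:
  fixes A :: "int mat"
  assumes A: "A \<in> carrier_mat n n" and d: "det A * det A = 1"
  shows "invertible_mat A"
proof -
  define B where "B = det A \<cdot>\<^sub>m adj_mat A"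
  have "A * B = 1\<^sub>m n" "B * A = 1\<^sub>m n"
    using adj_mat[OF A] A d
    by (auto simp: B_def mult_smult_distrib[OF A adj_mat(1)[OF A]]
        mult_smult_assoc_mat[OF adj_mat(1)[OF A] A] intro!: eq_matI)
  moreover have "B \<in> carrier_mat n n" using adj_mat(1)[OF A] by (simp add: B_def)
  ultimately show ?thesis using A by (auto simp: invertible_mat_def inverts_mat_def)
qed

lemma det_eq_coeff_char_poly:
  fixes A :: "'a :: comm_ring_1 mat"
  assumes A: "A \<in> carrier_mat n n"
  shows "coeff (char_poly A) 0 = (- 1) ^ n * det A"
proof -
  have S: "{S. S \<subseteq> {0..<n} \<and> card S = n} = {{0..<n}}"
    using card_subset_eq[of "{0..<n}"] by auto
  show ?thesis
    using coeff_char_poly[OF A, of n] A unfolding S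
    by (simp add: det_def' sum_distrib_left mult.assoc)
qed

text \<open>An entry 1 in column \<open>j\<close> of the last row closes a cycle of length
  \<open>2 * g - j\<close>; so the graph consists of cycles of lengths \<open>2 * g\<close>,
  \<open>g + gap g\<close> and \<open>g - gap g\<close> through the last vertex.\<close>

definition mu_matrix :: "nat \<Rightarrow> int mat" where
  "mu_matrix g = companion (\<lambda>j. of_bool (j \<in> {0, g - gap g, g + gap g})) (2 * g)"

context
  fixes g :: nat
  assumes g: "2 \<le> g"
begin

lemma gap_facts: "0 < gap g" "gap g < g" "odd (g + gap g)" "odd (g - gap g)"
  using gap_less[OF g] by (auto simp: gap_def)

lemma mu_matrix_carrier: "mu_matrix g \<in> carrier_mat (2 * g) (2 * g)"
  by (simp add: mu_matrix_def)

lemma char_poly_mu_matrix: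
  "char_poly (mu_matrix g) = monom 1 (2 * g) - monom 1 (g + gap g) - monom 1 (g - gap g) - 1"
proof -
  let ?J = "{0, g - gap g, g + gap g}"
  obtain m where m: "2 * g = Suc m" using g by (cases "2 * g") auto
  have "(\<Sum>j\<le>m. monom (of_bool (j \<in> ?J) :: int) j) = (\<Sum>j\<in>?J. monom 1 j)"
    using gap_facts m by (intro sum.mono_neutral_cong_right) auto
  also have "\<dots> = 1 + monom 1 (g - gap g) + monom 1 (g + gap g)"
    using gap_facts by (simp add: add.assoc)
  finally show ?thesis
    unfolding mu_matrix_def m char_poly_companion by simp
qed

lemma char_poly_complex_mu_matrix:
  "char_poly (complex_of_int_mat (mu_matrix g)) =
    monom 1 (2 * g) - monom 1 (g + gap g) - monom 1 (g - gap g) - 1"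
  unfolding of_int_hom.char_poly_hom[OF mu_matrix_carrier] char_poly_mu_matrix
  by (simp add: hom_distribs)

lemma mu_matrix_GL: "mu_matrix g \<in> GL_int (2 * g)"
proof -
  have "coeff (char_poly (mu_matrix g)) 0 = - 1"
    unfolding char_poly_mu_matrix using gap_facts g by simp
  then have "det (mu_matrix g) = - 1"
    using det_eq_coeff_char_poly[OF mu_matrix_carrier] by simp
  then have "invertible_mat (mu_matrix g)"
    by (intro invertible_int_of_det[OF mu_matrix_carrier]) simp
  then show ?thesis using mu_matrix_carrier by (simp add: GL_int_def)
qed

lemma primitive_mu_matrix: "primitive_matrix (mu_matrix g)"
proof (rule primitive_of_coprime_loops[OF mu_matrix_carrier])
  show "nonneg_matrix (mu_matrix g)" by (auto simp: nonneg_matrix_def mu_matrix_def companion_def)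
  show "0 < 2 * g" using g by simp
  show "0 < mu_matrix g $$ (i, Suc i)" if "Suc i < 2 * g" for i
    using that by (auto simp: mu_matrix_def companion_def)
  show "0 < mu_matrix g $$ (2 * g - 1, 0)" "0 < mu_matrix g $$ (2 * g - 1, g + gap g)"
    using g gap_facts by (auto simp: mu_matrix_def companion_def)
  show "g + gap g < 2 * g" using gap_facts by simp
  have "coprime g (g + gap g)"
  proof -
    \<comment> \<open>\<open>gap g\<close> is 2 only for odd \<open>g\<close>.\<close>
    have "coprime g (gap g)" by (simp add: gap_def)
    then show ?thesis by (simp add: coprime_iff_gcd_eq_1)
  qed
  then show "coprime (2 * g) (g + gap g)" using gap_facts by simp
qed

text \<open>The inner exponents are mirror images of each other and odd, so their sign
  \<open>(- 1) ^ k\<close> cancels the constant coefficient \<open>- 1\<close>.\<close>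

lemma skew_reciprocal_mu_matrix: "skew_reciprocal (complex_of_int_mat (mu_matrix g))"
proof -
  let ?P = "char_poly (complex_of_int_mat (mu_matrix g))"
  have C: "complex_of_int_mat (mu_matrix g) \<in> carrier_mat (2 * g) (2 * g)"
    using mu_matrix_carrier by simp
  have co: "coeff ?P k = of_bool (k = 2 * g) - of_bool (k = g + gap g) - of_bool (k = g - gap g)
      - of_bool (k = 0)" for k
    unfolding char_poly_complex_mu_matrix by (auto simp: coeff_monom)
  have c0: "coeff ?P 0 = - 1" unfolding co using g gap_facts by simp
  have "coeff ?P (2 * g - k) = (- 1) ^ k * coeff ?P 0 * coeff ?P k" if k: "k \<le> 2 * g" for k
  proof -
    consider "k = 0" | "k = 2 * g" | "k = g - gap g" | "k = g + gap g"
      | "k \<notin> {0, 2 * g, g - gap g, g + gap g}" by auto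
    then show ?thesis
    proof cases
      case 5
      then have "2 * g - k \<notin> {0, 2 * g, g - gap g, g + gap g}" using k gap_facts by auto
      then show ?thesis using 5 by (simp add: co)
    qed (use gap_facts g in \<open>auto simp: co[of "_ - _"] co[of "_ + _"] co[of 0] co[of "2 * g"]\<close>)
  qed
  then show ?thesis using skew_reciprocal_iff[OF C] c0 by simp
qed

text \<open>By the triangle inequality the modulus of an eigenvalue makes \<open>mu_poly g\<close>
  nonpositive, while \<open>mu_poly g\<close> is positive beyond \<open>mu g\<close>.\<close>

lemma spectral_radius_mu_matrix: "spectral_radius (complex_of_int_mat (mu_matrix g)) = mu g"
proof -
  let ?C = "complex_of_int_mat (mu_matrix g)"
  have C: "?C \<in> carrier_mat (2 * g) (2 * g)" using mu_matrix_carrier by simp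
  have n: "0 < 2 * g" using g by simp
  have P: "poly (char_poly ?C) z = z ^ (2 * g) - z ^ (g + gap g) - z ^ (g - gap g) - 1" for z
    by (simp add: char_poly_complex_mu_matrix poly_monom)
  have m1: "1 < mu g" by (rule mu_gt_1[OF g])
  show ?thesis
  proof (rule antisym)
    have "poly (char_poly ?C) (of_real (mu g)) = of_real (poly (mu_poly g) (mu g))"
      unfolding P poly_mu_poly by simp
    then have "of_real (mu g) \<in> spectrum ?C"
      using mu_greatest_root(1)[OF g] eigenvalue_root_char_poly[OF C] by (simp add: spectrum_def)
    then have "norm (complex_of_real (mu g)) \<in> norm ` spectrum ?C" by (rule imageI)
    from spectral_radius_mem_max(2)[OF C n this] m1
    show "mu g \<le> spectral_radius ?C" by simp
  next
    obtain z where z: "z \<in> spectrum ?C" "spectral_radius ?C = norm z"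
      using spectral_radius_mem_max(1)[OF C n] by auto
    then have "poly (char_poly ?C) z = 0"
      using eigenvalue_root_char_poly[OF C] by (simp add: spectrum_def)
    then have "z ^ (2 * g) = z ^ (g + gap g) + z ^ (g - gap g) + 1" unfolding P by (simp add: algebra_simps)
    then have "norm z ^ (2 * g) = norm (z ^ (g + gap g) + z ^ (g - gap g) + 1)" by (metis norm_power)
    also have "\<dots> \<le> norm z ^ (g + gap g) + norm z ^ (g - gap g) + 1"
      by (metis (no_types) norm_power norm_one norm_triangle_mono norm_triangle_ineq order_refl)
    finally have le: "poly (mu_poly g) (norm z) \<le> 0" unfolding poly_mu_poly by simp
    show "spectral_radius ?C \<le> mu g"
    proof (rule ccontr)
      assume "\<not> ?thesis"
      then have gt: "mu g < norm z" using z by simp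
      then have "recip_sum g (1 / norm z) < recip_sum g (1 / mu g)"
        using m1 by (intro recip_sum_strict_mono[OF g]) (auto simp: frac_less2)
      then have "0 < norm z ^ (2 * g) * (1 - recip_sum g (1 / norm z))"
        using recip_sum_mu[OF g] gt m1 by (intro mult_pos_pos zero_less_power) auto
      moreover have "0 < norm z" using gt m1 by linarith
      ultimately show False using le poly_mu_poly_recip[OF g, of "norm z"] by linarith
    qed
  qed
qed

end

theorem theorem5:
  fixes g :: nat
  assumes "g \<ge> 2"
  shows "(\<exists>A \<in> GL_int (2 * g).
            primitive_matrix A \<and> skew_reciprocal (complex_of_int_mat A) \<and>
            spectral_radius (complex_of_int_mat A) > 1 \<and>
            spectral_radius (complex_of_int_mat A) = mu g) \<and>
         (\<forall>A \<in> GL_int (2 * g).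
            primitive_matrix A \<longrightarrow> skew_reciprocal (complex_of_int_mat A) \<longrightarrow>
            spectral_radius (complex_of_int_mat A) > 1 \<longrightarrow>
            mu g \<le> spectral_radius (complex_of_int_mat A))"
proof (intro conjI ballI impI)
  have "1 < spectral_radius (complex_of_int_mat (mu_matrix g))"
    using spectral_radius_mu_matrix[OF assms] mu_gt_1[OF assms] by simp
  then show "\<exists>A \<in> GL_int (2 * g).
            primitive_matrix A \<and> skew_reciprocal (complex_of_int_mat A) \<and>
            spectral_radius (complex_of_int_mat A) > 1 \<and>
            spectral_radius (complex_of_int_mat A) = mu g"
    using mu_matrix_GL[OF assms] primitive_mu_matrix[OF assms]
      skew_reciprocal_mu_matrix[OF assms] spectral_radius_mu_matrix[OF assms] by blast
next
  fix A
  assume "A \<in> GL_int (2 * g)" "primitive_matrix A" "skew_reciprocal (complex_of_int_mat A)"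
    "spectral_radius (complex_of_int_mat A) > 1"
  then show "mu g \<le> spectral_radius (complex_of_int_mat A)"
    using lower_bound[OF assms, of A] by (simp add: GL_int_def)
qed

end
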